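(* Let $\bar\epsilon\in\mathrm{int}(\mathcal{E})$ be such that $\{\bar\epsilon\}$ is a singleton invariancy set, and suppose that both the primal and dual nondegeneracy conditions hold at $\bar\epsilon$. Let $\{\bar{\mathcal{B}},\bar{\mathcal{N}},\bar{\mathcal{R}},\{\bar{\mathcal{T}}_1,\bar{\mathcal{T}}_2,\bar{\mathcal{T}}_3\}\}=\pi(\bar\epsilon)$ and let $\chi(\epsilon)=(w(\epsilon);z(\epsilon);u(\epsilon);v(\epsilon))$ be the real analytic mapping near $\bar\epsilon$ defined in the context. Then $\bar\epsilon$ belongs to a nonlinearity interval if and only if, for all $k\ge1$, $$\big(u^i_j(\epsilon)\big)^{(k)}\big|_{\epsilon=\bar\epsilon}=0\quad\forall i\in\bar{\mathcal{T}}_1,\ \forall j=1,\ldots,n_i,$$ $$\big((u^i_1(\epsilon))^2-\|u^i_{2:n_i}(\epsilon)\|^2\big)^{(k)}\big|_{\epsilon=\bar\epsilon}=0\quad\forall i\in\bar{\mathcal{T}}_2,$$ $$\big(v_i(\epsilon)\big)^{(k)}\big|_{\epsilon=\bar\epsilon}=0\quad\forall i\in\bar{\mathcal{T}}_3,$$ where $(\cdot)^{(k)}$ denotes the $k$-th order derivative with respect to $\epsilon$.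
   Context: Setting. Let $\mathbb{L}^{n_i}_+=\{x^i\in\mathbb{R}^{n_i}: x^i_1\ge\|x^i_{2:n_i}\|\}$ ($\|\cdot\|$ the $\ell_2$ norm), with interior $\mathrm{int}(\mathbb{L}^{n_i}_+)=\{x^i: x^i_1>\|x^i_{2:n_i}\|\}$ and boundary $\mathrm{bd}(\mathbb{L}^{n_i}_+)=\{x^i: x^i_1=\|x^i_{2:n_i}\|\}$. Let $\mathcal{L}^{\bar n}_+=\mathbb{L}^{n_1}_+\times\cdots\times\mathbb{L}^{n_p}_+$, $\bar n=\sum_{i=1}^p n_i$. Data: $A=(A^1,\ldots,A^p)\in\mathbb{R}^{m\times\bar n}$ with $A^i\in\mathbb{R}^{m\times n_i}$, $b\in\mathbb{R}^m$, $c,\bar c\in\mathbb{R}^{\bar n}$, $\bar c\ne0$ fixed. For $\epsilon\in\mathbb{R}$ consider $(\mathrm{P}_\epsilon)$: $\inf_x\{(c+\epsilon\bar c)^Tx: Ax=b,\ x\in\mathcal{L}^{\bar n}_+\}$ and $(\mathrm{D}_\epsilon)$: $\sup_{(y;s)}\{b^Ty: A^Ty+s=c+\epsilon\bar c,\ s\in\mathcal{L}^{\bar n}_+\}$, with vectors partitioned as $x=(x^1;\ldots;x^p)$, $s=(s^1;\ldots;s^p)$. Standing assumptions: $A$ has full row rank, and at $\epsilon=0$ there is a feasible $(x;y;s)$ of $(\mathrm{P}_0)$ and $(\mathrm{D}_0)$ with $x^i,s^i\in\mathrm{int}(\mathbb{L}^{n_i}_+)$ for all $i$. $\psi(\epsilon)\in\mathbb{R}\cup\{\pm\infty\}$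 is the optimal value of $(\mathrm{P}_\epsilon)$; $\mathcal{E}=\{\epsilon:\psi(\epsilon)\in\mathbb{R}\}$, which is a non-singleton closed interval. The optimal sets are $\mathcal{P}^*(\epsilon)=\{x\in\mathcal{L}^{\bar n}_+: Ax=b,\ (c+\epsilon\bar c)^Tx=\psi(\epsilon)\}$ and $\mathcal{D}^*(\epsilon)=\{(y;s): s\in\mathcal{L}^{\bar n}_+,\ A^Ty+s=c+\epsilon\bar c,\ b^Ty=\psi(\epsilon)\}$; they are nonempty and compact for $\epsilon\in\mathrm{int}(\mathcal{E})$. Optimal partition. $\mathcal{B}(\epsilon)=\{i:\exists x\in\mathcal{P}^*(\epsilon),\ x^i\in\mathrm{int}(\mathbb{L}^{n_i}_+)\}$; $\mathcal{N}(\epsilon)=\{i:\exists (y;s)\in\mathcal{D}^*(\epsilon),\ s^i\in\mathrm{int}(\mathbb{L}^{n_i}_+)\}$; $\mathcal{R}(\epsilon)=\{i:\exists (x;y;s)\in\mathcal{P}^*(\epsilon)\times\mathcal{D}^*(\epsilon),\ x^i,s^i\in\mathrm{bd}(\mathbb{L}^{n_i}_+)\setminus\{0\}\}$; $\mathcal{T}(\epsilon)=\{1,\ldots,p\}\setminus(\mathcal{B}(\epsilon)\cup\mathcal{N}(\epsilon)\cup\mathcal{R}(\epsilon))$. $\mathcal{T}(\epsilon)$ is further partitioned into $\mathcal{T}_1(\epsilon)=\{i\in\mathcal{T}(\epsilon): x^i=s^i=0\ \forall (x;y;s)\in\mathcal{P}^*(\epsilon)\times\mathcal{D}^*(\epsilon)\}$;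 $\mathcal{T}_2(\epsilon)=\{i\in\mathcal{T}(\epsilon):\exists x\in\mathcal{P}^*(\epsilon),\ x^i\in\mathrm{bd}(\mathbb{L}^{n_i}_+)\setminus\{0\}$, and $s^i=0\ \forall (y;s)\in\mathcal{D}^*(\epsilon)\}$; $\mathcal{T}_3(\epsilon)=\{i\in\mathcal{T}(\epsilon):\exists (y;s)\in\mathcal{D}^*(\epsilon),\ s^i\in\mathrm{bd}(\mathbb{L}^{n_i}_+)\setminus\{0\}$, and $x^i=0\ \forall x\in\mathcal{P}^*(\epsilon)\}$. The optimal partition is $\pi(\epsilon)=\{\mathcal{B}(\epsilon),\mathcal{N}(\epsilon),\mathcal{R}(\epsilon),\mathcal{T}(\epsilon)\}$ with $\mathcal{T}(\epsilon)=\{\mathcal{T}_1(\epsilon),\mathcal{T}_2(\epsilon),\mathcal{T}_3(\epsilon)\}$; equality of optimal partitions means equality of all these index sets. Maximally complementary optimal solution at $\epsilon$: $(x^*(\epsilon);y^*(\epsilon);s^*(\epsilon))$ with $x^*(\epsilon)$ in the relative interior of $\mathcal{P}^*(\epsilon)$ and $(y^*(\epsilon);s^*(\epsilon))$ in the relative interior of $\mathcal{D}^*(\epsilon)$. Write $\mathbb{R}_+x=\{\zeta x:\zeta\ge0\}$. Invariancy set: a maximal subset $\mathcal{E}_{\mathrm{inv}}$ of $\mathrm{int}(\mathcal{E})$ such that $\pi(\epsilon')=\pi(\epsilon'')$ for all $\epsilon',\epsilon''\in\mathcal{E}_{\mathrm{inv}}$ and the rays $\mathbb{R}_+x^{*i}(\epsilon)$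 for $i\in\mathcal{R}(\epsilon)\cup\mathcal{T}_2(\epsilon)$ and $\mathbb{R}_+s^{*i}(\epsilon)$ for $i\in\mathcal{R}(\epsilon)\cup\mathcal{T}_3(\epsilon)$ do not vary with $\epsilon\in\mathcal{E}_{\mathrm{inv}}$, where $(x^*(\epsilon);y^*(\epsilon);s^*(\epsilon))$ is any maximally complementary optimal solution at $\epsilon$ (the rays do not depend on this choice). Nonlinearity interval: a non-singleton open maximal subinterval $\mathcal{E}_{\mathrm{non}}$ of $\mathrm{int}(\mathcal{E})$ such that $\pi(\epsilon')=\pi(\epsilon'')$ for all $\epsilon',\epsilon''\in\mathcal{E}_{\mathrm{non}}$, while $\mathbb{R}_+x^{*i}(\epsilon)$ for some $i\in\mathcal{R}(\epsilon)\cup\mathcal{T}_2(\epsilon)$ or $\mathbb{R}_+s^{*i}(\epsilon)$ for some $i\in\mathcal{R}(\epsilon)\cup\mathcal{T}_3(\epsilon)$ varies with $\epsilon$. Nondegeneracy. Let $R^i=\mathrm{diag}(1,-1,\ldots,-1)\in\mathbb{R}^{n_i\times n_i}$ and $L(x^i)=\begin{pmatrix}x^i_1&(x^i_{2:n_i})^T\\ x^i_{2:n_i}&x^i_1I_{n_i-1}\end{pmatrix}$. For matrices $N^i$ with $m$ rows, $(N^i)_I$ is the matrix formed by putting $N^i$, $i\in I$, side by side. Let $(x^*(\epsilon);y^*(\epsilon);s^*(\epsilon))$ be a maximally complementary optimal solution. $x^*(\epsilon)$ is primal nondegenerate if $\big((A^i\bar P^{*i}(\epsilon))_{\mathcal{R}(\epsilon)\cup\mathcal{T}_2(\epsilon)},\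 (A^i)_{\mathcal{B}(\epsilon)}\big)$ has full row rank, where the columns of $\bar P^{*i}(\epsilon)\in\mathbb{R}^{n_i\times(n_i-1)}$ are the normalized (orthonormal) eigenvectors of the positive eigenvalues of $L(x^{*i}(\epsilon))$. $(y^*(\epsilon);s^*(\epsilon))$ is dual nondegenerate if $\big((A^iR^is^{*i}(\epsilon))_{\mathcal{R}(\epsilon)\cup\mathcal{T}_3(\epsilon)},\ (A^i)_{\mathcal{B}(\epsilon)\cup\mathcal{T}_1(\epsilon)\cup\mathcal{T}_2(\epsilon)}\big)$ has full column rank. The primal and dual nondegeneracy conditions hold at $\epsilon$ if there is a maximally complementary optimal solution at $\epsilon$ that is both primal and dual nondegenerate; then the primal-dual optimal solution at $\epsilon$ is unique. The mapping $G$. With index sets taken from $\pi(\bar\epsilon)$, let $w\in\mathbb{R}^m$, $z=(z^i)_{i\in\bar{\mathcal{R}}\cup\bar{\mathcal{N}}\cup\bar{\mathcal{T}}_3}$ with $z^i\in\mathbb{R}^{n_i}$, $u=(u^i)_{i=1}^p$ with $u^i\in\mathbb{R}^{n_i}$, $v=(v_i)_{i\in\bar{\mathcal{R}}\cup\bar{\mathcal{T}}_3}$ with $v_i\in\mathbb{R}$; let $\bar n_c$ be the total dimension of $(w;z;u;v)$. Define $G:\mathbb{R}^{\bar n_c}\times\mathbb{R}\to\mathbb{R}^{\bar n_c}$ as the concatenation of: $-\sum_{i=1}^pA^iu^i-b$; $-u^i-2v_iR^iz^i$ for $i\in\bar{\mathcal{R}}$; $-u^i$ for $i\in\bar{\mathcal{N}}$;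 $-u^i-2v_iR^iz^i$ for $i\in\bar{\mathcal{T}}_3$; $(A^i)^Tw-c^i-\epsilon\bar c^i$ for $i\in\bar{\mathcal{B}}\cup\bar{\mathcal{T}}_1\cup\bar{\mathcal{T}}_2$; $(A^i)^Tw+z^i-c^i-\epsilon\bar c^i$ for $i\in\bar{\mathcal{R}}\cup\bar{\mathcal{N}}\cup\bar{\mathcal{T}}_3$; $(z^i)^TR^iz^i$ for $i\in\bar{\mathcal{R}}\cup\bar{\mathcal{T}}_3$. The mapping $\chi$. Let $(x^*(\bar\epsilon);y^*(\bar\epsilon);s^*(\bar\epsilon))$ be the unique optimal solution at $\bar\epsilon$ and put $w^*(\bar\epsilon)=y^*(\bar\epsilon)$, $z^{*i}(\bar\epsilon)=s^{*i}(\bar\epsilon)$ ($i\in\bar{\mathcal{R}}\cup\bar{\mathcal{N}}\cup\bar{\mathcal{T}}_3$), $u^{*i}(\bar\epsilon)=-x^{*i}(\bar\epsilon)$ (all $i$), $v^*_i(\bar\epsilon)=\tfrac12x^{*i}_1(\bar\epsilon)/s^{*i}_1(\bar\epsilon)$ ($i\in\bar{\mathcal{R}}\cup\bar{\mathcal{T}}_3$). This point is a zero of $G(\cdot,\bar\epsilon)$, and the Jacobian of $G$ with respect to $(w;z;u;v)$ is nonsingular there (known under primal and dual nondegeneracy). By the analytic implicit function theorem there are $\varrho>0$ and a unique real analytic mapping $\chi(\epsilon)=(w(\epsilon);z(\epsilon);u(\epsilon);v(\epsilon))$ on $(\bar\epsilon-\varrho,\bar\epsilon+\varrho)$ with $G(\chi(\epsilon),\epsilon)=0$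 for all such $\epsilon$ and $\chi(\bar\epsilon)=(w^*(\bar\epsilon);z^*(\bar\epsilon);u^*(\bar\epsilon);v^*(\bar\epsilon))$. *)

theory Defs
  imports "HOL-Analysis.Analysis"
begin

text \<open>
  The space of all block vectors \<open>x = (x\<^sup>1; \<dots>; x\<^sup>p)\<close> is \<open>real ^ 'n\<close>: the coordinates \<open>'n\<close>
  are distributed over the blocks \<open>'p\<close> by \<open>block_of\<close>, so that block \<open>i\<close> has the coordinates
  \<open>{j. block_of j = i}\<close> (whose number is the block size), and \<open>head_of i\<close> is the first coordinate
  of block \<open>i\<close>.  A single block \<open>x\<^sup>i\<close> is represented in the same space, padded with zeros outside
  block \<open>i\<close>; consequently \<open>A\<^sup>i x\<^sup>i\<close> is \<open>A *v part D i x\<close>.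
\<close>

record ('m, 'n, 'p) socp =
  block_of :: "'n::finite \<Rightarrow> 'p::finite"
  head_of :: "'p \<Rightarrow> 'n"
  matA :: "real ^ 'n ^ ('m::finite)"
  rhs :: "real ^ 'm"
  cost :: "real ^ 'n"
  dcost :: "real ^ 'n"

definition part :: "('m::finite, 'n::finite, 'p::finite) socp \<Rightarrow> 'p \<Rightarrow> real ^ 'n \<Rightarrow> real ^ 'n" where
  "part D i x = (\<chi> j. if block_of D j = i then x $ j else 0)"

definition tail :: "('m::finite, 'n::finite, 'p::finite) socp \<Rightarrow> 'p \<Rightarrow> 'n set" where
  "tail D i = {j. block_of D j = i \<and> j \<noteq> head_of D i}"

definition tail_norm :: "('m::finite, 'n::finite, 'p::finite) socp \<Rightarrow> 'p \<Rightarrow> real ^ 'n \<Rightarrow> real" where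
  "tail_norm D i x = L2_set (\<lambda>j. x $ j) (tail D i)"

text \<open>Membership of the block \<open>x\<^sup>i\<close> in the second-order cone, its interior, and its boundary
  without the origin.\<close>

definition in_cone :: "('m::finite, 'n::finite, 'p::finite) socp \<Rightarrow> 'p \<Rightarrow> real ^ 'n \<Rightarrow> bool" where
  "in_cone D i x \<longleftrightarrow> x $ head_of D i \<ge> tail_norm D i x"

definition in_int :: "('m::finite, 'n::finite, 'p::finite) socp \<Rightarrow> 'p \<Rightarrow> real ^ 'n \<Rightarrow> bool" where
  "in_int D i x \<longleftrightarrow> x $ head_of D i > tail_norm D i x"

definition in_bd0 :: "('m::finite, 'n::finite, 'p::finite) socp \<Rightarrow> 'p \<Rightarrow> real ^ 'n \<Rightarrow> bool" where
  "in_bd0 D i x \<longleftrightarrow> x $ head_of D i = tail_norm D i x \<and> part D i x \<noteq> 0"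

definition prod_cone :: "('m::finite, 'n::finite, 'p::finite) socp \<Rightarrow> (real ^ 'n) set" where
  "prod_cone D = {x. \<forall>i. in_cone D i x}"

definition cost_at :: "('m::finite, 'n::finite, 'p::finite) socp \<Rightarrow> real \<Rightarrow> real ^ 'n" where
  "cost_at D e = cost D + e *\<^sub>R dcost D"

definition primal_feasible :: "('m::finite, 'n::finite, 'p::finite) socp \<Rightarrow> (real ^ 'n) set" where
  "primal_feasible D = {x \<in> prod_cone D. matA D *v x = rhs D}"

definition dual_feasible ::
  "('m::finite, 'n::finite, 'p::finite) socp \<Rightarrow> real \<Rightarrow> ((real ^ 'm) \<times> (real ^ 'n)) set" where
  "dual_feasible D e =
    {(y, s). s \<in> prod_cone D \<and> transpose (matA D) *v y + s = cost_at D e}"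

definition parametric_socp :: "('m::finite, 'n::finite, 'p::finite) socp \<Rightarrow> bool" where
  "parametric_socp D \<longleftrightarrow>
    (\<forall>i. block_of D (head_of D i) = i) \<and>
    dcost D \<noteq> 0 \<and>
    rank (matA D) = CARD('m) \<and>
    (\<exists>x y s. x \<in> primal_feasible D \<and> (y, s) \<in> dual_feasible D 0 \<and>
      (\<forall>i. in_int D i x \<and> in_int D i s))"

definition opt_val :: "('m::finite, 'n::finite, 'p::finite) socp \<Rightarrow> real \<Rightarrow> ereal" where
  "opt_val D e = (INF x \<in> primal_feasible D. ereal (cost_at D e \<bullet> x))"

definition dom_val :: "('m::finite, 'n::finite, 'p::finite) socp \<Rightarrow> real set" where
  "dom_val D = {e. \<bar>opt_val D e\<bar> \<noteq> \<infinity>}"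

definition primal_opt :: "('m::finite, 'n::finite, 'p::finite) socp \<Rightarrow> real \<Rightarrow> (real ^ 'n) set" where
  "primal_opt D e = {x \<in> primal_feasible D. ereal (cost_at D e \<bullet> x) = opt_val D e}"

definition dual_opt ::
  "('m::finite, 'n::finite, 'p::finite) socp \<Rightarrow> real \<Rightarrow> ((real ^ 'm) \<times> (real ^ 'n)) set" where
  "dual_opt D e = {(y, s) \<in> dual_feasible D e. ereal (rhs D \<bullet> y) = opt_val D e}"

definition setB :: "('m::finite, 'n::finite, 'p::finite) socp \<Rightarrow> real \<Rightarrow> 'p set" where
  "setB D e = {i. \<exists>x \<in> primal_opt D e. in_int D i x}"

definition setN :: "('m::finite, 'n::finite, 'p::finite) socp \<Rightarrow> real \<Rightarrow> 'p set" where
  "setN D e = {i. \<exists>(y, s) \<in> dual_opt D e. in_int D i s}"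

definition setR :: "('m::finite, 'n::finite, 'p::finite) socp \<Rightarrow> real \<Rightarrow> 'p set" where
  "setR D e = {i. \<exists>x \<in> primal_opt D e. \<exists>(y, s) \<in> dual_opt D e. in_bd0 D i x \<and> in_bd0 D i s}"

definition setT :: "('m::finite, 'n::finite, 'p::finite) socp \<Rightarrow> real \<Rightarrow> 'p set" where
  "setT D e = UNIV - (setB D e \<union> setN D e \<union> setR D e)"

definition setT1 :: "('m::finite, 'n::finite, 'p::finite) socp \<Rightarrow> real \<Rightarrow> 'p set" where
  "setT1 D e = {i \<in> setT D e.
    \<forall>x \<in> primal_opt D e. \<forall>(y, s) \<in> dual_opt D e. part D i x = 0 \<and> part D i s = 0}"

definition setT2 :: "('m::finite, 'n::finite, 'p::finite) socp \<Rightarrow> real \<Rightarrow> 'p set" where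
  "setT2 D e = {i \<in> setT D e.
    (\<exists>x \<in> primal_opt D e. in_bd0 D i x) \<and> (\<forall>(y, s) \<in> dual_opt D e. part D i s = 0)}"

definition setT3 :: "('m::finite, 'n::finite, 'p::finite) socp \<Rightarrow> real \<Rightarrow> 'p set" where
  "setT3 D e = {i \<in> setT D e.
    (\<exists>(y, s) \<in> dual_opt D e. in_bd0 D i s) \<and> (\<forall>x \<in> primal_opt D e. part D i x = 0)}"

definition opt_partition ::
  "('m::finite, 'n::finite, 'p::finite) socp \<Rightarrow> real \<Rightarrow>
    'p set \<times> 'p set \<times> 'p set \<times> 'p set \<times> 'p set \<times> 'p set \<times> 'p set" where
  "opt_partition D e =
    (setB D e, setN D e, setR D e, setT D e, setT1 D e, setT2 D e, setT3 D e)"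

definition max_compl ::
  "('m::finite, 'n::finite, 'p::finite) socp \<Rightarrow> real \<Rightarrow> real ^ 'n \<Rightarrow> real ^ 'm \<Rightarrow> real ^ 'n \<Rightarrow> bool" where
  "max_compl D e x y s \<longleftrightarrow>
    x \<in> rel_interior (primal_opt D e) \<and> (y, s) \<in> rel_interior (dual_opt D e)"

definition ray :: "real ^ 'n \<Rightarrow> (real ^ 'n) set" where
  "ray x = {t *\<^sub>R x | t. t \<ge> 0}"

definition partition_const :: "('m::finite, 'n::finite, 'p::finite) socp \<Rightarrow> real set \<Rightarrow> bool" where
  "partition_const D S \<longleftrightarrow> (\<forall>e' \<in> S. \<forall>e'' \<in> S. opt_partition D e' = opt_partition D e'')"

text \<open>Only used together with \<open>partition_const\<close>, so the index sets may be taken at \<open>e'\<close>.\<close>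

definition rays_const :: "('m::finite, 'n::finite, 'p::finite) socp \<Rightarrow> real set \<Rightarrow> bool" where
  "rays_const D S \<longleftrightarrow>
    (\<forall>e' \<in> S. \<forall>e'' \<in> S. \<forall>x' y' s' x'' y'' s''.
      max_compl D e' x' y' s' \<longrightarrow> max_compl D e'' x'' y'' s'' \<longrightarrow>
        (\<forall>i \<in> setR D e' \<union> setT2 D e'. ray (part D i x') = ray (part D i x'')) \<and>
        (\<forall>i \<in> setR D e' \<union> setT3 D e'. ray (part D i s') = ray (part D i s'')))"

definition invariancy_set :: "('m::finite, 'n::finite, 'p::finite) socp \<Rightarrow> real set \<Rightarrow> bool" where
  "invariancy_set D S \<longleftrightarrow>
    S \<subseteq> interior (dom_val D) \<and> partition_const D S \<and> rays_const D S \<and>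
    (\<forall>S'. S \<subseteq> S' \<and> S' \<subseteq> interior (dom_val D) \<and> partition_const D S' \<and> rays_const D S'
      \<longrightarrow> S' = S)"

definition nonlinear_on :: "('m::finite, 'n::finite, 'p::finite) socp \<Rightarrow> real set \<Rightarrow> bool" where
  "nonlinear_on D S \<longleftrightarrow>
    open S \<and> is_interval S \<and> (\<nexists>t. S \<subseteq> {t}) \<and> S \<subseteq> interior (dom_val D) \<and>
    partition_const D S \<and> \<not> rays_const D S"

definition nonlinearity_interval ::
  "('m::finite, 'n::finite, 'p::finite) socp \<Rightarrow> real set \<Rightarrow> bool" where
  "nonlinearity_interval D S \<longleftrightarrow>
    nonlinear_on D S \<and> (\<forall>S'. S \<subseteq> S' \<and> nonlinear_on D S' \<longrightarrow> S' = S)"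

text \<open>The arrow-shaped matrix \<open>L(x\<^sup>i)\<close>, padded with zeros outside block \<open>i\<close>; its eigenvectors for
  positive eigenvalues are those of the unpadded matrix.\<close>

definition arrow ::
  "('m::finite, 'n::finite, 'p::finite) socp \<Rightarrow> 'p \<Rightarrow> real ^ 'n \<Rightarrow> real ^ 'n ^ 'n" where
  "arrow D i x = (\<chi> j k.
    if block_of D j = i \<and> block_of D k = i then
      (if j = k then x $ head_of D i
       else if j = head_of D i then x $ k
       else if k = head_of D i then x $ j
       else 0)
    else 0)"

text \<open>\<open>R = diag(R\<^sup>1, \<dots>, R\<^sup>p)\<close> applied to a vector.\<close>

definition reflect :: "('m::finite, 'n::finite, 'p::finite) socp \<Rightarrow> real ^ 'n \<Rightarrow> real ^ 'n" where
  "reflect D x = (\<chi> j. if j = head_of D (block_of D j) then x $ j else - (x $ j))"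

text \<open>The \<open>n\<^sub>i - 1\<close> columns \<open>Q j\<close> of \<open>P\<^sup>i\<close> are indexed by the tail coordinates of block \<open>i\<close>.\<close>

definition positive_eigencols ::
  "('m::finite, 'n::finite, 'p::finite) socp \<Rightarrow> 'p \<Rightarrow> real ^ 'n \<Rightarrow> ('n \<Rightarrow> real ^ 'n) \<Rightarrow> bool" where
  "positive_eigencols D i x Q \<longleftrightarrow>
    (\<forall>j \<in> tail D i. part D i (Q j) = Q j \<and> (\<exists>l > 0. arrow D i x *v Q j = l *\<^sub>R Q j)) \<and>
    (\<forall>j \<in> tail D i. \<forall>k \<in> tail D i. Q j \<bullet> Q k = (if j = k then 1 else 0))"

text \<open>The matrix with the columns \<open>f j\<close>, \<open>j \<in> J\<close>, padded with zero columns.  The padding does not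
  change the rank, but the number of columns is \<open>card J\<close>.\<close>

definition col_matrix :: "'k::finite set \<Rightarrow> ('k \<Rightarrow> real ^ 'm) \<Rightarrow> real ^ 'k ^ 'm" where
  "col_matrix J f = (\<chi> r j. if j \<in> J then f j $ r else 0)"

definition primal_nondegenerate ::
  "('m::finite, 'n::finite, 'p::finite) socp \<Rightarrow> real \<Rightarrow> real ^ 'n \<Rightarrow> bool" where
  "primal_nondegenerate D e x \<longleftrightarrow>
    (\<exists>Q. (\<forall>i \<in> setR D e \<union> setT2 D e. positive_eigencols D i x Q) \<and>
      rank (col_matrix ((\<Union>i \<in> setR D e \<union> setT2 D e. tail D i) \<union> {j. block_of D j \<in> setB D e})
        (\<lambda>j. if block_of D j \<in> setB D e then column j (matA D) else matA D *v Q j))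
      = CARD('m))"

text \<open>One column \<open>A\<^sup>i R\<^sup>i s\<^sup>i\<close> for each \<open>Inl i\<close>, and one column of \<open>A\<close> for each \<open>Inr j\<close>.\<close>

definition dual_nondegenerate ::
  "('m::finite, 'n::finite, 'p::finite) socp \<Rightarrow> real \<Rightarrow> real ^ 'n \<Rightarrow> bool" where
  "dual_nondegenerate D e s \<longleftrightarrow>
    (let J = Inl ` (setR D e \<union> setT3 D e) \<union>
             Inr ` {j. block_of D j \<in> setB D e \<union> setT1 D e \<union> setT2 D e}
     in rank (col_matrix J
          (case_sum (\<lambda>i. matA D *v part D i (reflect D s)) (\<lambda>j. column j (matA D))))
        = card J)"

definition nondegenerate_at :: "('m::finite, 'n::finite, 'p::finite) socp \<Rightarrow> real \<Rightarrow> bool" where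
  "nondegenerate_at D e \<longleftrightarrow>
    (\<exists>x y s. max_compl D e x y s \<and> primal_nondegenerate D e x \<and> dual_nondegenerate D e s)"

text \<open>
  The unknowns \<open>(w; z; u; v)\<close> of the mapping \<open>G\<close>, with index sets taken at \<open>e0\<close>, form the subspace
  \<open>G_space D e0\<close>: the blocks of \<open>z\<close> and the entries of \<open>v\<close> that are not unknowns are padded with
  zeros.  The value of \<open>G\<close> is padded in the same way.
\<close>

definition G_space ::
  "('m::finite, 'n::finite, 'p::finite) socp \<Rightarrow> real \<Rightarrow>
    ((real ^ 'm) \<times> (real ^ 'n) \<times> (real ^ 'n) \<times> (real ^ 'p)) set" where
  "G_space D e0 = {(w, z, u, v).
    (\<forall>i. i \<notin> setR D e0 \<union> setN D e0 \<union> setT3 D e0 \<longrightarrow> part D i z = 0) \<and>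
    (\<forall>i. i \<notin> setR D e0 \<union> setT3 D e0 \<longrightarrow> v $ i = 0)}"

definition G_map ::
  "('m::finite, 'n::finite, 'p::finite) socp \<Rightarrow> real \<Rightarrow>
    (real ^ 'm) \<times> (real ^ 'n) \<times> (real ^ 'n) \<times> (real ^ 'p) \<Rightarrow> real \<Rightarrow>
    (real ^ 'm) \<times> (real ^ 'n) \<times> (real ^ 'n) \<times> (real ^ 'p)" where
  "G_map D e0 = (\<lambda>(w, z, u, v) e.
    (- (matA D *v u) - rhs D,
     (\<chi> j. let i = block_of D j in
        if i \<in> setR D e0 \<union> setT3 D e0 then - (u $ j) - 2 * v $ i * reflect D z $ j
        else if i \<in> setN D e0 then - (u $ j)
        else 0),
     (\<chi> j. let i = block_of D j in
        if i \<in> setB D e0 \<union> setT1 D e0 \<union> setT2 D e0 then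
          (transpose (matA D) *v w) $ j - cost D $ j - e * dcost D $ j
        else if i \<in> setR D e0 \<union> setN D e0 \<union> setT3 D e0 then
          (transpose (matA D) *v w) $ j + z $ j - cost D $ j - e * dcost D $ j
        else 0),
     (\<chi> i. if i \<in> setR D e0 \<union> setT3 D e0 then part D i z \<bullet> reflect D (part D i z) else 0)))"

definition G_start ::
  "('m::finite, 'n::finite, 'p::finite) socp \<Rightarrow> real \<Rightarrow> real ^ 'n \<Rightarrow> real ^ 'm \<Rightarrow> real ^ 'n \<Rightarrow>
    (real ^ 'm) \<times> (real ^ 'n) \<times> (real ^ 'n) \<times> (real ^ 'p)" where
  "G_start D e0 x y s =
    (y,
     (\<chi> j. if block_of D j \<in> setR D e0 \<union> setN D e0 \<union> setT3 D e0 then s $ j else 0),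
     - x,
     (\<chi> i. if i \<in> setR D e0 \<union> setT3 D e0
           then 1 / 2 * x $ head_of D i / s $ head_of D i else 0))"

definition real_analytic_on :: "(real \<Rightarrow> 'a::real_normed_vector) \<Rightarrow> real set \<Rightarrow> bool" where
  "real_analytic_on f S \<longleftrightarrow>
    (\<forall>t \<in> S. \<exists>r > 0. \<exists>a :: nat \<Rightarrow> 'a. \<forall>h. \<bar>h\<bar> < r \<longrightarrow> (\<lambda>k. h ^ k *\<^sub>R a k) sums f (t + h))"

definition is_chi ::
  "('m::finite, 'n::finite, 'p::finite) socp \<Rightarrow> real \<Rightarrow> real \<Rightarrow>
    (real \<Rightarrow> (real ^ 'm) \<times> (real ^ 'n) \<times> (real ^ 'n) \<times> (real ^ 'p)) \<Rightarrow> bool" where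
  "is_chi D e0 r X \<longleftrightarrow>
    r > 0 \<and> real_analytic_on X {e0 - r<..<e0 + r} \<and>
    (\<forall>e \<in> {e0 - r<..<e0 + r}. X e \<in> G_space D e0 \<and> G_map D e0 (X e) e = 0) \<and>
    (\<exists>x \<in> primal_opt D e0. \<exists>(y, s) \<in> dual_opt D e0. X e0 = G_start D e0 x y s)"

end

theory Submission
  imports Defs
begin

text \<open>
  The criterion holds because, near \<open>e0\<close>, two objects coincide: the optimal solutions, as long as the
  optimal partition does not change, and the branch of zeros of \<open>G\<close>, as long as it keeps the blocks of
  \<open>T\<^sub>1\<close>, \<open>T\<^sub>2\<close>, \<open>T\<^sub>3\<close> in their degenerate position.  That position is described by analytic functions of the
  parameter which vanish at \<open>e0\<close>, so it is kept near \<open>e0\<close> exactly if all their derivatives at \<open>e0\<close> vanish.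

  Since \<open>{e0}\<close> is an invariancy set, \<open>e0\<close> lies in a nonlinearity interval if and only if the partition is constant
  near \<open>e0\<close> (\<open>nonlinearity_interval_iff_partition_locally_const\<close>).  Suppose that it is.  Both problems are strictly
  feasible at parameters near \<open>e0\<close>, so optimal solutions exist and are bounded there, and as the solution
  at \<open>e0\<close> is unique, they converge to it (\<open>kkt_stability\<close>).  With an unchanged partition they are zeros of \<open>G\<close>
  (\<open>kkt_G_eqs\<close>), and zeros of \<open>G\<close> near the starting point are unique because the Jacobian is injective there
  (\<open>G_jacobian_injective\<close>, \<open>G_eqs_diff\<close>).  So the branch consists of optimal solutions and its blocks are positioned as
  the partition says (\<open>partition_const_imp_complementary_branch\<close>).  Conversely, a branch that keeps the degenerate
  blocks in position is feasible and complementary, hence optimal, and by continuity its blocks are positioned as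
  at \<open>e0\<close>.  The partition is then constant provided that the optimal solution is unique
  (\<open>complementary_branch_imp_partition_const\<close>).

  Uniqueness, at \<open>e0\<close> and nearby, rests on a reformulation of nondegeneracy.  Differences of optimal
  solutions lie in \<open>primal_kernel\<close> and \<open>dual_kernel\<close>, closed families of homogeneous conditions, and nondegeneracy
  says that these contain only zero at the given solution (\<open>primal_nondegenerate_kernel\<close>, \<open>dual_nondegenerate_kernel\<close>).
  By compactness of the unit sphere this persists for nearby solutions (\<open>trivial_kernel_persists\<close>).  Injectivity
  of the Jacobian of \<open>G\<close> is reduced to the same two kernels.

  Throughout, \<open>R x\<close> in comments stands for \<open>reflect D x\<close>, and \<open>R\<close> also denotes the block class \<open>setR D e0\<close>.
\<close>

section \<open>Full column rank\<close>

text \<open>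
  A nontrivial relation among the columns lets one column be dropped from the spanning set, which
  costs one dimension.  The statement is about coefficients rather than the set of columns, so
  repeated columns are covered as well.
\<close>

lemma full_column_rank_trivial_kernel:
  fixes f :: "'k::finite \<Rightarrow> real ^ 'm::finite"
  assumes rank: "rank (col_matrix J f) = card J"
    and zero: "(\<Sum>j\<in>J. t j *\<^sub>R f j) = 0" and j: "j \<in> J"
  shows "t j = 0"
proof (rule ccontr)
  assume "t j \<noteq> 0"
  let ?S = "f ` (J - {j})"
  have "t j *\<^sub>R f j = - (\<Sum>k\<in>J - {j}. t k *\<^sub>R f k)"
    using zero j by (simp add: sum.remove add_eq_0_iff)
  also have "\<dots> \<in> span ?S"
    by (intro span_neg span_sum span_scale span_base) auto
  finally have "(1 / t j) *\<^sub>R t j *\<^sub>R f j \<in> span ?S"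
    by (rule span_scale)
  then have fj: "f j \<in> span ?S"
    using \<open>t j \<noteq> 0\<close> by simp
  have "column k (col_matrix J f) \<in> span ?S" for k
  proof -
    have "column k (col_matrix J f) = (if k \<in> J then f k else 0)"
      by (simp add: vec_eq_iff column_def col_matrix_def)
    then show ?thesis
      using fj by (cases "k = j") (auto intro: span_base span_0)
  qed
  then have "columns (col_matrix J f) \<subseteq> span ?S"
    by (auto simp: columns_def)
  then have "dim (columns (col_matrix J f)) \<le> card ?S"
    by (intro dim_le_card) auto
  also have "\<dots> \<le> card (J - {j})"
    by (rule card_image_le) simp
  also have "\<dots> < card J"
    using j by (intro card_Diff1_less) auto
  finally show False
    using rank by (simp add: column_rank_def)
qed

lemma full_row_rank_orthogonal:
  fixes f :: "'k::finite \<Rightarrow> real ^ 'm::finite"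
  assumes rank: "rank (col_matrix J f) = CARD('m)"
    and orth: "\<And>j. j \<in> J \<Longrightarrow> f j \<bullet> y = 0"
  shows "y = 0"
proof -
  have "(transpose (col_matrix J f) *v y) $ j = (if j \<in> J then f j \<bullet> y else 0)" for j
    by (simp add: matrix_vector_mult_def transpose_def col_matrix_def inner_vec_def)
  then have "transpose (col_matrix J f) *v y = 0"
    using orth by (simp add: vec_eq_iff)
  moreover have "inj ((*v) (transpose (col_matrix J f)))"
    using rank by (simp add: full_rank_injective[symmetric] rank_transpose)
  ultimately show ?thesis
    by (metis injD matrix_vector_mult_0_right)
qed

section \<open>Persistence of trivial kernels\<close>

text \<open>
  The parameters that admit a solution in the compact set \<open>K\<close> form a closed set, being the projection
  of \<open>Z\<close> along a compact factor.  This is used both for the kernels of linear systems and for the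
  semicontinuity of the set of optimal solutions.
\<close>

lemma closed_relation_near:
  fixes Z :: "('a::euclidean_space \<times> 'b::euclidean_space) set"
  assumes "closed Z" "compact K" "\<And>x. x \<in> K \<Longrightarrow> (x, p0) \<notin> Z"
  shows "\<forall>\<^sub>F p in nhds p0. \<forall>x\<in>K. (x, p) \<notin> Z"
proof -
  have "closed {p. \<exists>x. x \<in> K \<and> (x, p) \<in> Z}"
    by (intro closed_compact_projection assms)
  then have "open (- {p. \<exists>x. x \<in> K \<and> (x, p) \<in> Z})"
    by (simp add: open_Compl)
  then have "\<forall>\<^sub>F p in nhds p0. p \<in> - {p. \<exists>x. x \<in> K \<and> (x, p) \<in> Z}"
    using assms(3) by (intro eventually_nhds_in_open) auto
  then show ?thesis
    by eventually_elim auto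
qed

text \<open>
  Apply the preceding lemma to the unit sphere: a nonzero solution of a homogeneous system can be
  normalized.  The system is given by its solution set \<open>Z\<close>, since the conditions below mix linear
  equations with proportionality conditions on single blocks.
\<close>

lemma trivial_kernel_persists:
  fixes Z :: "('a::euclidean_space \<times> 'b::euclidean_space) set"
  assumes Z: "closed Z" and scale: "\<And>x p c. (x, p) \<in> Z \<Longrightarrow> (c *\<^sub>R x, p) \<in> Z"
    and trivial: "\<And>x. (x, p0) \<in> Z \<Longrightarrow> x = 0"
  shows "\<forall>\<^sub>F p in nhds p0. \<forall>x. (x, p) \<in> Z \<longrightarrow> x = 0"
proof -
  have "\<forall>\<^sub>F p in nhds p0. \<forall>x\<in>sphere 0 1. (x, p) \<notin> Z"
    using trivial by (intro closed_relation_near Z compact_sphere) (metis norm_zero mem_sphere_0 zero_neq_one)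
  then show ?thesis
  proof eventually_elim
    case (elim p)
    show ?case
    proof (intro allI impI)
      fix x assume "(x, p) \<in> Z"
      then have "((1 / norm x) *\<^sub>R x, p) \<in> Z"
        by (rule scale)
      then show "x = 0"
        using elim by (cases "x = 0") auto
    qed
  qed
qed

section \<open>Analytic functions with vanishing derivatives\<close>

text \<open>
  A vector-valued power series is turned into scalar ones by bounded linear functionals, so that the
  calculus of formal power series applies to each component.
\<close>

lemma real_analytic_on_coordinate_expansion:
  assumes X: "real_analytic_on X S" and t: "t \<in> S" and L: "bounded_linear L"
  shows "\<exists>F. (\<lambda>h. L (X (t + h)) :: real) has_fps_expansion F"
proof -
  obtain r a where r: "r > 0"
    and a: "\<And>h. \<bar>h\<bar> < r \<Longrightarrow> (\<lambda>k. h ^ k *\<^sub>R a k) sums X (t + h)"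
    using X t unfolding real_analytic_on_def by blast
  have "\<forall>\<^sub>F h in nhds 0. h \<in> ball 0 r"
    using r by (intro eventually_nhds_in_open) auto
  then have "\<forall>\<^sub>F h in nhds 0.
      (\<lambda>k. fps_nth (Abs_fps (\<lambda>k. L (a k))) k * h ^ k) sums L (X (t + h))"
  proof eventually_elim
    case (elim h)
    then have "(\<lambda>k. L (h ^ k *\<^sub>R a k)) sums L (X (t + h))"
      by (intro bounded_linear.sums[OF L] a) auto
    then show ?case
      by (simp add: linear_cmul[OF bounded_linear.linear[OF L]] mult.commute)
  qed
  then show ?thesis
    by (blast intro: has_fps_expansionI)
qed

lemma real_analytic_on_tendsto:
  fixes X :: "real \<Rightarrow> 'a::euclidean_space"
  assumes "real_analytic_on X S" "t \<in> S"
  shows "(X \<longlongrightarrow> X t) (nhds t)"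
proof -
  have "isCont X t"
    unfolding isCont_iff tendsto_componentwise_iff[where f = "\<lambda>h. X (t + h)"]
  proof
    fix b :: 'a assume "b \<in> Basis"
    obtain F where "(\<lambda>h. X (t + h) \<bullet> b) has_fps_expansion F"
      using real_analytic_on_coordinate_expansion[OF assms bounded_linear_inner_left] by blast
    from has_fps_expansion_imp_continuous[OF this, of UNIV]
    show "((\<lambda>h. X (t + h) \<bullet> b) \<longlongrightarrow> X t \<bullet> b) (at 0)"
      by (simp add: continuous_within)
  qed
  then show ?thesis
    by (simp add: isCont_def tendsto_at_iff_tendsto_nhds)
qed

lemma has_fps_expansion_higher_deriv:
  fixes f :: "real \<Rightarrow> real"
  assumes "f has_fps_expansion F"
  shows "(deriv ^^ k) f 0 = fact k * fps_nth F k"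
  using assms
proof (induction k arbitrary: f F)
  case 0
  then show ?case
    using eventually_nhds_x_imp_x[of "\<lambda>z. eval_fps F z = f z" 0]
    by (simp add: has_fps_expansion_def eval_fps_at_0)
next
  case (Suc k)
  have "(deriv ^^ k) (deriv f) 0 = fact k * fps_nth (fps_deriv F) k"
    by (intro Suc.IH has_fps_expansion_deriv Suc.prems)
  then show ?case
    by (simp add: funpow_swap1 algebra_simps)
qed

lemma higher_deriv_shift:
  fixes f :: "real \<Rightarrow> real"
  shows "(deriv ^^ k) (\<lambda>h. f (t + h)) = (\<lambda>h. (deriv ^^ k) f (t + h))"
proof (induction k)
  case (Suc k)
  have "deriv (\<lambda>h. g (t + h)) = (\<lambda>h. deriv g (t + h))" for g :: "real \<Rightarrow> real"
    by (simp add: fun_eq_iff deriv_def DERIV_shift add.commute)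
  with Suc show ?case
    by simp
qed simp

text \<open>
  If all derivatives vanish, the power series reduces to its constant term; this is the only place
  where analyticity, rather than smoothness, matters.
\<close>

lemma higher_derivs_zero_iff_locally_constant:
  fixes f :: "real \<Rightarrow> real"
  assumes F: "(\<lambda>h. f (t + h)) has_fps_expansion F"
  shows "(\<forall>k\<ge>1. (deriv ^^ k) f t = 0) \<longleftrightarrow> (\<forall>\<^sub>F e in nhds t. f e = f t)"
proof
  assume zero: "\<forall>k\<ge>1. (deriv ^^ k) f t = 0"
  have "fps_nth F k = 0" if "k \<ge> 1" for k
    using has_fps_expansion_higher_deriv[OF F, of k] higher_deriv_shift[of k f t] zero that
    by simp
  then have "F = fps_const (fps_nth F 0)"
    by (simp add: fps_eq_iff)
  then have eval: "eval_fps F h = fps_nth F 0" for h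
    by (metis eval_fps_const)
  have ev: "\<forall>\<^sub>F h in nhds 0. fps_nth F 0 = f (t + h)"
    using F eval by (simp add: has_fps_expansion_def)
  then have "fps_nth F 0 = f t"
    using eventually_nhds_x_imp_x[OF ev] by simp
  with ev obtain d where "d > 0" "\<And>h. dist h 0 < d \<Longrightarrow> f (t + h) = f t"
    unfolding eventually_nhds_metric by auto
  then have "\<And>e. dist e t < d \<Longrightarrow> f e = f t"
    by (metis add_diff_cancel_left' diff_0_right diff_add_cancel add.commute dist_norm)
  then show "\<forall>\<^sub>F e in nhds t. f e = f t"
    using \<open>d > 0\<close> unfolding eventually_nhds_metric by blast
next
  assume ev: "\<forall>\<^sub>F e in nhds t. f e = f t"
  have const: "(deriv ^^ k) (\<lambda>e::real. c::real) = (\<lambda>e. if k = 0 then c else 0)" for k c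
    by (induction k) (simp_all cong: if_cong)
  show "\<forall>k\<ge>1. (deriv ^^ k) f t = 0"
    using higher_deriv_cong_ev[OF ev refl] by (auto simp: const)
qed

section \<open>Blocks of the second-order cone\<close>

definition block_inner ::
  "('m::finite, 'n::finite, 'p::finite) socp \<Rightarrow> 'p \<Rightarrow> real ^ 'n \<Rightarrow> real ^ 'n \<Rightarrow> real" where
  "block_inner D i x s = (\<Sum>j | block_of D j = i. x $ j * s $ j)"

text \<open>
  If the head coordinate of \<open>a\<close> is nonzero, this says that block \<open>i\<close> of \<open>d\<close> is a multiple of
  that of \<open>a\<close>.  The cross-multiplied form is linear in \<open>d\<close> and, unlike the existence of a factor,
  visibly closed in \<open>(a, d)\<close> jointly.
\<close>

definition block_parallel ::
  "('m::finite, 'n::finite, 'p::finite) socp \<Rightarrow> 'p \<Rightarrow> real ^ 'n \<Rightarrow> real ^ 'n \<Rightarrow> bool" where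
  "block_parallel D i a d \<longleftrightarrow>
    (\<forall>j. block_of D j = i \<longrightarrow> a $ head_of D i * d $ j = d $ head_of D i * a $ j)"

lemma inner_eq_sum_block_inner: "x \<bullet> s = (\<Sum>i\<in>UNIV. block_inner D i x s)"
proof -
  have "x \<bullet> s = (\<Sum>j\<in>UNIV. x $ j * s $ j)"
    by (simp add: inner_vec_def)
  also have "\<dots> = (\<Sum>i\<in>UNIV. \<Sum>j | j \<in> UNIV \<and> block_of D j = i. x $ j * s $ j)"
    by (intro sum.group[symmetric]) auto
  finally show ?thesis
    by (simp add: block_inner_def)
qed

lemma block_inner_commute: "block_inner D i x s = block_inner D i s x"
  by (simp add: block_inner_def mult.commute)

lemma block_inner_zero: "part D i x = 0 \<Longrightarrow> block_inner D i x s = 0"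
  unfolding block_inner_def by (rule sum.neutral) (auto simp: part_def vec_eq_iff split: if_splits)

lemma part_eq_0_iff: "part D i x = 0 \<longleftrightarrow> (\<forall>j. block_of D j = i \<longrightarrow> x $ j = 0)"
  by (auto simp: part_def vec_eq_iff)

lemma tail_norm_square: "(tail_norm D i x)\<^sup>2 = (\<Sum>j\<in>tail D i. (x $ j)\<^sup>2)"
  by (simp add: tail_norm_def L2_set_def sum_nonneg)

lemma tail_norm_nonneg [simp]: "0 \<le> tail_norm D i x"
  by (simp add: tail_norm_def)

lemma tail_norm_scale: "tail_norm D i (c *\<^sub>R x) = \<bar>c\<bar> * tail_norm D i x"
proof -
  have "(tail_norm D i (c *\<^sub>R x))\<^sup>2 = (\<bar>c\<bar> * tail_norm D i x)\<^sup>2"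
    by (simp add: tail_norm_square power_mult_distrib sum_distrib_left)
  then show ?thesis
    by simp
qed

lemma tail_norm_triangle: "tail_norm D i (x + y) \<le> tail_norm D i x + tail_norm D i y"
  unfolding tail_norm_def using L2_set_triangle_ineq[of "($) x" "($) y" "tail D i"]
  by (simp add: L2_set_def)

lemma tail_norm_cong:
  "(\<And>j. block_of D j = i \<Longrightarrow> x $ j = y $ j) \<Longrightarrow> tail_norm D i x = tail_norm D i y"
  by (simp add: tail_norm_def tail_def L2_set_def)

lemma continuous_on_tail_norm [continuous_intros]:
  "continuous_on S f \<Longrightarrow> continuous_on S (\<lambda>t. tail_norm D i (f t))"
  unfolding tail_norm_def L2_set_def by (intro continuous_intros)

lemma tendsto_tail_norm [tendsto_intros]:
  "(f \<longlongrightarrow> l) F \<Longrightarrow> ((\<lambda>t. tail_norm D i (f t)) \<longlongrightarrow> tail_norm D i l) F"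
  unfolding tail_norm_def L2_set_def by (intro tendsto_intros)

lemma in_cone_iff: "in_cone D i x \<longleftrightarrow> in_int D i x \<or> x $ head_of D i = tail_norm D i x"
  by (auto simp: in_cone_def in_int_def)

locale socp_blocks =
  fixes D :: "('m::finite, 'n::finite, 'p::finite) socp"
  assumes head [simp]: "block_of D (head_of D i) = i"
begin

lemma block_eq: "{j. block_of D j = i} = insert (head_of D i) (tail D i)"
  and head_notin_tail [simp]: "head_of D i \<notin> tail D i"
  by (auto simp: tail_def)

lemma all_block_iff:
  "(\<forall>j. block_of D j = i \<longrightarrow> P j) \<longleftrightarrow> P (head_of D i) \<and> (\<forall>j\<in>tail D i. P j)"
  by (auto simp: tail_def)

lemma block_inner_head_tail:
  "block_inner D i x s = x $ head_of D i * s $ head_of D i + (\<Sum>j\<in>tail D i. x $ j * s $ j)"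
  by (simp add: block_inner_def block_eq)

lemma reflect_head [simp]: "reflect D x $ head_of D i = x $ head_of D i"
  by (simp add: reflect_def)

lemma reflect_tail: "j \<in> tail D i \<Longrightarrow> reflect D x $ j = - x $ j"
  by (auto simp: reflect_def tail_def)

lemma reflect_eq_0_iff [simp]: "reflect D x $ j = 0 \<longleftrightarrow> x $ j = 0"
  by (simp add: reflect_def)

lemma block_inner_reflect_self:
  "block_inner D i z (reflect D z) = (z $ head_of D i)\<^sup>2 - (tail_norm D i z)\<^sup>2"
  by (simp add: block_inner_head_tail reflect_tail sum_negf
      tail_norm_square[unfolded power2_eq_square] power2_eq_square)

lemma inner_part_reflect_part:
  "part D i z \<bullet> reflect D (part D i z) = block_inner D i z (reflect D z)"
proof -
  have "part D i z \<bullet> reflect D (part D i z)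
      = (\<Sum>j\<in>UNIV. if block_of D j = i then z $ j * reflect D z $ j else 0)"
    unfolding inner_vec_def by (intro sum.cong) (auto simp: part_def reflect_def)
  also have "\<dots> = block_inner D i z (reflect D z)"
    by (simp add: block_inner_def sum.If_cases)
  finally show ?thesis .
qed

lemma block_inner_reflect: "block_inner D i (reflect D x) s = block_inner D i x (reflect D s)"
  by (simp add: block_inner_head_tail reflect_tail)

lemma cone_head_nonneg: "in_cone D i x \<Longrightarrow> 0 \<le> x $ head_of D i"
  unfolding in_cone_def using tail_norm_nonneg order_trans by blast

lemma cone_square: "in_cone D i x \<Longrightarrow> (tail_norm D i x)\<^sup>2 \<le> (x $ head_of D i)\<^sup>2"
  by (simp add: in_cone_def power_mono)

lemma cone_part_eq_0_iff:
  assumes "in_cone D i x"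
  shows "part D i x = 0 \<longleftrightarrow> x $ head_of D i = 0"
proof
  assume 0: "x $ head_of D i = 0"
  with assms have "(\<Sum>j\<in>tail D i. (x $ j)\<^sup>2) = 0"
    using cone_square tail_norm_square
    by (metis sum_nonneg zero_le_power2 order_antisym power_zero_numeral)
  with 0 show "part D i x = 0"
    by (simp add: part_eq_0_iff all_block_iff sum_nonneg_eq_0_iff)
qed (simp add: part_eq_0_iff)

lemma cone_cases:
  assumes "in_cone D i x"
  shows "part D i x = 0 \<longleftrightarrow> \<not> in_int D i x \<and> \<not> in_bd0 D i x"
  using assms cone_part_eq_0_iff[OF assms] tail_norm_nonneg[of D i x]
  unfolding in_bd0_def in_int_def in_cone_def by linarith

lemma in_int_head_pos: "in_int D i x \<Longrightarrow> 0 < x $ head_of D i"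
  unfolding in_int_def using tail_norm_nonneg le_less_trans by blast

lemma in_bd0_in_cone: "in_bd0 D i x \<Longrightarrow> in_cone D i x"
  by (simp add: in_bd0_def in_cone_def)

lemma in_bd0_head_pos: "in_bd0 D i x \<Longrightarrow> 0 < x $ head_of D i"
  using cone_head_nonneg cone_part_eq_0_iff in_bd0_in_cone
  by (metis in_bd0_def order_le_less)

lemma in_bd0I:
  assumes pos: "0 < x $ head_of D i" and eq: "(x $ head_of D i)\<^sup>2 = (tail_norm D i x)\<^sup>2"
  shows "in_bd0 D i x"
proof -
  have "x $ head_of D i = tail_norm D i x"
    using pos eq by (simp add: power2_eq_iff_nonneg)
  moreover have "part D i x \<noteq> 0"
    using pos by (metis head less_irrefl part_eq_0_iff)
  ultimately show ?thesis
    by (simp add: in_bd0_def)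
qed

lemma in_bd0_square: "in_bd0 D i x \<Longrightarrow> (x $ head_of D i)\<^sup>2 = (tail_norm D i x)\<^sup>2"
  by (simp add: in_bd0_def)

lemma block_inner_nonneg:
  assumes "in_cone D i x" "in_cone D i s"
  shows "0 \<le> block_inner D i x s"
proof -
  have "\<bar>\<Sum>j\<in>tail D i. x $ j * s $ j\<bar> \<le> (\<Sum>j\<in>tail D i. \<bar>x $ j\<bar> * \<bar>s $ j\<bar>)"
    by (simp add: sum_abs[THEN order_trans] abs_mult)
  also have "\<dots> \<le> tail_norm D i x * tail_norm D i s"
    unfolding tail_norm_def by (rule L2_set_mult_ineq)
  also have "\<dots> \<le> x $ head_of D i * s $ head_of D i"
    using assms cone_head_nonneg by (intro mult_mono) (auto simp: in_cone_def)
  finally show ?thesis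
    by (simp add: block_inner_head_tail)
qed

text \<open>
  For blocks of the cone the right-hand side is nonpositive, because \<open>tail_norm\<close> is bounded by the head
  coordinate.  Orthogonality therefore forces every square on the left to vanish, which contains all
  complementarity facts about a single cone without a discussion of equality in the
  Cauchy-Schwarz inequality.
\<close>

lemma complementary_square:
  assumes "block_inner D i x s = 0"
  shows "(\<Sum>j\<in>tail D i. (s $ head_of D i * x $ j + x $ head_of D i * s $ j)\<^sup>2)
    = (s $ head_of D i)\<^sup>2 * ((tail_norm D i x)\<^sup>2 - (x $ head_of D i)\<^sup>2)
      + (x $ head_of D i)\<^sup>2 * ((tail_norm D i s)\<^sup>2 - (s $ head_of D i)\<^sup>2)"
proof -
  let ?x = "x $ head_of D i" and ?s = "s $ head_of D i"
  have tail: "(\<Sum>j\<in>tail D i. x $ j * s $ j) = - (?x * ?s)"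
    using assms by (simp add: block_inner_head_tail)
  have "(\<Sum>j\<in>tail D i. (?s * x $ j + ?x * s $ j)\<^sup>2)
      = (\<Sum>j\<in>tail D i. ?s\<^sup>2 * (x $ j)\<^sup>2 + (2 * ?s * ?x) * (x $ j * s $ j) + ?x\<^sup>2 * (s $ j)\<^sup>2)"
    by (intro sum.cong refl) (simp add: power2_eq_square algebra_simps)
  also have "\<dots> = ?s\<^sup>2 * (tail_norm D i x)\<^sup>2 + (2 * ?s * ?x) * (\<Sum>j\<in>tail D i. x $ j * s $ j)
      + ?x\<^sup>2 * (tail_norm D i s)\<^sup>2"
    by (simp add: sum.distrib sum_distrib_left[symmetric] tail_norm_square)
  finally show ?thesis
    unfolding tail by (simp add: power2_eq_square algebra_simps)
qed

text \<open>
  Both facts come from \<open>complementary_square\<close>: the left-hand squares give proportionality to the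
  reflected vector, and the two terms on the right vanish separately.
\<close>

lemma complementary_cone:
  assumes x: "in_cone D i x" and s: "in_cone D i s" and 0: "block_inner D i x s = 0"
  shows "block_parallel D i (reflect D s) x"
    and "part D i s \<noteq> 0 \<Longrightarrow> \<not> in_int D i x"
proof -
  let ?x = "x $ head_of D i" and ?s = "s $ head_of D i"
  have le: "?s\<^sup>2 * ((tail_norm D i x)\<^sup>2 - ?x\<^sup>2) \<le> 0" "?x\<^sup>2 * ((tail_norm D i s)\<^sup>2 - ?s\<^sup>2) \<le> 0"
    using cone_square[OF x] cone_square[OF s] by (simp_all add: mult_nonneg_nonpos)
  have ge: "0 \<le> (\<Sum>j\<in>tail D i. (?s * x $ j + ?x * s $ j)\<^sup>2)"
    by (simp add: sum_nonneg)
  with le complementary_square[OF 0]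
  have zero: "(\<Sum>j\<in>tail D i. (?s * x $ j + ?x * s $ j)\<^sup>2) = 0"
    and eq: "?s\<^sup>2 * ((tail_norm D i x)\<^sup>2 - ?x\<^sup>2) = 0"
    by linarith+
  have "?s * x $ j = ?x * reflect D s $ j" if "j \<in> tail D i" for j
    using zero that by (simp add: sum_nonneg_eq_0_iff reflect_tail add_eq_0_iff2)
  then show "block_parallel D i (reflect D s) x"
    by (simp add: block_parallel_def all_block_iff)
  assume "part D i s \<noteq> 0"
  with s have "(tail_norm D i x)\<^sup>2 = ?x\<^sup>2"
    using eq by (simp add: cone_part_eq_0_iff)
  then show "\<not> in_int D i x"
    using tail_norm_nonneg[of D i x] cone_head_nonneg[OF x]
    by (simp add: in_int_def)
qed

lemma complementary_interior:
  assumes "in_cone D i x" "in_int D i s" "block_inner D i x s = 0"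
  shows "part D i x = 0"
proof (rule ccontr)
  assume "part D i x \<noteq> 0"
  moreover have "in_cone D i s"
    using assms by (simp add: in_cone_iff)
  ultimately show False
    using complementary_cone(2)[of i s x] assms by (simp add: block_inner_commute)
qed

text \<open>
  The Lorentz form \<open>d \<mapsto> d \<bullet> R d\<close> is negative semidefinite on the tangent hyperplane of the light cone at
  \<open>z\<close>, and its null directions there are the multiples of \<open>z\<close>.  It supplies the second-order
  information that makes the Jacobian of \<open>G\<close> injective.
\<close>

lemma tangent_square:
  assumes z: "in_bd0 D i z" and tan: "block_inner D i z (reflect D d) = 0"
  shows "block_inner D i d (reflect D d) \<le> 0"
    and "block_inner D i d (reflect D d) = 0 \<Longrightarrow> block_parallel D i z d"
proof -
  let ?z = "z $ head_of D i" and ?d = "d $ head_of D i"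
  let ?S = "\<Sum>j\<in>tail D i. (?z * d $ j - ?d * z $ j)\<^sup>2"
  have "?z > 0"
    by (rule in_bd0_head_pos[OF z])
  have tail: "(\<Sum>j\<in>tail D i. z $ j * d $ j) = ?z * ?d"
    using tan by (simp add: block_inner_head_tail reflect_tail sum_negf)
  have "?S = (\<Sum>j\<in>tail D i. ?z\<^sup>2 * (d $ j)\<^sup>2 - (2 * ?z * ?d) * (z $ j * d $ j) + ?d\<^sup>2 * (z $ j)\<^sup>2)"
    by (intro sum.cong refl) (simp add: power2_eq_square algebra_simps)
  also have "\<dots> = ?z\<^sup>2 * (tail_norm D i d)\<^sup>2 - (2 * ?z * ?d) * (\<Sum>j\<in>tail D i. z $ j * d $ j)
      + ?d\<^sup>2 * (tail_norm D i z)\<^sup>2"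
    by (simp add: sum.distrib sum_subtractf sum_distrib_left[symmetric] tail_norm_square)
  also have "\<dots> = - (?z\<^sup>2 * block_inner D i d (reflect D d))"
    unfolding tail in_bd0_square[OF z, symmetric] block_inner_reflect_self
    by (simp add: power2_eq_square algebra_simps)
  finally have S: "?z\<^sup>2 * block_inner D i d (reflect D d) = - ?S"
    by simp
  have "?S \<ge> 0"
    by (simp add: sum_nonneg)
  with S have "?z\<^sup>2 * block_inner D i d (reflect D d) \<le> 0"
    by simp
  moreover have "0 < ?z\<^sup>2"
    using \<open>?z > 0\<close> by simp
  ultimately show "block_inner D i d (reflect D d) \<le> 0"
    by (meson mult_pos_pos not_le)
  assume "block_inner D i d (reflect D d) = 0"
  with S have "?S = 0"
    by simp
  then have "?z * d $ j = ?d * z $ j" if "j \<in> tail D i" for j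
    using that by (simp add: sum_nonneg_eq_0_iff)
  then show "block_parallel D i z d"
    by (simp add: block_parallel_def all_block_iff)
qed

section \<open>The product cone\<close>

lemma prod_cone_0: "0 \<in> prod_cone D"
  by (simp add: prod_cone_def in_cone_def tail_norm_def L2_set_def)

lemma prod_cone_scale: "x \<in> prod_cone D \<Longrightarrow> 0 \<le> c \<Longrightarrow> c *\<^sub>R x \<in> prod_cone D"
  by (simp add: prod_cone_def in_cone_def tail_norm_scale mult_left_mono)

lemma prod_cone_add: "x \<in> prod_cone D \<Longrightarrow> y \<in> prod_cone D \<Longrightarrow> x + y \<in> prod_cone D"
  unfolding prod_cone_def in_cone_def
  by (auto intro!: order_trans[OF tail_norm_triangle] add_mono)

lemma in_int_convex:
  assumes "in_int D i x" "in_cone D i y" "0 < a" "0 \<le> b"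
  shows "in_int D i (a *\<^sub>R x + b *\<^sub>R y)"
proof -
  have "tail_norm D i (a *\<^sub>R x + b *\<^sub>R y) \<le> a * tail_norm D i x + b * tail_norm D i y"
    using tail_norm_triangle[of D i "a *\<^sub>R x" "b *\<^sub>R y"] assms by (simp add: tail_norm_scale)
  also have "\<dots> < a * x $ head_of D i + b * y $ head_of D i"
    using assms by (intro add_less_le_mono mult_strict_left_mono mult_left_mono)
      (auto simp: in_int_def in_cone_def)
  finally show ?thesis
    by (simp add: in_int_def)
qed

lemma prod_cone_inner_nonneg: "x \<in> prod_cone D \<Longrightarrow> s \<in> prod_cone D \<Longrightarrow> 0 \<le> x \<bullet> s"
  unfolding inner_eq_sum_block_inner[of x s D]
  by (intro sum_nonneg block_inner_nonneg) (auto simp: prod_cone_def)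

lemma prod_cone_complementary:
  assumes "x \<in> prod_cone D" "s \<in> prod_cone D" "x \<bullet> s = 0"
  shows "block_inner D i x s = 0"
proof -
  have "\<forall>i\<in>UNIV. block_inner D i x s = 0"
    using assms(3) unfolding inner_eq_sum_block_inner[of x s D]
    by (subst (asm) sum_nonneg_eq_0_iff) (use assms in \<open>auto simp: prod_cone_def block_inner_nonneg\<close>)
  then show ?thesis
    by simp
qed

lemma prod_cone_interior_complementary:
  assumes x: "x \<in> prod_cone D" and s: "\<And>i. in_int D i s" and "x \<bullet> s = 0"
  shows "x = 0"
proof -
  have "s \<in> prod_cone D"
    using s by (simp add: prod_cone_def in_cone_iff)
  then have "part D i x = 0" for i
    using complementary_interior[of i x s] prod_cone_complementary assms
    by (simp add: prod_cone_def)
  then show ?thesis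
    by (metis part_eq_0_iff vec_eq_iff zero_index)
qed

lemma closed_prod_cone: "closed (prod_cone D)"
proof -
  have "prod_cone D = (\<Inter>i. {x. tail_norm D i x \<le> x $ head_of D i})"
    by (auto simp: prod_cone_def in_cone_def)
  then show ?thesis
    by (auto intro!: closed_Collect_le continuous_intros)
qed

text \<open>
  The linear form \<open>x \<mapsto> s \<bullet> x\<close> is positive on the compact set of unit vectors of the cone, hence bounded
  below there.
\<close>

lemma interior_coercive:
  assumes s: "\<And>i. in_int D i s"
  shows "\<exists>\<mu>>0. \<forall>x\<in>prod_cone D. \<mu> * norm x \<le> s \<bullet> x"
proof (cases "prod_cone D \<inter> sphere 0 1 = {}")
  case True
  have "x = 0" if "x \<in> prod_cone D" for x
  proof (rule ccontr)
    assume "x \<noteq> 0"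
    then have "(1 / norm x) *\<^sub>R x \<in> prod_cone D \<inter> sphere 0 1"
      using that by (auto intro: prod_cone_scale)
    with True show False
      by blast
  qed
  then have "\<forall>x\<in>prod_cone D. 1 * norm x \<le> s \<bullet> x"
    by (metis inner_zero_right mult_1 norm_zero order_refl)
  then show ?thesis
    using zero_less_one by blast
next
  case False
  have sK: "s \<in> prod_cone D"
    using s by (simp add: prod_cone_def in_cone_iff)
  have "compact (prod_cone D \<inter> sphere 0 1)"
    by (intro closed_Int_compact closed_prod_cone compact_sphere)
  from this False obtain x0 where x0: "x0 \<in> prod_cone D \<inter> sphere 0 1"
    and min: "\<And>x. x \<in> prod_cone D \<inter> sphere 0 1 \<Longrightarrow> s \<bullet> x0 \<le> s \<bullet> x"
    using continuous_attains_inf[of "prod_cone D \<inter> sphere 0 1" "\<lambda>x. s \<bullet> x"]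
      continuous_on_inner[OF continuous_on_const continuous_on_id]
    by blast
  have "s \<bullet> x0 \<noteq> 0"
    using prod_cone_interior_complementary[of x0 s] s x0 by (auto simp: inner_commute)
  then have "0 < s \<bullet> x0"
    using prod_cone_inner_nonneg[OF sK] x0 by (simp add: order_less_le)
  moreover have "(s \<bullet> x0) * norm x \<le> s \<bullet> x" if "x \<in> prod_cone D" for x
  proof (cases "x = 0")
    case False
    then have "s \<bullet> x0 \<le> s \<bullet> ((1 / norm x) *\<^sub>R x)"
      using that by (intro min) (auto intro: prod_cone_scale)
    with False show ?thesis
      by (simp add: field_simps)
  qed simp
  ultimately show ?thesis
    by blast
qed

text \<open>
  The test vectors live in a single block: with head \<open>h\<close> and tail \<open>- c\<close> times the tail of \<open>s\<close>.  The choice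
  \<open>c = 1\<close> is decisive unless the tail of \<open>s\<close> vanishes, in which case \<open>c = 0\<close> is enough.
\<close>

lemma prod_cone_self_dual:
  assumes "\<And>x. x \<in> prod_cone D \<Longrightarrow> 0 \<le> s \<bullet> x"
  shows "s \<in> prod_cone D"
proof -
  have "tail_norm D i s \<le> s $ head_of D i" for i
  proof -
    let ?t = "tail_norm D i s"
    have test: "0 \<le> s $ head_of D i * h - c * ?t\<^sup>2" if h: "\<bar>c\<bar> * ?t \<le> h" for c h
    proof -
      define x where "x = (\<chi> j. if j = head_of D i then h else if j \<in> tail D i then - c * s $ j else 0)"
      have head_x: "x $ head_of D k = (if k = i then h else 0)" for k
      proof (cases "k = i")
        case False
        then have "head_of D k \<noteq> head_of D i" "head_of D k \<notin> tail D i"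
          by (metis head) (use False in \<open>simp add: tail_def\<close>)
        with False show ?thesis
          by (simp add: x_def)
      qed (simp add: x_def)
      have x_tail: "x $ j = - c * s $ j" if "j \<in> tail D i" for j
        using that by (auto simp: x_def)
      have x_off: "x $ j = 0" if "block_of D j \<noteq> i" for j
        using that by (auto simp: x_def tail_def)
      have tail_x: "tail_norm D k x = (if k = i then \<bar>c\<bar> * ?t else 0)" for k
      proof (cases "k = i")
        case True
        have "(tail_norm D i x)\<^sup>2 = (tail_norm D i ((- c) *\<^sub>R s))\<^sup>2"
          unfolding tail_norm_square by (intro sum.cong) (auto simp: x_tail)
        then have "tail_norm D i x = tail_norm D i ((- c) *\<^sub>R s)"
          by (simp only: power2_eq_iff_nonneg tail_norm_nonneg)
        also have "\<dots> = \<bar>c\<bar> * ?t"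
          by (simp only: tail_norm_scale abs_minus_cancel)
        finally show ?thesis
          using True by (simp only: simp_thms if_True)
      next
        case False
        then have "(tail_norm D k x)\<^sup>2 = 0"
          unfolding tail_norm_square by (intro sum.neutral) (auto simp: tail_def x_off)
        with False show ?thesis
          by (simp only: if_False zero_eq_power2)
      qed
      have "x \<in> prod_cone D"
        unfolding prod_cone_def in_cone_def mem_Collect_eq head_x tail_x using h by simp
      then have "0 \<le> s \<bullet> x"
        by (rule assms)
      also have "s \<bullet> x = (\<Sum>j | block_of D j = i. s $ j * x $ j)"
        unfolding inner_vec_def by (intro sum.mono_neutral_cong_right) (auto simp: x_off)
      also have "\<dots> = s $ head_of D i * x $ head_of D i + (\<Sum>j\<in>tail D i. s $ j * x $ j)"
        unfolding block_eq by (rule sum.insert) simp_all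
      also have "\<dots> = s $ head_of D i * h + (\<Sum>j\<in>tail D i. - c * (s $ j)\<^sup>2)"
        by (intro arg_cong2[where f = "(+)"] sum.cong)
          (simp_all add: head_x x_tail power2_eq_square)
      also have "(\<Sum>j\<in>tail D i. - c * (s $ j)\<^sup>2) = - c * ?t\<^sup>2"
        by (simp only: tail_norm_square sum_distrib_left)
      finally show ?thesis
        by (simp only: minus_mult_left diff_conv_add_uminus)
    qed
    show ?thesis
    proof (cases "?t = 0")
      case True
      have "0 \<le> s $ head_of D i"
        using test[of 0 1] by simp
      then show ?thesis
        unfolding True .
    next
      case False
      then have "0 < ?t"
        using tail_norm_nonneg[of D i s] by linarith
      moreover have "0 \<le> (s $ head_of D i - ?t) * ?t"
        using test[of 1 ?t] by (simp add: power2_eq_square left_diff_distrib)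
      ultimately show ?thesis
        by (simp add: zero_le_mult_iff)
    qed
  qed
  then show ?thesis
    by (simp add: prod_cone_def in_cone_def)
qed

end

section \<open>Optimality conditions and strong duality\<close>

text \<open>
  Feasibility on both sides and zero duality gap.  Unlike the sets of optimal solutions, this relation
  does not mention the optimal value and is closed in all its arguments.
\<close>

definition kkt ::
  "('m::finite, 'n::finite, 'p::finite) socp \<Rightarrow> real \<Rightarrow> real ^ 'n \<Rightarrow> real ^ 'm \<Rightarrow> real ^ 'n \<Rightarrow> bool" where
  "kkt D e x y s \<longleftrightarrow> x \<in> primal_feasible D \<and> (y, s) \<in> dual_feasible D e \<and> x \<bullet> s = 0"

lemma inner_transpose: "x \<bullet> (y v* A) = (A *v x) \<bullet> (y :: real ^ 'm::finite)"
  for A :: "real ^ 'n::finite ^ 'm"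
  by (metis dot_lmul_matrix inner_commute)

lemmas transpose_inner = dot_lmul_matrix inner_transpose

lemma continuous_on_matrix_vector_mult [continuous_intros]:
  fixes A :: "real ^ 'n::finite ^ 'm::finite"
  shows "continuous_on S f \<Longrightarrow> continuous_on S (\<lambda>t. A *v f t)"
  by (rule bounded_linear.continuous_on[OF matrix_vector_mul_bounded_linear])

lemma duality_gap:
  assumes "matA D *v x = rhs D" "(y, s) \<in> dual_feasible D e"
  shows "cost_at D e \<bullet> x = rhs D \<bullet> y + x \<bullet> s"
proof -
  have "cost_at D e \<bullet> x = (transpose (matA D) *v y) \<bullet> x + s \<bullet> x"
    using assms(2) by (auto simp: dual_feasible_def inner_add_left[symmetric])
  then show ?thesis
    by (simp add: transpose_inner assms(1) inner_commute[of s])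
      (simp add: inner_commute)
qed

lemma closed_kkt:
  assumes "closed (prod_cone D)"
  shows "closed {((x, y, s), e). kkt D e x y s}"
proof -
  have eq: "{((x, y, s), e). kkt D e x y s} =
    (\<lambda>q. fst (fst q)) -` prod_cone D \<inter> (\<lambda>q. snd (snd (fst q))) -` prod_cone D
    \<inter> {q. matA D *v fst (fst q) = rhs D}
    \<inter> {q. transpose (matA D) *v fst (snd (fst q)) + snd (snd (fst q)) = cost D + snd q *\<^sub>R dcost D}
    \<inter> {q. fst (fst q) \<bullet> snd (snd (fst q)) = 0}"
    by (auto simp: kkt_def primal_feasible_def dual_feasible_def cost_at_def)
  show ?thesis
    unfolding eq
    by (intro closed_Int closed_Collect_eq closed_vimage[OF assms] continuous_intros)
qed

locale parametric_problem =
  fixes D :: "('m::finite, 'n::finite, 'p::finite) socp"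
  assumes socp: "parametric_socp D"

sublocale parametric_problem \<subseteq> socp_blocks D
  using socp by unfold_locales (simp add: parametric_socp_def)

context parametric_problem
begin

lemma inj_transpose: "inj ((*v) (transpose (matA D)))"
  using socp by (simp add: parametric_socp_def full_rank_injective[symmetric] rank_transpose)

lemma transpose_eq_0: "transpose (matA D) *v y = 0 \<Longrightarrow> y = 0"
  using inj_transpose by (metis injD matrix_vector_mult_0_right)

lemma duality_gap_nonneg:
  assumes "x \<in> primal_feasible D" "(y, s) \<in> dual_feasible D e"
  shows "rhs D \<bullet> y \<le> cost_at D e \<bullet> x"
  using assms duality_gap[of D x y s e] prod_cone_inner_nonneg[of x s]
  by (auto simp: primal_feasible_def dual_feasible_def)

lemma opt_val_eqI:
  assumes "x \<in> primal_feasible D"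
    and "\<And>x'. x' \<in> primal_feasible D \<Longrightarrow> cost_at D e \<bullet> x \<le> cost_at D e \<bullet> x'"
  shows "opt_val D e = ereal (cost_at D e \<bullet> x)"
  unfolding opt_val_def using assms by (intro antisym INF_lower INF_greatest) auto

lemma kkt_opt_val:
  assumes "kkt D e x y s"
  shows "opt_val D e = ereal (cost_at D e \<bullet> x)"
proof (rule opt_val_eqI)
  show "x \<in> primal_feasible D"
    using assms by (simp add: kkt_def)
  fix x' assume "x' \<in> primal_feasible D"
  then show "cost_at D e \<bullet> x \<le> cost_at D e \<bullet> x'"
    using assms duality_gap_nonneg[of x' y s e] duality_gap[of D x y s e]
    by (auto simp: kkt_def primal_feasible_def)
qed

lemma kkt_iff_optimal: "kkt D e x y s \<longleftrightarrow> x \<in> primal_opt D e \<and> (y, s) \<in> dual_opt D e"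
proof
  assume kkt: "kkt D e x y s"
  then show "x \<in> primal_opt D e \<and> (y, s) \<in> dual_opt D e"
    using kkt_opt_val[OF kkt] duality_gap[of D x y s e]
    by (auto simp: kkt_def primal_opt_def dual_opt_def primal_feasible_def)
next
  assume "x \<in> primal_opt D e \<and> (y, s) \<in> dual_opt D e"
  then have "x \<in> primal_feasible D" "(y, s) \<in> dual_feasible D e"
    and "ereal (cost_at D e \<bullet> x) = ereal (rhs D \<bullet> y)"
    by (auto simp: primal_opt_def dual_opt_def)
  then show "kkt D e x y s"
    using duality_gap[of D x y s e] by (auto simp: kkt_def primal_feasible_def)
qed

lemma kkt_exchange:
  "kkt D e x y s \<Longrightarrow> kkt D e x' y' s' \<Longrightarrow> kkt D e x y' s'"
  by (simp add: kkt_iff_optimal)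

lemma kkt_block:
  assumes "kkt D e x y s"
  shows "in_cone D i x" "in_cone D i s" "block_inner D i x s = 0"
  using assms prod_cone_complementary[of x s i]
  by (auto simp: kkt_def primal_feasible_def dual_feasible_def prod_cone_def)

lemma slater_points:
  obtains x0 y0 s0 where "x0 \<in> primal_feasible D" "(y0, s0) \<in> dual_feasible D 0"
    "\<forall>i. in_int D i x0" "\<forall>i. in_int D i s0"
proof -
  from socp obtain x0 y0 s0 where "x0 \<in> primal_feasible D" "(y0, s0) \<in> dual_feasible D 0"
    and "\<forall>i. in_int D i x0 \<and> in_int D i s0"
    unfolding parametric_socp_def by metis
  with that show thesis
    by metis
qed

text \<open>
  Separate the origin from the convex set of attainable pairs of constraint residual and objective
  excess.  The multiplier of the objective cannot vanish, because a strictly feasible primal point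
  exists and the rows of \<open>A\<close> are independent; dividing by it gives the dual solution.
\<close>

lemma strong_duality:
  assumes psi: "opt_val D e = ereal psi"
  obtains y s where "(y, s) \<in> dual_feasible D e" "psi \<le> rhs D \<bullet> y"
proof -
  obtain x0 y0 s0 where x0: "x0 \<in> primal_feasible D" "\<forall>i. in_int D i x0"
    by (rule slater_points)
  let ?c = "cost_at D e" and ?A = "matA D"
  let ?M = "{(?A *v x - rhs D, ?c \<bullet> x - psi + t) | x t. x \<in> prod_cone D \<and> 0 < t}"
  have conv: "convex ?M"
  proof (rule convexI)
    fix p q and a b :: real
    assume "p \<in> ?M" "q \<in> ?M" and ab: "0 \<le> a" "0 \<le> b" "a + b = 1"
    then obtain x t x' t' where
      p: "p = (?A *v x - rhs D, ?c \<bullet> x - psi + t)" "x \<in> prod_cone D" "0 < t" and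
      q: "q = (?A *v x' - rhs D, ?c \<bullet> x' - psi + t')" "x' \<in> prod_cone D" "0 < t'"
      by blast
    have b: "b = 1 - a"
      using ab by simp
    have "0 < a * t + b * t'"
    proof (cases "a = 0")
      case False
      then have "0 < a * t" "0 \<le> b * t'"
        using ab p q by simp_all
      then show ?thesis
        by simp
    qed (use ab q in simp)
    moreover have "a *\<^sub>R x + b *\<^sub>R x' \<in> prod_cone D"
      using p q ab by (intro prod_cone_add prod_cone_scale)
    moreover have "a *\<^sub>R p + b *\<^sub>R q = (?A *v (a *\<^sub>R x + b *\<^sub>R x') - rhs D,
        ?c \<bullet> (a *\<^sub>R x + b *\<^sub>R x') - psi + (a * t + b * t'))"
      unfolding p q b
      by (simp add: matrix_vector_right_distrib matrix_vector_mult_scaleR inner_add_right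
          algebra_simps)
    ultimately show "a *\<^sub>R p + b *\<^sub>R q \<in> ?M"
      by blast
  qed
  have notin: "0 \<notin> ?M"
  proof
    assume "0 \<in> ?M"
    then obtain x t where "x \<in> primal_feasible D" "0 < t" "?c \<bullet> x - psi + t = 0"
      by (auto simp: primal_feasible_def zero_prod_def)
    moreover have "ereal psi \<le> ereal (?c \<bullet> x)"
      unfolding psi[symmetric] opt_val_def using calculation by (intro INF_lower)
    ultimately show False
      by simp
  qed
  from separating_hyperplane_set_0[OF conv notin] obtain l
    where "l \<noteq> 0" and l: "\<forall>q\<in>?M. 0 \<le> l \<bullet> q"
    by (elim exE conjE)
  obtain lam mu where l_eq: "l = (lam, mu)"
    by (cases l)
  define g where "g = transpose ?A *v lam + mu *\<^sub>R ?c"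
  define beta where "beta = lam \<bullet> rhs D + mu * psi"
  have sep: "0 \<le> g \<bullet> x - beta + mu * t" if "x \<in> prod_cone D" "0 < t" for x t
  proof -
    have "0 \<le> l \<bullet> (?A *v x - rhs D, ?c \<bullet> x - psi + t)"
      using that by (intro l[rule_format]) blast
    also have "\<dots> = g \<bullet> x - beta + mu * t"
      by (simp add: l_eq g_def beta_def inner_add_left transpose_inner inner_diff_right algebra_simps)
    finally show ?thesis .
  qed
  have mu: "0 \<le> mu"
  proof (rule ccontr)
    assume "\<not> 0 \<le> mu"
    define t where "t = (\<bar>beta\<bar> + 1) / - mu"
    have "0 < t" "mu * t = - (\<bar>beta\<bar> + 1)"
      using \<open>\<not> 0 \<le> mu\<close> by (simp_all add: t_def divide_simps)
    then show False
      using sep[OF prod_cone_0 \<open>0 < t\<close>] by simp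
  qed
  have ge: "beta \<le> g \<bullet> x" if "x \<in> prod_cone D" for x
  proof (rule field_le_epsilon)
    fix d :: real assume "0 < d"
    then have "mu * (d / (mu + 1)) \<le> d"
      using mu by (simp add: divide_simps)
    moreover have "0 \<le> g \<bullet> x - beta + mu * (d / (mu + 1))"
      using that mu \<open>0 < d\<close> by (intro sep) auto
    ultimately show "beta \<le> g \<bullet> x + d"
      by linarith
  qed
  have beta: "beta \<le> 0"
    using ge[OF prod_cone_0] by simp
  have g: "g \<in> prod_cone D"
  proof (rule prod_cone_self_dual, rule ccontr)
    fix x assume x: "x \<in> prod_cone D" and "\<not> 0 \<le> g \<bullet> x"
    then have "beta \<le> g \<bullet> (((beta - 1) / (g \<bullet> x)) *\<^sub>R x)"
      using beta by (intro ge prod_cone_scale) (auto simp: divide_simps)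
    then show False
      using \<open>\<not> 0 \<le> g \<bullet> x\<close> by simp
  qed
  \<comment> \<open>Otherwise \<open>g = A\<^sup>T lam\<close> would be a point of the cone orthogonal to an interior point.\<close>
  have "mu \<noteq> 0"
  proof
    assume "mu = 0"
    then have "g \<bullet> x0 = beta"
      using x0 by (simp add: g_def beta_def transpose_inner primal_feasible_def)
    moreover have "0 \<le> g \<bullet> x0"
      using g x0(1) by (simp add: prod_cone_inner_nonneg primal_feasible_def)
    ultimately have "g = 0"
      using beta g x0 by (intro prod_cone_interior_complementary[of g x0]) auto
    then have "lam = 0"
      using \<open>mu = 0\<close> by (intro transpose_eq_0) (simp add: g_def)
    with \<open>mu = 0\<close> \<open>l \<noteq> 0\<close> show False
      by (simp add: l_eq zero_prod_def)
  qed
  with mu have "0 < mu"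
    by simp
  show ?thesis
  proof
    have "transpose ?A *v ((- 1 / mu) *\<^sub>R lam) + (1 / mu) *\<^sub>R g = ?c"
      unfolding g_def matrix_vector_mult_scaleR scaleR_add_right using \<open>mu \<noteq> 0\<close> by simp
    then show "((- 1 / mu) *\<^sub>R lam, (1 / mu) *\<^sub>R g) \<in> dual_feasible D e"
      using g \<open>0 < mu\<close> by (simp add: dual_feasible_def prod_cone_scale)
    have "rhs D \<bullet> ((- 1 / mu) *\<^sub>R lam) = psi - beta / mu"
      using \<open>mu \<noteq> 0\<close> by (simp add: beta_def inner_commute field_simps)
    moreover have "beta / mu \<le> 0"
      using beta \<open>0 < mu\<close> by (simp add: divide_nonpos_pos)
    ultimately show "psi \<le> rhs D \<bullet> ((- 1 / mu) *\<^sub>R lam)"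
      by simp
  qed
qed

text \<open>
  The point \<open>e0\<close> lies strictly between \<open>0\<close>, where the dual is strictly feasible, and a point \<open>e1\<close> of the domain
  on the far side, where the dual is feasible by strong duality.  The corresponding convex combination
  of dual points is strictly feasible at \<open>e0\<close>.
\<close>

lemma interior_dom_coercive:
  assumes e0: "e0 \<in> interior (dom_val D)"
  obtains y s mu where "transpose (matA D) *v y + s = cost_at D e0" "0 < mu"
    "\<And>x. x \<in> prod_cone D \<Longrightarrow> mu * norm x \<le> s \<bullet> x"
proof -
  obtain x0 y0 s0 where y0: "(y0, s0) \<in> dual_feasible D 0" and s0: "\<forall>i. in_int D i s0"
    by (rule slater_points)
  obtain d where "d > 0" and d: "ball e0 d \<subseteq> dom_val D"
    using e0 by (meson mem_interior)
  \<comment> \<open>Beyond \<open>e0\<close> as seen from \<open>0\<close>, so that \<open>e0 = t e1\<close> with \<open>0 \<le> t < 1\<close>.\<close>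
  define e1 where "e1 = (if e0 \<ge> 0 then e0 + d / 2 else e0 - d / 2)"
  have "e1 \<in> dom_val D"
    using d \<open>d > 0\<close> by (auto simp: e1_def dist_real_def)
  then obtain psi where "opt_val D e1 = ereal psi"
    by (cases "opt_val D e1") (auto simp: dom_val_def)
  then obtain y1 s1 where y1: "(y1, s1) \<in> dual_feasible D e1"
    by (rule strong_duality)
  define t where "t = e0 / e1"
  have t: "0 \<le> t" "t < 1" "t * e1 = e0"
    using \<open>d > 0\<close> by (auto simp: t_def e1_def divide_simps)
  define y s where "y = (1 - t) *\<^sub>R y0 + t *\<^sub>R y1" and "s = (1 - t) *\<^sub>R s0 + t *\<^sub>R s1"
  have int: "in_int D i s" for i
    unfolding s_def using y1 t by (intro in_int_convex s0[rule_format]) (auto simp: dual_feasible_def prod_cone_def)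
  have "transpose (matA D) *v y + s
      = (1 - t) *\<^sub>R (transpose (matA D) *v y0 + s0) + t *\<^sub>R (transpose (matA D) *v y1 + s1)"
    by (simp add: y_def s_def matrix_vector_right_distrib matrix_vector_mult_scaleR scaleR_add_right)
  also have "\<dots> = (1 - t) *\<^sub>R cost_at D 0 + t *\<^sub>R cost_at D e1"
    using y0 y1 by (simp add: dual_feasible_def)
  also have "\<dots> = cost_at D e0"
    by (simp add: cost_at_def scaleR_add_right t(3)[symmetric] flip: scaleR_add_left)
  finally show thesis
    using that interior_coercive[of s] int by metis
qed

text \<open>
  A strictly feasible dual point at \<open>e0\<close> makes the primal objective coercive uniformly for nearby
  parameters, and a strictly feasible primal point bounds the dual solutions.  What is perturbed with
  the parameter is the coercivity estimate, not the feasibility of the dual point.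
\<close>

lemma kkt_locally_exist_bounded:
  assumes e0: "e0 \<in> interior (dom_val D)"
  obtains d M where "d > 0"
    "\<And>e. \<bar>e - e0\<bar> < d \<Longrightarrow> \<exists>x y s. kkt D e x y s"
    "\<And>e x y s. \<bar>e - e0\<bar> < d \<Longrightarrow> kkt D e x y s \<Longrightarrow> norm (x, y, s) \<le> M"
proof -
  obtain x0 y0 s0 where x0: "x0 \<in> primal_feasible D" "\<forall>i. in_int D i x0"
    by (rule slater_points)
  obtain nu where nu: "nu > 0" "\<And>s. s \<in> prod_cone D \<Longrightarrow> nu * norm s \<le> x0 \<bullet> s"
    using interior_coercive[of x0] x0 by metis
  obtain y1 s1 mu where y1: "transpose (matA D) *v y1 + s1 = cost_at D e0" and mu: "0 < mu"
    and s1: "\<And>x. x \<in> prod_cone D \<Longrightarrow> mu * norm x \<le> s1 \<bullet> x"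
    using interior_dom_coercive[OF e0] by metis
  obtain B where B: "B > 0" "\<And>y. B * norm y \<le> norm (transpose (matA D) *v y)"
    using linear_inj_bounded_below_pos[OF matrix_vector_mul_linear inj_transpose] by metis
  define d where "d = min 1 (mu / (2 * (norm (dcost D) + 1)))"
  have "d > 0"
    using mu by (simp add: d_def add_nonneg_pos)
  define C where "C = norm (cost_at D e0) + norm (dcost D)"
  have cost: "norm (cost_at D e) \<le> C" and cost_ge:
    "x \<in> primal_feasible D \<Longrightarrow> rhs D \<bullet> y1 + mu / 2 * norm x \<le> cost_at D e \<bullet> x"
    if e: "\<bar>e - e0\<bar> < d" for e x
  proof -
    have eq: "cost_at D e = cost_at D e0 + (e - e0) *\<^sub>R dcost D"
      by (simp add: cost_at_def algebra_simps)
    have "\<bar>e - e0\<bar> * norm (dcost D) \<le> 1 * norm (dcost D)"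
      using e by (intro mult_right_mono) (auto simp: d_def)
    then show "norm (cost_at D e) \<le> C"
      using norm_triangle_ineq[of "cost_at D e0" "(e - e0) *\<^sub>R dcost D"] by (simp add: eq C_def)
    assume x: "x \<in> primal_feasible D"
    have "\<bar>(e - e0) *\<^sub>R dcost D \<bullet> x\<bar> \<le> \<bar>e - e0\<bar> * (norm (dcost D) * norm x)"
      using Cauchy_Schwarz_ineq2[of "(e - e0) *\<^sub>R dcost D" x] by simp
    also have "\<dots> \<le> (\<bar>e - e0\<bar> * (norm (dcost D) + 1)) * norm x"
      by (simp add: algebra_simps)
    also have "\<dots> \<le> mu / 2 * norm x"
    proof (rule mult_right_mono)
      have cancel: "mu / (2 * a) * a = mu / 2" if "0 < a" for a :: real
        using that by simp
      have "\<bar>e - e0\<bar> * (norm (dcost D) + 1) \<le> mu / (2 * (norm (dcost D) + 1)) * (norm (dcost D) + 1)"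
        using e by (intro mult_right_mono) (auto simp: d_def)
      also have "\<dots> = mu / 2"
        by (rule cancel) (simp add: add_nonneg_pos)
      finally show "\<bar>e - e0\<bar> * (norm (dcost D) + 1) \<le> mu / 2" .
    qed simp
    finally have pert: "- (mu / 2 * norm x) \<le> (e - e0) *\<^sub>R dcost D \<bullet> x"
      by linarith
    have "cost_at D e \<bullet> x = y1 \<bullet> (matA D *v x) + s1 \<bullet> x + (e - e0) *\<^sub>R dcost D \<bullet> x"
      unfolding eq y1[symmetric] by (simp add: inner_add_left transpose_inner)
    moreover have "mu * norm x \<le> s1 \<bullet> x"
      using x by (intro s1) (simp add: primal_feasible_def)
    ultimately show "rhs D \<bullet> y1 + mu / 2 * norm x \<le> cost_at D e \<bullet> x"
      using pert x by (simp add: primal_feasible_def inner_commute)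
  qed
  have exist: "\<exists>x y s. kkt D e x y s" if e: "\<bar>e - e0\<bar> < d" for e
  proof -
    define L where "L = primal_feasible D \<inter> {x. cost_at D e \<bullet> x \<le> cost_at D e \<bullet> x0}"
    have "closed L"
      unfolding L_def primal_feasible_def using closed_prod_cone
      by (auto intro!: closed_Int closed_Collect_le closed_Collect_eq closed_Collect_conj
          continuous_intros)
    moreover have "bounded L"
    proof (rule boundedI)
      fix x assume "x \<in> L"
      then have "mu / 2 * norm x \<le> cost_at D e \<bullet> x0 - rhs D \<bullet> y1"
        using cost_ge[OF e, of x] by (simp add: L_def)
      then show "norm x \<le> (cost_at D e \<bullet> x0 - rhs D \<bullet> y1) * 2 / mu"
        using mu by (simp add: field_simps)
    qed
    ultimately have "compact L"
      by (simp add: compact_eq_bounded_closed)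
    moreover have "x0 \<in> L"
      using x0 by (simp add: L_def)
    then have "L \<noteq> {}"
      by blast
    ultimately obtain x where x: "x \<in> L" and "\<forall>x'\<in>L. cost_at D e \<bullet> x \<le> cost_at D e \<bullet> x'"
      using continuous_attains_inf[of L "\<lambda>x. cost_at D e \<bullet> x"]
        continuous_on_inner[OF continuous_on_const continuous_on_id] by blast
    then have "cost_at D e \<bullet> x \<le> cost_at D e \<bullet> x'" if "x' \<in> primal_feasible D" for x'
      using that by (cases "x' \<in> L") (auto simp: L_def)
    then have "opt_val D e = ereal (cost_at D e \<bullet> x)"
      using x by (intro opt_val_eqI) (auto simp: L_def)
    then obtain y s where ys: "(y, s) \<in> dual_feasible D e" "cost_at D e \<bullet> x \<le> rhs D \<bullet> y"
      by (rule strong_duality)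
    moreover have xf: "x \<in> primal_feasible D"
      using x by (simp add: L_def)
    moreover have "0 \<le> x \<bullet> s"
      using xf ys by (intro prod_cone_inner_nonneg) (auto simp: primal_feasible_def dual_feasible_def)
    ultimately have "kkt D e x y s"
      using duality_gap[of D x y s e] by (auto simp: kkt_def primal_feasible_def)
    then show ?thesis
      by blast
  qed
  define K where "K = C * norm x0 - rhs D \<bullet> y1"
  define M where "M = K * 2 / mu + ((C + K / nu) / B + K / nu)"
  have bound: "norm (x, y, s) \<le> M" if e: "\<bar>e - e0\<bar> < d" and kkt: "kkt D e x y s" for e x y s
  proof -
    have x: "x \<in> primal_feasible D" "x \<in> prod_cone D" and s: "s \<in> prod_cone D"
      and ys: "(y, s) \<in> dual_feasible D e"
      using kkt by (auto simp: kkt_def primal_feasible_def dual_feasible_def)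
    have "cost_at D e \<bullet> x0 \<le> norm (cost_at D e) * norm x0"
      by (rule norm_cauchy_schwarz)
    also have "\<dots> \<le> C * norm x0"
      using cost[OF e] by (intro mult_right_mono) auto
    finally have K: "cost_at D e \<bullet> x0 - rhs D \<bullet> y1 \<le> K"
      by (simp add: K_def)
    have gap: "cost_at D e \<bullet> x = rhs D \<bullet> y" "cost_at D e \<bullet> x0 = rhs D \<bullet> y + x0 \<bullet> s"
      using duality_gap[OF _ ys] kkt x0(1) by (auto simp: kkt_def primal_feasible_def)
    have "0 \<le> x0 \<bullet> s"
      using nu(2)[OF s] nu(1) by (meson mult_nonneg_nonneg norm_ge_zero order_less_imp_le order_trans)
    have "mu / 2 * norm x \<le> K"
      using cost_ge[OF e x(1)] K gap \<open>0 \<le> x0 \<bullet> s\<close> by linarith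
    then have nx: "norm x \<le> K * 2 / mu"
      using mu by (simp add: field_simps)
    have "0 \<le> mu / 2 * norm x"
      using mu by simp
    then have "nu * norm s \<le> K"
      using nu(2)[OF s] cost_ge[OF e x(1)] K gap by linarith
    then have ns: "norm s \<le> K / nu"
      using nu(1) by (simp add: field_simps)
    have "transpose (matA D) *v y = cost_at D e - s"
      using ys by (auto simp: dual_feasible_def algebra_simps)
    then have "B * norm y \<le> norm (cost_at D e) + norm s"
      using B(2)[of y] norm_triangle_ineq4[of "cost_at D e" s] by simp
    also have "\<dots> \<le> C + K / nu"
      using cost[OF e] ns by (rule add_mono)
    finally have ny: "norm y \<le> (C + K / nu) / B"
      using B(1) by (simp add: field_simps)
    have "norm (x, y, s) \<le> norm x + norm (y, s)"
      by (rule norm_Pair_le)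
    also have "norm (y, s) \<le> norm y + norm s"
      by (rule norm_Pair_le)
    finally show ?thesis
      using nx ns ny unfolding M_def by linarith
  qed
  show thesis
    using \<open>d > 0\<close> exist bound by (rule that)
qed

text \<open>
  Nearby optimal solutions stay bounded, and limits of them are optimal at \<open>e0\<close>; hence they cannot stay
  away from the unique optimal solution.
\<close>

lemma kkt_stability:
  assumes e0: "e0 \<in> interior (dom_val D)"
    and unique: "\<And>x y s. kkt D e0 x y s \<Longrightarrow> (x, y, s) = (xs, ys, ss)"
    and P: "\<forall>\<^sub>F (x, y, s) in nhds (xs, ys, ss). P x y s"
  shows "\<forall>\<^sub>F e in nhds e0. \<exists>x y s. kkt D e x y s \<and> P x y s"
proof -
  obtain U where U: "open U" "(xs, ys, ss) \<in> U" and UP: "\<And>x y s. (x, y, s) \<in> U \<Longrightarrow> P x y s"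
    using P unfolding eventually_nhds by fastforce
  obtain d M where d: "d > 0"
    and exist: "\<And>e. \<bar>e - e0\<bar> < d \<Longrightarrow> \<exists>x y s. kkt D e x y s"
    and bound: "\<And>e x y s. \<bar>e - e0\<bar> < d \<Longrightarrow> kkt D e x y s \<Longrightarrow> norm (x, y, s) \<le> M"
    using kkt_locally_exist_bounded[OF e0] by metis
  have "\<forall>\<^sub>F e in nhds e0. \<forall>q\<in>cball 0 M - U. (q, e) \<notin> {((x, y, s), e). kkt D e x y s}"
  proof (rule closed_relation_near)
    show "compact (cball 0 M - U)"
      using U by (intro compact_diff) auto
  qed (use closed_kkt closed_prod_cone unique U in auto)
  moreover have "\<forall>\<^sub>F e in nhds e0. e \<in> ball e0 d"
    using d by (intro eventually_nhds_in_open) auto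
  ultimately show ?thesis
  proof eventually_elim
    case (elim e)
    then have e: "\<bar>e - e0\<bar> < d"
      by (simp add: dist_real_def abs_minus_commute)
    then obtain x y s where kkt: "kkt D e x y s"
      using exist by blast
    then have "(x, y, s) \<in> U"
      using elim(1) bound[OF e kkt] by (auto dest!: bspec[of _ _ "(x, y, s)"])
    with kkt UP show ?case
      by blast
  qed
qed

end

section \<open>Nondegeneracy as triviality of a kernel\<close>

text \<open>
  The displacements \<open>(dy, ds)\<close> of the dual solution that are compatible to first order with
  complementarity to the primal solution \<open>x\<close>.  Primal nondegeneracy says that there are none but zero,
  and in this form it can be perturbed and compared with other solutions.
\<close>

definition primal_kernel ::
  "('m::finite, 'n::finite, 'p::finite) socp \<Rightarrow> real \<Rightarrow> real ^ 'n \<Rightarrow> real ^ 'm \<Rightarrow> real ^ 'n \<Rightarrow> bool" where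
  "primal_kernel D e x dy ds \<longleftrightarrow>
    transpose (matA D) *v dy + ds = 0 \<and>
    (\<forall>i \<in> setB D e. part D i ds = 0) \<and>
    (\<forall>i \<in> setR D e \<union> setT2 D e. block_parallel D i (reflect D x) ds)"

text \<open>
  The corresponding displacements of the primal solution, as seen from the dual solution \<open>s\<close>.
\<close>

definition dual_kernel ::
  "('m::finite, 'n::finite, 'p::finite) socp \<Rightarrow> real \<Rightarrow> real ^ 'n \<Rightarrow> real ^ 'n \<Rightarrow> bool" where
  "dual_kernel D e s dx \<longleftrightarrow>
    matA D *v dx = 0 \<and>
    (\<forall>i \<in> setN D e. part D i dx = 0) \<and>
    (\<forall>i \<in> setR D e \<union> setT3 D e. block_parallel D i (reflect D s) dx)"

lemma block_parallel_diff:
  "block_parallel D i a d \<Longrightarrow> block_parallel D i a d' \<Longrightarrow> block_parallel D i a (d - d')"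
  by (simp add: block_parallel_def algebra_simps)

lemma block_parallel_scale: "block_parallel D i a d \<Longrightarrow> block_parallel D i a (c *\<^sub>R d)"
  by (simp add: block_parallel_def algebra_simps)

lemma part_diff: "part D i x = 0 \<Longrightarrow> part D i y = 0 \<Longrightarrow> part D i (x - y) = 0"
  by (simp add: part_eq_0_iff)

context parametric_problem
begin

lemma primal_opt_in_cone: "x \<in> primal_opt D e \<Longrightarrow> in_cone D i x"
  by (simp add: primal_opt_def primal_feasible_def prod_cone_def)

lemma dual_opt_in_cone: "(y, s) \<in> dual_opt D e \<Longrightarrow> in_cone D i s"
  by (simp add: dual_opt_def dual_feasible_def prod_cone_def)

lemma setB_complementary:
  assumes "i \<in> setB D e" "(y, s) \<in> dual_opt D e"
  shows "part D i s = 0"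
proof -
  obtain x where "x \<in> primal_opt D e" and int: "in_int D i x"
    using assms(1) by (auto simp: setB_def)
  then have "kkt D e x y s"
    using assms(2) by (simp add: kkt_iff_optimal)
  from kkt_block[OF this] int show ?thesis
    using complementary_interior[of i s x] by (simp add: block_inner_commute)
qed

lemma setN_complementary:
  assumes "i \<in> setN D e" "x \<in> primal_opt D e"
  shows "part D i x = 0"
proof -
  obtain y s where "(y, s) \<in> dual_opt D e" and int: "in_int D i s"
    using assms(1) by (auto simp: setN_def)
  then have "kkt D e x y s"
    using assms(2) by (simp add: kkt_iff_optimal)
  from kkt_block[OF this] int show ?thesis
    by (intro complementary_interior[of i x s])
qed

text \<open>
  A block of \<open>T\<close> cannot have nonzero primal and nonzero dual optimal parts, for these would both be on
  the boundary and put the block into \<open>R\<close>.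
\<close>

lemma partition_cover:
  "setB D e \<union> setN D e \<union> setR D e \<union> setT1 D e \<union> setT2 D e \<union> setT3 D e = UNIV"
proof -
  have "i \<in> setT1 D e \<union> setT2 D e \<union> setT3 D e" if T: "i \<in> setT D e" for i
  proof -
    have x: "part D i x = 0 \<or> in_bd0 D i x" if "x \<in> primal_opt D e" for x
      using T that cone_cases[OF primal_opt_in_cone[OF that], of i] by (auto simp: setT_def setB_def)
    have s: "part D i s = 0 \<or> in_bd0 D i s" if "(y, s) \<in> dual_opt D e" for y s
      using T that cone_cases[OF dual_opt_in_cone[OF that], of i] by (auto simp: setT_def setN_def)
    have "\<not> (in_bd0 D i x \<and> in_bd0 D i s)" if "x \<in> primal_opt D e" "(y, s) \<in> dual_opt D e" for x y s
      using T that by (auto simp: setT_def setR_def)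
    with x s T show ?thesis
      unfolding setT1_def setT2_def setT3_def by blast
  qed
  then show ?thesis
    by (auto simp: setT_def)
qed

lemma setR_setT_not_interior:
  "i \<in> setR D e \<union> setT D e \<Longrightarrow> i \<notin> setB D e \<and> i \<notin> setN D e"
  using setB_complementary[of i e] setN_complementary[of i e]
  by (auto simp: setT_def setR_def in_bd0_def)

text \<open>
  At a boundary point \<open>x\<close> the symmetric arrow matrix annihilates \<open>R x\<close>, so eigenvectors of positive
  eigenvalues are orthogonal to \<open>R x\<close>, that is, tangent to the cone at \<open>x\<close>.
\<close>

lemma positive_eigenvector_orthogonal:
  assumes x: "x $ head_of D i = tail_norm D i x"
    and l: "l > 0" "arrow D i x *v q = l *\<^sub>R q"
  shows "block_inner D i q (reflect D x) = 0"
proof -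
  let ?h = "head_of D i"
  have comp: "l * q $ k = (\<Sum>j\<in>UNIV. arrow D i x $ k $ j * q $ j)" for k
    using arg_cong[OF l(2), of "\<lambda>v. v $ k"] by (simp add: matrix_vector_mult_def)
  have "l * q $ k = (\<Sum>j | block_of D j = i. arrow D i x $ k $ j * q $ j)" for k
    unfolding comp by (rule sum.mono_neutral_right) (auto simp: arrow_def)
  then have comp': "l * q $ k = arrow D i x $ k $ ?h * q $ ?h
      + (\<Sum>j\<in>tail D i. arrow D i x $ k $ j * q $ j)" for k
    by (simp add: block_eq)
  have hd: "l * q $ ?h = x $ ?h * q $ ?h + (\<Sum>j\<in>tail D i. x $ j * q $ j)"
    unfolding comp'[of ?h]
    by (intro arg_cong2[where f = "(+)"] sum.cong) (auto simp: arrow_def tail_def)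
  have tl: "l * q $ k = x $ k * q $ ?h + x $ ?h * q $ k" if k: "k \<in> tail D i" for k
  proof -
    have "(\<Sum>j\<in>tail D i. arrow D i x $ k $ j * q $ j)
        = (\<Sum>j\<in>tail D i. if j = k then x $ ?h * q $ j else 0)"
      using k by (intro sum.cong refl) (auto simp: arrow_def tail_def)
    also have "\<dots> = x $ ?h * q $ k"
      using k by simp
    finally show ?thesis
      unfolding comp'[of k] using k by (simp add: arrow_def tail_def)
  qed
  have "l * (\<Sum>k\<in>tail D i. q $ k * x $ k) = (\<Sum>k\<in>tail D i. (l * q $ k) * x $ k)"
    by (simp add: sum_distrib_left mult.assoc)
  also have "\<dots> = (\<Sum>k\<in>tail D i. q $ ?h * (x $ k)\<^sup>2 + x $ ?h * (x $ k * q $ k))"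
    by (intro sum.cong refl) (simp add: tl power2_eq_square algebra_simps)
  also have "\<dots> = q $ ?h * (tail_norm D i x)\<^sup>2 + x $ ?h * (\<Sum>k\<in>tail D i. x $ k * q $ k)"
    by (simp add: sum.distrib sum_distrib_left tail_norm_square)
  also have "\<dots> = x $ ?h * (l * q $ ?h)"
    unfolding hd x by (simp add: power2_eq_square algebra_simps)
  finally have eq: "l * (\<Sum>k\<in>tail D i. q $ k * x $ k) = x $ ?h * (l * q $ ?h)" .
  have "l * (q $ ?h * x $ ?h - (\<Sum>k\<in>tail D i. q $ k * x $ k)) = 0"
    unfolding right_diff_distrib eq by simp
  with \<open>l > 0\<close> have "q $ ?h * x $ ?h - (\<Sum>k\<in>tail D i. q $ k * x $ k) = 0"
    by simp
  then show ?thesis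
    by (simp add: block_inner_head_tail reflect_tail sum_negf)
qed

text \<open>
  The block of \<open>x\<close> is nonzero because a vanishing arrow matrix has no positive eigenvalue, while
  a block with a nonzero boundary point has at least one tail coordinate and so requires one.
\<close>

lemma primal_nondegenerate_boundary:
  assumes opt: "x \<in> primal_opt D e" and nd: "primal_nondegenerate D e x"
    and i: "i \<in> setR D e \<union> setT2 D e"
  shows "in_bd0 D i x"
proof -
  obtain Q where Q: "positive_eigencols D i x Q"
    using nd i unfolding primal_nondegenerate_def by blast
  obtain x' where x': "in_bd0 D i x'"
    using i by (auto simp: setR_def setT2_def)
  have "tail D i \<noteq> {}"
  proof
    assume "tail D i = {}"
    then have "tail_norm D i x' = 0"
      by (simp add: tail_norm_def)
    then show False
      using in_bd0_head_pos[OF x'] x' by (simp add: in_bd0_def)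
  qed
  then obtain j where j: "j \<in> tail D i"
    by blast
  have "part D i x \<noteq> 0"
  proof
    assume "part D i x = 0"
    then have "x $ k = 0" if "block_of D k = i" for k
      using that by (simp add: part_eq_0_iff)
    then have "arrow D i x = 0"
      by (auto simp: arrow_def vec_eq_iff)
    moreover obtain l where "l > 0" "arrow D i x *v Q j = l *\<^sub>R Q j"
      using Q j by (auto simp: positive_eigencols_def)
    ultimately have "Q j = 0"
      by simp
    moreover have "Q j \<bullet> Q j = 1"
      using Q j unfolding positive_eigencols_def by simp
    ultimately show False
      by simp
  qed
  moreover have "\<not> in_int D i x"
    using setR_setT_not_interior[of i e] i opt by (auto simp: setB_def setT2_def)
  ultimately show ?thesis
    using cone_cases[OF primal_opt_in_cone[OF opt], of i] by blast
qed

text \<open>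
  Such a \<open>dy\<close> is orthogonal to all columns of the matrix of full row rank: on \<open>R\<close> and \<open>T\<^sub>2\<close> because \<open>ds\<close> is a
  multiple of \<open>R x\<close>, on \<open>B\<close> because \<open>ds\<close> vanishes.
\<close>

lemma primal_nondegenerate_kernel:
  assumes opt: "x \<in> primal_opt D e" and nd: "primal_nondegenerate D e x"
    and ker: "primal_kernel D e x dy ds"
  shows "dy = 0 \<and> ds = 0"
proof -
  let ?I = "setR D e \<union> setT2 D e"
  let ?J = "(\<Union>i\<in>?I. tail D i) \<union> {j. block_of D j \<in> setB D e}"
  obtain Q where Q: "\<And>i. i \<in> ?I \<Longrightarrow> positive_eigencols D i x Q"
    and rank: "rank (col_matrix ?J (\<lambda>j. if block_of D j \<in> setB D e then column j (matA D)
      else matA D *v Q j)) = CARD('m)"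
    using nd unfolding primal_nondegenerate_def by blast
  have ds: "transpose (matA D) *v dy = - ds"
    using ker by (simp add: primal_kernel_def eq_neg_iff_add_eq_0)
  have "dy = 0"
  proof (rule full_row_rank_orthogonal[OF rank])
    fix j assume j: "j \<in> ?J"
    show "(if block_of D j \<in> setB D e then column j (matA D) else matA D *v Q j) \<bullet> dy = 0"
    proof (cases "block_of D j \<in> setB D e")
      case True
      have "column j (matA D) \<bullet> dy = (transpose (matA D) *v dy) $ j"
        by (simp add: column_def matrix_vector_mult_def inner_vec_def transpose_def)
      also have "\<dots> = 0"
        unfolding ds using ker True by (auto simp: primal_kernel_def part_eq_0_iff)
      finally show ?thesis
        using True by simp
    next
      case False
      with j obtain i where i: "i \<in> ?I" "j \<in> tail D i"
        by blast
      from Q[OF i(1)] i(2) obtain l where l: "l > 0" "arrow D i x *v Q j = l *\<^sub>R Q j"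
        and part: "part D i (Q j) = Q j"
        by (auto simp: positive_eigencols_def)
      have bd: "in_bd0 D i x"
        by (rule primal_nondegenerate_boundary[OF opt nd i(1)])
      have orth: "block_inner D i (Q j) (reflect D x) = 0"
        using bd l by (intro positive_eigenvector_orthogonal[of x i l]) (auto simp: in_bd0_def)
      have par: "block_parallel D i (reflect D x) ds"
        using ker i(1) by (simp add: primal_kernel_def)
      have "x $ head_of D i * block_inner D i (Q j) ds
          = (\<Sum>k | block_of D k = i. Q j $ k * (x $ head_of D i * ds $ k))"
        by (simp add: block_inner_def sum_distrib_left mult.left_commute)
      also have "\<dots> = (\<Sum>k | block_of D k = i. Q j $ k * (ds $ head_of D i * reflect D x $ k))"
        using par by (intro sum.cong) (auto simp: block_parallel_def)
      also have "\<dots> = ds $ head_of D i * block_inner D i (Q j) (reflect D x)"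
        by (simp add: block_inner_def sum_distrib_left mult.left_commute)
      finally have "block_inner D i (Q j) ds = 0"
        using orth in_bd0_head_pos[OF bd] by simp
      moreover have "Q j \<bullet> ds = block_inner D i (Q j) ds"
      proof -
        have "Q j $ k = 0" if "block_of D k \<noteq> i" for k
          using that by (subst part[symmetric]) (simp add: part_def)
        then show ?thesis
          unfolding inner_vec_def block_inner_def
          by (intro sum.mono_neutral_cong_right) auto
      qed
      moreover have "(matA D *v Q j) \<bullet> dy = Q j \<bullet> (transpose (matA D) *v dy)"
        by (simp add: transpose_inner)
      ultimately show ?thesis
        using False ds by simp
    qed
  qed
  then show ?thesis
    using ker by (simp add: primal_kernel_def)
qed

text \<open>
  If the block of \<open>s\<close> were zero, the matrix would have a zero column and not full column rank.
\<close>

lemma dual_nondegenerate_boundary: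
  assumes opt: "(y, s) \<in> dual_opt D e" and nd: "dual_nondegenerate D e s"
    and i: "i \<in> setR D e \<union> setT3 D e"
  shows "in_bd0 D i s"
proof -
  let ?J = "Inl ` (setR D e \<union> setT3 D e) \<union> Inr ` {j. block_of D j \<in> setB D e \<union> setT1 D e \<union> setT2 D e}"
  let ?f = "case_sum (\<lambda>i. matA D *v part D i (reflect D s)) (\<lambda>j. column j (matA D))"
  have rank: "rank (col_matrix ?J ?f) = card ?J"
    using nd by (simp add: dual_nondegenerate_def Let_def)
  have "part D i s \<noteq> 0"
  proof
    assume "part D i s = 0"
    then have "part D i (reflect D s) = 0"
      by (simp add: part_eq_0_iff)
    then have "(\<Sum>j\<in>?J. (if j = Inl i then 1 else 0) *\<^sub>R ?f j) = 0"
      by (intro sum.neutral) auto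
    from full_column_rank_trivial_kernel[OF rank this, of "Inl i"] i show False
      by simp
  qed
  moreover have "\<not> in_int D i s"
    using setR_setT_not_interior[of i e] i opt by (auto simp: setN_def setT3_def)
  ultimately show ?thesis
    using cone_cases[OF dual_opt_in_cone[OF opt], of i] by blast
qed

text \<open>
  Such a \<open>dx\<close> is a combination of the vectors \<open>R s\<close> on the blocks of \<open>R\<close> and \<open>T\<^sub>3\<close> and of unit vectors on those of
  \<open>B\<close>, \<open>T\<^sub>1\<close>, \<open>T\<^sub>2\<close>; applying \<open>A\<close> gives a relation among the columns of the matrix.
\<close>

lemma dual_nondegenerate_kernel:
  assumes x: "x \<in> primal_opt D e" and opt: "(y, s) \<in> dual_opt D e"
    and nd: "dual_nondegenerate D e s" and ker: "dual_kernel D e s dx"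
  shows "dx = 0"
proof -
  let ?I = "setR D e \<union> setT3 D e"
  let ?K = "setB D e \<union> setT1 D e \<union> setT2 D e"
  let ?J1 = "Inl ` ?I" and ?J2 = "Inr ` {j. block_of D j \<in> ?K}"
  let ?f = "case_sum (\<lambda>i. matA D *v part D i (reflect D s)) (\<lambda>j. column j (matA D))"
  \<comment> \<open>The coefficient of \<open>R s\<close> on a block is the ratio of the head coordinates; the boundary position of
    \<open>s\<close> makes the denominator positive.\<close>
  let ?t = "case_sum (\<lambda>i. dx $ head_of D i / s $ head_of D i) (\<lambda>j. dx $ j)"
  have rank: "rank (col_matrix (?J1 \<union> ?J2) ?f) = card (?J1 \<union> ?J2)"
    using nd by (simp add: dual_nondegenerate_def Let_def)
  have dx_I: "dx $ k = dx $ head_of D i / s $ head_of D i * reflect D s $ k"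
    if "i \<in> ?I" "block_of D k = i" for i k
    using that ker in_bd0_head_pos[OF dual_nondegenerate_boundary[OF opt nd that(1)]]
    by (simp add: dual_kernel_def block_parallel_def field_simps)
  have disj: "?I \<inter> ?K = {}"
    using setR_setT_not_interior[of _ e] x
    by (fastforce simp: setT1_def setT2_def setT3_def setT_def in_bd0_def)
  have dx_eq: "dx = (\<Sum>i\<in>?I. ?t (Inl i) *\<^sub>R part D i (reflect D s))
      + (\<Sum>j | block_of D j \<in> ?K. ?t (Inr j) *\<^sub>R axis j 1)"
  proof (rule vec_eq_iff[THEN iffD2], rule allI)
    fix k
    have 1: "(\<Sum>i\<in>?I. ?t (Inl i) *\<^sub>R part D i (reflect D s)) $ k
        = (if block_of D k \<in> ?I then dx $ k else 0)"
    proof -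
      have "(\<Sum>i\<in>?I. ?t (Inl i) *\<^sub>R part D i (reflect D s)) $ k
          = (\<Sum>i\<in>?I. if block_of D k = i then ?t (Inl i) * reflect D s $ k else 0)"
        by (simp add: part_def if_distrib cong: if_cong)
      also have "\<dots> = (if block_of D k \<in> ?I then ?t (Inl (block_of D k)) * reflect D s $ k else 0)"
        by (rule sum.delta') simp
      finally show ?thesis
        using dx_I[of "block_of D k" k] by simp
    qed
    have 2: "(\<Sum>j | block_of D j \<in> ?K. ?t (Inr j) *\<^sub>R axis j 1) $ k
        = (if block_of D k \<in> ?K then dx $ k else 0)"
    proof -
      have "(\<Sum>j | block_of D j \<in> ?K. ?t (Inr j) *\<^sub>R axis j 1) $ k
          = (\<Sum>j | block_of D j \<in> ?K. if k = j then dx $ j else 0)"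
        by (simp add: axis_def if_distrib cong: if_cong)
      also have "\<dots> = (if k \<in> {j. block_of D j \<in> ?K} then dx $ k else 0)"
        by (rule sum.delta') simp
      finally show ?thesis
        by simp
    qed
    have "dx $ k = 0" if "block_of D k \<notin> ?I" "block_of D k \<notin> ?K"
      using that partition_cover[of e] ker by (auto simp: dual_kernel_def part_eq_0_iff)
    then show "dx $ k = ((\<Sum>i\<in>?I. ?t (Inl i) *\<^sub>R part D i (reflect D s))
      + (\<Sum>j | block_of D j \<in> ?K. ?t (Inr j) *\<^sub>R axis j 1)) $ k"
      unfolding vector_add_component 1 2 using disj by auto
  qed
  have "matA D *v dx = (\<Sum>i\<in>?I. ?t (Inl i) *\<^sub>R (matA D *v part D i (reflect D s)))
      + (\<Sum>j | block_of D j \<in> ?K. ?t (Inr j) *\<^sub>R column j (matA D))"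
    by (subst dx_eq) (simp only: matrix_vector_right_distrib matrix_vector_mult_basis
        matrix_vector_mult_scaleR linear_sum[OF matrix_vector_mul_linear])
  also have "\<dots> = (\<Sum>j\<in>?J1. ?t j *\<^sub>R ?f j) + (\<Sum>j\<in>?J2. ?t j *\<^sub>R ?f j)"
    by (simp add: sum.reindex)
  also have "\<dots> = (\<Sum>j\<in>?J1 \<union> ?J2. ?t j *\<^sub>R ?f j)"
    by (rule sum.union_disjoint[symmetric]) auto
  finally have "(\<Sum>j\<in>?J1 \<union> ?J2. ?t j *\<^sub>R ?f j) = 0"
    using ker by (simp add: dual_kernel_def)
  then have t: "?t j = 0" if "j \<in> ?J1 \<union> ?J2" for j
    using full_column_rank_trivial_kernel[OF rank] that by blast
  have "dx $ k = 0" for k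
  proof -
    consider "block_of D k \<in> ?I" | "block_of D k \<in> ?K" | "block_of D k \<in> setN D e"
      using partition_cover[of e] by blast
    then show ?thesis
    proof cases
      case 1
      then show ?thesis
        using t[of "Inl (block_of D k)"] dx_I[of "block_of D k" k] by auto
    next
      case 2
      then show ?thesis
        using t[of "Inr k"] by auto
    next
      case 3
      then show ?thesis
        using ker by (auto simp: dual_kernel_def part_eq_0_iff)
    qed
  qed
  then show ?thesis
    by (simp add: vec_eq_iff)
qed

text \<open>
  The index sets of the kernel may belong to another parameter \<open>e0\<close>, provided that \<open>N\<close> has not shrunk.  With
  \<open>e = e0\<close> this yields uniqueness under nondegeneracy, with \<open>e\<close> near \<open>e0\<close> uniqueness of the perturbed
  solution.
\<close>

lemma kkt_diff_dual_kernel: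
  assumes kkt: "kkt D e x y s" "kkt D e x' y' s'"
    and N: "setN D e0 \<subseteq> setN D e"
  shows "dual_kernel D e0 s (x' - x)"
proof -
  have k: "kkt D e x' y s"
    using kkt by (rule kkt_exchange[rotated])
  have "matA D *v (x' - x) = 0"
    using kkt by (simp add: kkt_def primal_feasible_def matrix_vector_mult_diff_distrib)
  moreover have "part D i (x' - x) = 0" if "i \<in> setN D e0" for i
    using that N setN_complementary[of i e] kkt
    by (intro part_diff) (auto simp: kkt_iff_optimal)
  moreover have "block_parallel D i (reflect D s) (x' - x)" for i
    using kkt_block[OF kkt(1)] kkt_block[OF k]
    by (intro block_parallel_diff complementary_cone)
  ultimately show ?thesis
    by (simp add: dual_kernel_def)
qed

lemma kkt_diff_primal_kernel:
  assumes kkt: "kkt D e x y s" "kkt D e x' y' s'"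
    and B: "setB D e0 \<subseteq> setB D e"
  shows "primal_kernel D e0 x (y' - y) (s' - s)"
proof -
  have k: "kkt D e x y' s'"
    using kkt by (rule kkt_exchange)
  have "transpose (matA D) *v (y' - y) + (s' - s)
      = (transpose (matA D) *v y' + s') - (transpose (matA D) *v y + s)"
    by (simp add: matrix_vector_mult_diff_distrib)
  also have "\<dots> = 0"
    using kkt by (simp add: kkt_def dual_feasible_def)
  finally have "transpose (matA D) *v (y' - y) + (s' - s) = 0" .
  moreover have "part D i (s' - s) = 0" if "i \<in> setB D e0" for i
    using that B setB_complementary[of i e] kkt
    by (intro part_diff) (auto simp: kkt_iff_optimal)
  moreover have "block_parallel D i (reflect D x) (s' - s)" for i
    using kkt_block[OF kkt(1), of i] kkt_block[OF k, of i]
    by (intro block_parallel_diff complementary_cone) (simp_all add: block_inner_commute)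
  ultimately show ?thesis
    by (simp add: primal_kernel_def)
qed

lemma unique_partition:
  assumes x: "primal_opt D e = {x}" and s: "dual_opt D e = {(y, s)}"
  shows "i \<in> setB D e \<longleftrightarrow> in_int D i x"
    and "i \<in> setN D e \<longleftrightarrow> in_int D i s"
    and "i \<in> setR D e \<longleftrightarrow> in_bd0 D i x \<and> in_bd0 D i s"
    and "i \<in> setT1 D e \<longleftrightarrow> part D i x = 0 \<and> part D i s = 0"
    and "i \<in> setT2 D e \<longleftrightarrow> in_bd0 D i x \<and> part D i s = 0"
    and "i \<in> setT3 D e \<longleftrightarrow> part D i x = 0 \<and> in_bd0 D i s"
proof -
  have xc: "part D i x = 0 \<longleftrightarrow> \<not> in_int D i x \<and> \<not> in_bd0 D i x"
    and sc: "part D i s = 0 \<longleftrightarrow> \<not> in_int D i s \<and> \<not> in_bd0 D i s"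
    using cone_cases[OF primal_opt_in_cone[of x e]] cone_cases[OF dual_opt_in_cone[of y s e]] x s
    by auto
  have excl: "\<not> (in_int D i x \<and> in_bd0 D i x)" "\<not> (in_int D i s \<and> in_bd0 D i s)"
    by (auto simp: in_int_def in_bd0_def)
  show B: "i \<in> setB D e \<longleftrightarrow> in_int D i x" and N: "i \<in> setN D e \<longleftrightarrow> in_int D i s"
    and R: "i \<in> setR D e \<longleftrightarrow> in_bd0 D i x \<and> in_bd0 D i s"
    by (simp_all add: setB_def setN_def setR_def x s)
  have "i \<in> setT D e \<longleftrightarrow> \<not> in_int D i x \<and> \<not> in_int D i s \<and> \<not> (in_bd0 D i x \<and> in_bd0 D i s)"
    using B N R by (auto simp: setT_def)
  then show "i \<in> setT1 D e \<longleftrightarrow> part D i x = 0 \<and> part D i s = 0"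
    and "i \<in> setT2 D e \<longleftrightarrow> in_bd0 D i x \<and> part D i s = 0"
    and "i \<in> setT3 D e \<longleftrightarrow> part D i x = 0 \<and> in_bd0 D i s"
    using xc sc excl by (auto simp: setT1_def setT2_def setT3_def x s)
qed

lemma opt_partition_cong:
  assumes "primal_opt D e = {x}" "dual_opt D e = {(y, s)}"
    and "primal_opt D e' = {x'}" "dual_opt D e' = {(y', s')}"
    and "\<And>i. in_int D i x \<longleftrightarrow> in_int D i x'" "\<And>i. in_bd0 D i x \<longleftrightarrow> in_bd0 D i x'"
    and "\<And>i. in_int D i s \<longleftrightarrow> in_int D i s'" "\<And>i. in_bd0 D i s \<longleftrightarrow> in_bd0 D i s'"
  shows "opt_partition D e = opt_partition D e'"
proof -
  have "in_cone D i x" "in_cone D i x'" "in_cone D i s" "in_cone D i s'" for i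
    using assms by (auto intro: primal_opt_in_cone dual_opt_in_cone)
  then have part: "part D i x = 0 \<longleftrightarrow> part D i x' = 0" "part D i s = 0 \<longleftrightarrow> part D i s' = 0" for i
    using assms by (simp_all add: cone_cases)
  have "setB D e = setB D e'" "setN D e = setN D e'" "setR D e = setR D e'"
    "setT1 D e = setT1 D e'" "setT2 D e = setT2 D e'" "setT3 D e = setT3 D e'"
    by (simp_all add: set_eq_iff unique_partition[OF assms(1,2)] unique_partition[OF assms(3,4)]
        assms(5-8) part)
  then show ?thesis
    by (simp add: opt_partition_def setT_def)
qed

end

section \<open>Persistence of nondegeneracy\<close>

lemma eventually_in_int:
  assumes f: "(f \<longlongrightarrow> x) F" and x: "in_int D i x"
  shows "\<forall>\<^sub>F t in F. in_int D i (f t)"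
proof -
  have "((\<lambda>t. f t $ head_of D i - tail_norm D i (f t)) \<longlongrightarrow> x $ head_of D i - tail_norm D i x) F"
    by (intro tendsto_intros f)
  then have "\<forall>\<^sub>F t in F. 0 < f t $ head_of D i - tail_norm D i (f t)"
    by (rule order_tendstoD) (use x in \<open>simp add: in_int_def\<close>)
  then show ?thesis
    by (simp add: in_int_def)
qed

lemma continuous_on_reflect [continuous_intros]:
  "continuous_on S f \<Longrightarrow> continuous_on S (\<lambda>t. reflect D (f t))"
  unfolding reflect_def
proof (rule continuous_on_vec_lambda)
  fix j assume "continuous_on S f"
  then show "continuous_on S (\<lambda>t. if j = head_of D (block_of D j) then f t $ j else - f t $ j)"
    by (cases "j = head_of D (block_of D j)") (simp_all add: continuous_intros)
qed

lemma closed_block_parallel: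
  assumes "continuous_on UNIV f" "continuous_on UNIV g"
  shows "closed {q. block_parallel D i (f q) (g q)}"
proof -
  have eq: "{q. block_parallel D i (f q) (g q)} = (\<Inter>j\<in>{j. block_of D j = i}.
      {q. f q $ head_of D i * g q $ j = g q $ head_of D i * f q $ j})"
    by (auto simp: block_parallel_def)
  show ?thesis
    unfolding eq by (intro closed_INT ballI closed_Collect_eq continuous_intros assms)
qed

lemma closed_part_eq_0:
  assumes "continuous_on UNIV f"
  shows "closed {q. part D i (f q) = 0}"
proof -
  have eq: "{q. part D i (f q) = 0} = (\<Inter>j\<in>{j. block_of D j = i}. {q. f q $ j = 0})"
    by (auto simp: part_eq_0_iff)
  show ?thesis
    unfolding eq by (intro closed_INT ballI closed_Collect_eq continuous_intros assms)
qed

lemma primal_kernel_persists: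
  assumes "\<And>dy ds. primal_kernel D e x dy ds \<Longrightarrow> dy = 0 \<and> ds = 0"
  shows "\<forall>\<^sub>F x' in nhds x. \<forall>dy ds. primal_kernel D e x' dy ds \<longrightarrow> dy = 0 \<and> ds = 0"
proof -
  let ?Z = "{q. primal_kernel D e (snd q) (fst (fst q)) (snd (fst q))}"
  have eq: "?Z = {q. transpose (matA D) *v fst (fst q) + snd (fst q) = 0}
    \<inter> (\<Inter>i\<in>setB D e. {q. part D i (snd (fst q)) = 0})
    \<inter> (\<Inter>i\<in>setR D e \<union> setT2 D e. {q. block_parallel D i (reflect D (snd q)) (snd (fst q))})"
    unfolding primal_kernel_def by blast
  have "closed ?Z"
    unfolding eq by (intro closed_Int closed_INT ballI closed_Collect_eq closed_part_eq_0
        closed_block_parallel continuous_intros)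
  then have "\<forall>\<^sub>F x' in nhds x. \<forall>d. (d, x') \<in> ?Z \<longrightarrow> d = 0"
  proof (rule trivial_kernel_persists)
    fix d x' and c :: real
    assume "(d, x') \<in> ?Z"
    moreover have "transpose (matA D) *v (c *\<^sub>R fst d) + c *\<^sub>R snd d
        = c *\<^sub>R (transpose (matA D) *v fst d + snd d)"
      by (simp only: matrix_vector_mult_scaleR scaleR_add_right)
    ultimately show "(c *\<^sub>R d, x') \<in> ?Z"
      by (simp add: primal_kernel_def block_parallel_scale part_eq_0_iff)
  qed (use assms in \<open>auto simp: zero_prod_def\<close>)
  then show ?thesis
    by eventually_elim (auto simp: zero_prod_def)
qed

lemma dual_kernel_persists:
  assumes "\<And>dx. dual_kernel D e s dx \<Longrightarrow> dx = 0"
  shows "\<forall>\<^sub>F s' in nhds s. \<forall>dx. dual_kernel D e s' dx \<longrightarrow> dx = 0"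
proof -
  let ?Z = "{q. dual_kernel D e (snd q) (fst q)}"
  have eq: "?Z = {q. matA D *v fst q = 0}
    \<inter> (\<Inter>i\<in>setN D e. {q. part D i (fst q) = 0})
    \<inter> (\<Inter>i\<in>setR D e \<union> setT3 D e. {q. block_parallel D i (reflect D (snd q)) (fst q)})"
    unfolding dual_kernel_def by blast
  have "closed ?Z"
    unfolding eq by (intro closed_Int closed_INT ballI closed_Collect_eq closed_part_eq_0
        closed_block_parallel continuous_intros)
  then have "\<forall>\<^sub>F s' in nhds s. \<forall>d. (d, s') \<in> ?Z \<longrightarrow> d = 0"
    by (rule trivial_kernel_persists)
      (use assms in \<open>auto simp: dual_kernel_def block_parallel_scale part_eq_0_iff
        matrix_vector_mult_scaleR\<close>)
  then show ?thesis
    by eventually_elim auto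
qed

section \<open>The equations defined by G and their linearization\<close>

text \<open>
  The system \<open>G = 0\<close> on \<open>G_space D e0\<close>.  The two cases of dual feasibility are merged into one vector equation,
  which is possible because \<open>z\<close> vanishes on the blocks of \<open>B\<close>, \<open>T\<^sub>1\<close> and \<open>T\<^sub>2\<close>.
\<close>

definition G_eqs ::
  "('m::finite, 'n::finite, 'p::finite) socp \<Rightarrow> real \<Rightarrow> real \<Rightarrow>
    real ^ 'm \<Rightarrow> real ^ 'n \<Rightarrow> real ^ 'n \<Rightarrow> real ^ 'p \<Rightarrow> bool" where
  "G_eqs D e0 e w z u v \<longleftrightarrow>
    matA D *v u = - rhs D \<and> transpose (matA D) *v w + z = cost_at D e \<and>
    (\<forall>i. i \<notin> setR D e0 \<union> setN D e0 \<union> setT3 D e0 \<longrightarrow> part D i z = 0) \<and>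
    (\<forall>i. i \<notin> setR D e0 \<union> setT3 D e0 \<longrightarrow> v $ i = 0) \<and>
    (\<forall>i \<in> setN D e0. part D i u = 0) \<and>
    (\<forall>i \<in> setR D e0 \<union> setT3 D e0.
      (\<forall>j. block_of D j = i \<longrightarrow> u $ j + 2 * (v $ i * reflect D z $ j) = 0) \<and>
      block_inner D i z (reflect D z) = 0)"

text \<open>
  The linearization of \<open>G_eqs\<close> at \<open>(z, v)\<close>; the unknowns \<open>w\<close> and \<open>u\<close> enter \<open>G\<close> linearly.
\<close>

definition G_jacobian_kernel ::
  "('m::finite, 'n::finite, 'p::finite) socp \<Rightarrow> real \<Rightarrow> real ^ 'n \<Rightarrow> real ^ 'p \<Rightarrow>
    real ^ 'm \<Rightarrow> real ^ 'n \<Rightarrow> real ^ 'n \<Rightarrow> real ^ 'p \<Rightarrow> bool" where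
  "G_jacobian_kernel D e0 z v dw dz du dv \<longleftrightarrow>
    matA D *v du = 0 \<and> transpose (matA D) *v dw + dz = 0 \<and>
    (\<forall>i. i \<notin> setR D e0 \<union> setN D e0 \<union> setT3 D e0 \<longrightarrow> part D i dz = 0) \<and>
    (\<forall>i. i \<notin> setR D e0 \<union> setT3 D e0 \<longrightarrow> dv $ i = 0) \<and>
    (\<forall>i \<in> setN D e0. part D i du = 0) \<and>
    (\<forall>i \<in> setR D e0 \<union> setT3 D e0.
      (\<forall>j. block_of D j = i \<longrightarrow>
        du $ j + 2 * (dv $ i * reflect D z $ j + v $ i * reflect D dz $ j) = 0) \<and>
      block_inner D i z (reflect D dz) = 0)"

lemma reflect_add: "reflect D (x + y) = reflect D x + reflect D y"
  and reflect_diff: "reflect D (x - y) = reflect D x - reflect D y"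
  and reflect_scale: "reflect D (c *\<^sub>R x) = c *\<^sub>R reflect D x"
  by (simp_all add: reflect_def vec_eq_iff)

lemma block_inner_left_diff: "block_inner D i (x - y) s = block_inner D i x s - block_inner D i y s"
  and block_inner_left_add: "block_inner D i (x + y) s = block_inner D i x s + block_inner D i y s"
  and block_inner_left_scale: "block_inner D i (c *\<^sub>R x) s = c * block_inner D i x s"
  by (simp_all add: block_inner_def sum_subtractf sum.distrib sum_distrib_left algebra_simps)

lemma block_inner_right_diff: "block_inner D i s (x - y) = block_inner D i s x - block_inner D i s y"
  and block_inner_right_scale: "block_inner D i s (c *\<^sub>R x) = c * block_inner D i s x"
  by (simp_all add: block_inner_commute[of D i s] block_inner_left_diff block_inner_left_scale)

context parametric_problem
begin

lemma partition_disjoint: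
  assumes "kkt D e x y s" "i \<in> setB D e \<union> setT1 D e \<union> setT2 D e"
  shows "i \<notin> setR D e" "i \<notin> setN D e" "i \<notin> setT3 D e"
proof -
  have opt: "x \<in> primal_opt D e" "(y, s) \<in> dual_opt D e"
    using assms(1) by (simp_all add: kkt_iff_optimal)
  have zero: "part D i s' = 0" if "(y', s') \<in> dual_opt D e" for y' s'
    using assms(2) that opt setB_complementary[OF _ that, of i] by (auto simp: setT1_def setT2_def)
  have "\<not> in_int D i s'" if "(y', s') \<in> dual_opt D e" for y' s'
    using zero[OF that] cone_cases[OF dual_opt_in_cone[OF that]] by blast
  then show "i \<notin> setN D e"
    by (auto simp: setN_def)
  show "i \<notin> setR D e" "i \<notin> setT3 D e"
    using zero by (auto simp: setR_def setT3_def in_bd0_def)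
qed

lemma G_zero_iff:
  assumes kkt: "kkt D e0 x y s"
  shows "(w, z, u, v) \<in> G_space D e0 \<and> G_map D e0 (w, z, u, v) e = 0
    \<longleftrightarrow> G_eqs D e0 e w z u v"
proof -
  let ?K = "setB D e0 \<union> setT1 D e0 \<union> setT2 D e0" and ?I = "setR D e0 \<union> setT3 D e0"
  have N: "i \<notin> ?I" if "i \<in> setN D e0" for i
    using setR_setT_not_interior[of i e0] that by (auto simp: setT3_def)
  have K: "i \<notin> ?K" if "i \<in> ?I \<union> setN D e0" for i
    using partition_disjoint[OF kkt, of i] that by blast
  have cover: "i \<in> ?K \<or> i \<in> ?I \<or> i \<in> setN D e0" for i
    using partition_cover[of e0] by blast
  show ?thesis
  proof (cases "(w, z, u, v) \<in> G_space D e0")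
    case False
    then show ?thesis
      by (auto simp: G_space_def G_eqs_def)
  next
    case True
    then have z: "z $ j = 0" if "block_of D j \<in> ?K" for j
      using that partition_disjoint[OF kkt, of "block_of D j"]
      by (auto simp: G_space_def part_eq_0_iff)
    obtain g1 g2 g3 g4 where g: "G_map D e0 (w, z, u, v) e = (g1, g2, g3, g4)"
      by (cases "G_map D e0 (w, z, u, v) e")
    have "g1 = - (matA D *v u) - rhs D"
      using g by (simp add: G_map_def)
    then have "g1 = 0 \<longleftrightarrow> matA D *v u = - rhs D"
      by (metis add.inverse_inverse eq_iff_diff_eq_0)
    moreover have "g2 = 0 \<longleftrightarrow> (\<forall>i\<in>setN D e0. part D i u = 0)
        \<and> (\<forall>i\<in>?I. \<forall>j. block_of D j = i \<longrightarrow> u $ j + 2 * (v $ i * reflect D z $ j) = 0)"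
    proof -
      have "g2 $ j = (if block_of D j \<in> ?I then - (u $ j + 2 * (v $ block_of D j * reflect D z $ j))
          else if block_of D j \<in> setN D e0 then - u $ j else 0)" for j
        using g by (auto simp: G_map_def Let_def)
      then have "g2 $ j = 0 \<longleftrightarrow> (block_of D j \<in> ?I \<longrightarrow> u $ j + 2 * (v $ block_of D j * reflect D z $ j) = 0)
          \<and> (block_of D j \<in> setN D e0 \<longrightarrow> u $ j = 0)" for j
        using N[of "block_of D j"] by (simp only: neg_equal_0_iff_equal split: if_splits) blast
      then show ?thesis
        unfolding part_eq_0_iff vec_eq_iff[of g2] zero_index by blast
    qed
    moreover have "g3 = 0 \<longleftrightarrow> transpose (matA D) *v w + z = cost_at D e"
    proof -
      have "g3 $ j = (if block_of D j \<in> ?K then (transpose (matA D) *v w) $ j - cost D $ j - e * dcost D $ j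
          else if block_of D j \<in> ?I \<union> setN D e0
          then (transpose (matA D) *v w) $ j + z $ j - cost D $ j - e * dcost D $ j else 0)" for j
        using g by (auto simp: G_map_def Let_def)
      then have "g3 $ j = (transpose (matA D) *v w + z - cost_at D e) $ j" for j
        using cover[of "block_of D j"] z[of j] by (auto simp: cost_at_def)
      then have "g3 = transpose (matA D) *v w + z - cost_at D e"
        unfolding vec_eq_iff by blast
      then show ?thesis
        by simp
    qed
    moreover have "g4 = 0 \<longleftrightarrow> (\<forall>i\<in>?I. block_inner D i z (reflect D z) = 0)"
    proof -
      have "g4 $ i = (if i \<in> ?I then block_inner D i z (reflect D z) else 0)" for i
        using g by (auto simp: G_map_def inner_part_reflect_part)
      then show ?thesis
        by (auto simp: vec_eq_iff)
    qed
    ultimately show ?thesis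
      using True unfolding g G_eqs_def by (auto simp: G_space_def zero_prod_def)
  qed
qed

text \<open>
  Since \<open>G\<close> is quadratic, the difference of two values is exactly the derivative at the midpoint applied to the
  difference of the arguments.  Thus injectivity of the Jacobian near a point gives local uniqueness of
  zeros without the inverse function theorem.
\<close>

lemma G_eqs_diff:
  assumes 1: "G_eqs D e0 e w1 z1 u1 v1" and 2: "G_eqs D e0 e w2 z2 u2 v2"
  shows "G_jacobian_kernel D e0 ((1/2) *\<^sub>R (z1 + z2)) ((1/2) *\<^sub>R (v1 + v2))
    (w1 - w2) (z1 - z2) (u1 - u2) (v1 - v2)"
proof -
  have "transpose (matA D) *v (w1 - w2) + (z1 - z2)
      = (transpose (matA D) *v w1 + z1) - (transpose (matA D) *v w2 + z2)"
    by (simp add: matrix_vector_mult_diff_distrib)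
  also have "\<dots> = 0"
    using 1 2 by (simp add: G_eqs_def)
  finally have "transpose (matA D) *v (w1 - w2) + (z1 - z2) = 0" .
  moreover have "matA D *v (u1 - u2) = 0"
    using 1 2 by (simp add: G_eqs_def matrix_vector_mult_diff_distrib)
  moreover have "(u1 - u2) $ j + 2 * ((v1 - v2) $ i * reflect D ((1/2) *\<^sub>R (z1 + z2)) $ j
      + ((1/2) *\<^sub>R (v1 + v2)) $ i * reflect D (z1 - z2) $ j) = 0"
    if "i \<in> setR D e0 \<union> setT3 D e0" "block_of D j = i" for i j
  proof -
    have "u1 $ j + 2 * (v1 $ i * reflect D z1 $ j) = 0" "u2 $ j + 2 * (v2 $ i * reflect D z2 $ j) = 0"
      using 1 2 that by (auto simp: G_eqs_def)
    moreover have "(a1 - a2) + 2 * ((b1 - b2) * (1 / 2 * (r1 + r2)) + 1 / 2 * (b1 + b2) * (r1 - r2))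
        = (a1 + 2 * (b1 * r1)) - (a2 + 2 * (b2 * r2))" for a1 a2 b1 b2 r1 r2 :: real
      by (simp add: field_simps)
    ultimately show ?thesis
      by (simp only: reflect_add reflect_diff reflect_scale vector_add_component
          vector_minus_component vector_scaleR_component) simp
  qed
  moreover have "block_inner D i ((1/2) *\<^sub>R (z1 + z2)) (reflect D (z1 - z2)) = 0"
    if "i \<in> setR D e0 \<union> setT3 D e0" for i
  proof -
    have "block_inner D i z1 (reflect D z1) = 0" "block_inner D i z2 (reflect D z2) = 0"
      using 1 2 that by (auto simp: G_eqs_def)
    moreover have "block_inner D i z2 (reflect D z1) = block_inner D i z1 (reflect D z2)"
      by (metis block_inner_commute block_inner_reflect)
    ultimately show ?thesis
      by (simp add: reflect_diff block_inner_left_add block_inner_left_scale block_inner_right_diff)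
  qed
  moreover have "part D i (z1 - z2) = 0" if "i \<notin> setR D e0 \<union> setN D e0 \<union> setT3 D e0" for i
    using 1 2 that by (intro part_diff) (auto simp: G_eqs_def)
  moreover have "(v1 - v2) $ i = 0" if "i \<notin> setR D e0 \<union> setT3 D e0" for i
    using 1 2 that by (auto simp: G_eqs_def)
  moreover have "part D i (u1 - u2) = 0" if "i \<in> setN D e0" for i
    using 1 2 that by (intro part_diff) (auto simp: G_eqs_def)
  ultimately show ?thesis
    unfolding G_jacobian_kernel_def by blast
qed

end

lemma G_jacobian_kernel_persists:
  assumes "\<And>dw dz du dv. G_jacobian_kernel D e0 z v dw dz du dv \<Longrightarrow> (dw, dz, du, dv) = 0"
  shows "\<forall>\<^sub>F (z', v') in nhds (z, v). \<forall>dw dz du dv.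
    G_jacobian_kernel D e0 z' v' dw dz du dv \<longrightarrow> (dw, dz, du, dv) = 0"
proof -
  let ?Z = "{q. G_jacobian_kernel D e0 (fst (snd q)) (snd (snd q))
    (fst (fst q)) (fst (snd (fst q))) (fst (snd (snd (fst q)))) (snd (snd (snd (fst q))))}"
  let ?dw = "\<lambda>q. fst (fst q)" and ?dz = "\<lambda>q. fst (snd (fst q))"
    and ?du = "\<lambda>q. fst (snd (snd (fst q)))" and ?dv = "\<lambda>q. snd (snd (snd (fst q)))"
  have eq: "?Z = {q. matA D *v ?du q = 0} \<inter> {q. transpose (matA D) *v ?dw q + ?dz q = 0}
    \<inter> (\<Inter>i\<in>- (setR D e0 \<union> setN D e0 \<union> setT3 D e0). {q. part D i (?dz q) = 0})
    \<inter> (\<Inter>i\<in>- (setR D e0 \<union> setT3 D e0). {q. ?dv q $ i = 0})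
    \<inter> (\<Inter>i\<in>setN D e0. {q. part D i (?du q) = 0})
    \<inter> (\<Inter>i\<in>setR D e0 \<union> setT3 D e0. \<Inter>j\<in>{j. block_of D j = i}. {q. ?du q $ j
        + 2 * (?dv q $ i * reflect D (fst (snd q)) $ j + snd (snd q) $ i * reflect D (?dz q) $ j) = 0})
    \<inter> (\<Inter>i\<in>setR D e0 \<union> setT3 D e0. {q. block_inner D i (fst (snd q)) (reflect D (?dz q)) = 0})"
    unfolding G_jacobian_kernel_def by blast
  have "closed ?Z"
    unfolding eq block_inner_def
    by (intro closed_Int closed_INT ballI closed_Collect_eq closed_part_eq_0 continuous_intros)
  then have "\<forall>\<^sub>F p in nhds (z, v). \<forall>d. (d, p) \<in> ?Z \<longrightarrow> d = 0"
  proof (rule trivial_kernel_persists)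
    fix d p and c :: real
    assume d: "(d, p) \<in> ?Z"
    obtain dw dz du dv where d_eq: "d = (dw, dz, du, dv)"
      by (cases d)
    have scale: "(c *\<^sub>R dw) v* matA D = c *\<^sub>R (dw v* matA D)"
      by (metis matrix_vector_mult_scaleR transpose_matrix_vector)
    have "c *\<^sub>R (dw v* matA D) + c *\<^sub>R dz = c *\<^sub>R (transpose (matA D) *v dw + dz)"
      by (simp add: scaleR_add_right)
    also have "\<dots> = 0"
      using d by (simp add: G_jacobian_kernel_def d_eq)
    finally have "c *\<^sub>R (dw v* matA D) + c *\<^sub>R dz = 0" .
    moreover have "c * a + 2 * (c * b * r + t * (c * l)) = c * (a + 2 * (b * r + t * l))"
      for a b r t l :: real
      by (simp add: algebra_simps)
    ultimately show "(c *\<^sub>R d, p) \<in> ?Z"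
      using d by (auto simp: G_jacobian_kernel_def d_eq part_eq_0_iff reflect_scale
          matrix_vector_mult_scaleR block_inner_right_scale scale)
  qed (use assms in \<open>auto simp: zero_prod_def\<close>)
  then show ?thesis
    by eventually_elim auto
qed

section \<open>Around a nondegenerate solution\<close>

locale nondegenerate_solution = parametric_problem D
  for D :: "('m::finite, 'n::finite, 'p::finite) socp" +
  fixes e0 :: real and xs :: "real ^ 'n" and ys :: "real ^ 'm" and ss :: "real ^ 'n"
  assumes e0: "e0 \<in> interior (dom_val D)"
    and xs: "xs \<in> primal_opt D e0" and ss: "(ys, ss) \<in> dual_opt D e0"
    and primal_nd: "primal_nondegenerate D e0 xs" and dual_nd: "dual_nondegenerate D e0 ss"
begin

lemma kkt_start: "kkt D e0 xs ys ss"
  using xs ss by (simp add: kkt_iff_optimal)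

text \<open>
  A second optimal solution differs from the given one by elements of the two kernels.
\<close>

lemma kkt_unique:
  assumes "kkt D e0 x y s"
  shows "x = xs \<and> y = ys \<and> s = ss"
proof -
  have "x - xs = 0"
    by (intro dual_nondegenerate_kernel[OF xs ss dual_nd] kkt_diff_dual_kernel[OF kkt_start assms]) simp
  moreover have "y - ys = 0 \<and> s - ss = 0"
    by (intro primal_nondegenerate_kernel[OF xs primal_nd] kkt_diff_primal_kernel[OF kkt_start assms])
      simp
  ultimately show ?thesis
    by simp
qed

lemma optimal_unique: "primal_opt D e0 = {xs}" "dual_opt D e0 = {(ys, ss)}"
proof -
  have "x = xs" if "x \<in> primal_opt D e0" for x
    using kkt_unique[of x ys ss] that ss by (simp add: kkt_iff_optimal)
  then show "primal_opt D e0 = {xs}"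
    using xs by blast
  have "q = (ys, ss)" if "q \<in> dual_opt D e0" for q
    using kkt_unique[of xs "fst q" "snd q"] that xs by (simp add: kkt_iff_optimal prod_eq_iff)
  then show "dual_opt D e0 = {(ys, ss)}"
    using ss by blast
qed

lemmas partition_start = unique_partition[OF optimal_unique]

text \<open>
  The \<open>v\<close>-component of the starting point of the branch.
\<close>

definition vs :: "real ^ 'p" where
  "vs = (\<chi> i. if i \<in> setR D e0 \<union> setT3 D e0 then 1 / 2 * xs $ head_of D i / ss $ head_of D i else 0)"

lemma G_start_eq: "G_start D e0 xs ys ss = (ys, ss, - xs, vs)"
proof -
  \<comment> \<open>The padding in \<open>G_start\<close> changes nothing, because \<open>ss\<close> vanishes on \<open>B\<close>, \<open>T\<^sub>1\<close> and \<open>T\<^sub>2\<close>.\<close>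
  have "ss $ j = 0" if "block_of D j \<notin> setR D e0 \<union> setN D e0 \<union> setT3 D e0" for j
    using that partition_cover[of e0] setB_complementary[OF _ ss, of "block_of D j"]
      partition_start(4,5)[of "block_of D j"]
    by (auto simp: part_eq_0_iff)
  then show ?thesis
    by (auto simp: G_start_def vs_def vec_eq_iff)
qed

lemma start_parallel:
  assumes "i \<in> setR D e0 \<union> setT3 D e0" "block_of D j = i"
  shows "xs $ j = 2 * vs $ i * reflect D ss $ j"
proof -
  have "in_bd0 D i ss"
    using assms(1) partition_start(3,6)[of i] unfolding Un_iff by argo
  then have "0 < ss $ head_of D i"
    by (rule in_bd0_head_pos)
  moreover have "ss $ head_of D i * xs $ j = xs $ head_of D i * reflect D ss $ j"
    using complementary_cone(1)[OF kkt_block[OF kkt_start]] assms(2)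
    by (simp add: block_parallel_def)
  ultimately show ?thesis
    using assms(1) by (simp add: vs_def field_simps)
qed

text \<open>
  Pairing the first two equations gives \<open>du \<bullet> dz = 0\<close>.  Blockwise this is a sum of nonnegative terms
  \<open>- 2 v\<^sub>i dz \<bullet> R dz\<close> by \<open>tangent_square\<close>, so each vanishes and \<open>dz\<close> is a multiple of \<open>z\<close> on the blocks of \<open>R\<close>,
  where \<open>v\<^sub>i > 0\<close>.  Then \<open>(dw, dz)\<close> lies in the primal kernel, and once it is zero, \<open>du\<close> lies in the dual kernel.
\<close>

lemma G_jacobian_injective:
  assumes ker: "G_jacobian_kernel D e0 ss vs dw dz du dv"
  shows "(dw, dz, du, dv) = 0"
proof -
  let ?I = "setR D e0 \<union> setT3 D e0"
  have Adu: "matA D *v du = 0" and Adw: "transpose (matA D) *v dw + dz = 0"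
    using ker unfolding G_jacobian_kernel_def by blast+
  have N: "part D i du = 0" if "i \<in> setN D e0" for i
    using ker that unfolding G_jacobian_kernel_def by simp
  have dv: "dv $ i = 0" if "i \<notin> ?I" for i
    using ker that unfolding G_jacobian_kernel_def by simp
  have dz0: "part D i dz = 0" if "i \<notin> ?I \<union> setN D e0" for i
    using ker that unfolding G_jacobian_kernel_def by simp
  have tan: "block_inner D i ss (reflect D dz) = 0" if "i \<in> ?I" for i
    using ker that unfolding G_jacobian_kernel_def by blast
  have du: "du $ j = - 2 * (dv $ i * reflect D ss $ j + vs $ i * reflect D dz $ j)"
    if "i \<in> ?I" "block_of D j = i" for i j
  proof -
    have "du $ j + 2 * (dv $ i * reflect D ss $ j + vs $ i * reflect D dz $ j) = 0"
      using ker that unfolding G_jacobian_kernel_def by blast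
    then show ?thesis
      by simp
  qed
  have block: "block_inner D i du dz = (if i \<in> ?I then - 2 * vs $ i * block_inner D i dz (reflect D dz) else 0)"
    for i
  proof (cases "i \<in> ?I")
    case True
    have "block_inner D i du dz = (\<Sum>j | block_of D j = i.
        - 2 * dv $ i * (reflect D ss $ j * dz $ j) - 2 * vs $ i * (reflect D dz $ j * dz $ j))"
      unfolding block_inner_def using True by (intro sum.cong) (auto simp: du[of i] algebra_simps)
    also have "\<dots> = - 2 * dv $ i * block_inner D i (reflect D ss) dz
        - 2 * vs $ i * block_inner D i (reflect D dz) dz"
      by (simp add: block_inner_def sum_subtractf sum_distrib_left sum_negf)
    finally show ?thesis
      using True tan[OF True] by (simp add: block_inner_reflect)
  next
    case False
    then have "part D i du = 0 \<or> part D i dz = 0"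
      using N dz0 by auto
    then show ?thesis
      using False by (metis block_inner_commute block_inner_zero)
  qed
  have bd: "in_bd0 D i ss" if "i \<in> ?I" for i
    using that partition_start(3,6)[of i] by auto
  \<comment> \<open>On \<open>T\<^sub>3\<close> the multiplier is zero, so only the blocks of \<open>R\<close> contribute information on \<open>dz\<close>.\<close>
  have vs_nonneg: "0 \<le> vs $ i" for i
    using cone_head_nonneg[OF kkt_block(1)[OF kkt_start, of i]]
      cone_head_nonneg[OF kkt_block(2)[OF kkt_start, of i]] by (simp add: vs_def)
  have vs_pos: "0 < vs $ i" if "i \<in> setR D e0" for i
    using that partition_start(3)[of i] in_bd0_head_pos by (simp add: vs_def)
  have "dz = - (transpose (matA D) *v dw)"
    using Adw by (metis add.commute eq_neg_iff_add_eq_0)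
  then have "du \<bullet> dz = 0"
    by (simp add: transpose_inner Adu)
  then have "(\<Sum>i\<in>UNIV. block_inner D i du dz) = 0"
    unfolding inner_eq_sum_block_inner[of du dz D] .
  moreover have "0 \<le> block_inner D i du dz" for i
    unfolding block using tangent_square(1)[OF bd tan, of i] vs_nonneg[of i]
    by (simp add: mult_nonneg_nonpos)
  ultimately have "block_inner D i du dz = 0" for i
    by (simp add: sum_nonneg_eq_0_iff)
  then have par: "block_parallel D i ss dz" if "i \<in> setR D e0" for i
    using that block[of i] vs_pos[of i] tangent_square(2)[OF bd tan, of i] by simp
  have "primal_kernel D e0 xs dw dz"
    unfolding primal_kernel_def
  proof (intro conjI ballI)
    fix i assume "i \<in> setB D e0"
    then show "part D i dz = 0"
      using partition_disjoint[OF kkt_start, of i] by (intro dz0) auto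
  next
    fix i assume i: "i \<in> setR D e0 \<union> setT2 D e0"
    show "block_parallel D i (reflect D xs) dz"
    proof (cases "i \<in> setR D e0")
      case True
      have "reflect D xs $ j = 2 * vs $ i * ss $ j" if "block_of D j = i" for j
        using start_parallel[of i j] True that by (simp add: reflect_def split: if_splits)
      then show ?thesis
        using par[OF True] by (simp add: block_parallel_def del: reflect_head)
    next
      case False
      then have "part D i dz = 0"
        using i partition_disjoint[OF kkt_start, of i] by (intro dz0) auto
      then show ?thesis
        by (simp add: block_parallel_def part_eq_0_iff)
    qed
  qed (rule Adw)
  then have dw: "dw = 0" "dz = 0"
    using primal_nondegenerate_kernel[OF xs primal_nd] by blast+
  then have du': "du $ j = - 2 * dv $ block_of D j * reflect D ss $ j" if "block_of D j \<in> ?I" for j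
    using du[OF that refl] by (simp add: reflect_def)
  have "dual_kernel D e0 ss du"
    unfolding dual_kernel_def block_parallel_def using Adu N du' by auto
  then have "du = 0"
    by (rule dual_nondegenerate_kernel[OF xs ss dual_nd])
  moreover have "dv $ i = 0" for i
  proof (cases "i \<in> ?I")
    case True
    then show ?thesis
      using du'[of "head_of D i"] in_bd0_head_pos[OF bd[OF True]] \<open>du = 0\<close> by simp
  qed (rule dv)
  ultimately show ?thesis
    using dw by (simp add: zero_prod_def vec_eq_iff)
qed

end

section \<open>The branch of zeros of G and the optimal partition\<close>

locale zero_branch = nondegenerate_solution D e0 xs ys ss
  for D :: "('m::finite, 'n::finite, 'p::finite) socp"
    and e0 :: real and xs :: "real ^ 'n" and ys :: "real ^ 'm" and ss :: "real ^ 'n" +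
  fixes r :: real
    and w :: "real \<Rightarrow> real ^ 'm" and z u :: "real \<Rightarrow> real ^ 'n" and v :: "real \<Rightarrow> real ^ 'p"
  assumes chi: "is_chi D e0 r (\<lambda>e. (w e, z e, u e, v e))"
begin

lemma branch_start: "w e0 = ys" "z e0 = ss" "u e0 = - xs" "v e0 = vs"
proof -
  obtain x y s where "x \<in> primal_opt D e0" "(y, s) \<in> dual_opt D e0"
    and "(w e0, z e0, u e0, v e0) = G_start D e0 x y s"
    using chi unfolding is_chi_def by blast
  then have "(w e0, z e0, u e0, v e0) = G_start D e0 xs ys ss"
    using optimal_unique by simp
  then show "w e0 = ys" "z e0 = ss" "u e0 = - xs" "v e0 = vs"
    by (simp_all add: G_start_eq)
qed

lemma branch_G_eqs: "\<forall>\<^sub>F e in nhds e0. G_eqs D e0 e (w e) (z e) (u e) (v e)"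
proof -
  have "\<forall>\<^sub>F e in nhds e0. e \<in> {e0 - r<..<e0 + r}"
    using chi by (intro eventually_nhds_in_open) (auto simp: is_chi_def)
  then show ?thesis
  proof eventually_elim
    case (elim e)
    then show ?case
      using chi G_zero_iff[OF kkt_start, of "w e" "z e" "u e" "v e" e] unfolding is_chi_def by blast
  qed
qed

lemma branch_tendsto:
  "(w \<longlongrightarrow> ys) (nhds e0)" "(z \<longlongrightarrow> ss) (nhds e0)" "(u \<longlongrightarrow> - xs) (nhds e0)" "(v \<longlongrightarrow> vs) (nhds e0)"
proof -
  have "((\<lambda>e. (w e, z e, u e, v e)) \<longlongrightarrow> (w e0, z e0, u e0, v e0)) (nhds e0)"
    using chi by (intro real_analytic_on_tendsto[of _ "{e0 - r<..<e0 + r}"]) (auto simp: is_chi_def)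
  then have lim: "((\<lambda>e. (w e, z e, u e, v e)) \<longlongrightarrow> (ys, ss, - xs, vs)) (nhds e0)"
    by (simp add: branch_start)
  show "(w \<longlongrightarrow> ys) (nhds e0)"
    using tendsto_fst[OF lim] by simp
  show "(z \<longlongrightarrow> ss) (nhds e0)"
    using tendsto_fst[OF tendsto_snd[OF lim]] by simp
  show "(u \<longlongrightarrow> - xs) (nhds e0)"
    using tendsto_fst[OF tendsto_snd[OF tendsto_snd[OF lim]]] by simp
  show "(v \<longlongrightarrow> vs) (nhds e0)"
    using tendsto_snd[OF tendsto_snd[OF tendsto_snd[OF lim]]] by simp
qed

text \<open>
  The conditions under which the branch of zeros keeps the three degenerate classes of blocks
  degenerate; near \<open>e0\<close> the zeros of \<open>G\<close> are then optimal solutions.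
\<close>

definition complementary_branch :: "real \<Rightarrow> bool" where
  "complementary_branch e \<longleftrightarrow>
    (\<forall>i\<in>setT1 D e0. part D i (u e) = 0) \<and>
    (\<forall>i\<in>setT2 D e0. (u e $ head_of D i)\<^sup>2 - (tail_norm D i (u e))\<^sup>2 = 0) \<and>
    (\<forall>i\<in>setT3 D e0. v e $ i = 0)"

text \<open>
  The factor by which \<open>x\<close> and \<open>2 R s\<close> are proportional on the blocks of \<open>R\<close> and \<open>T\<^sub>3\<close>.
\<close>

definition multiplier :: "real ^ 'n \<Rightarrow> real ^ 'n \<Rightarrow> real ^ 'p" where
  "multiplier x s = (\<chi> i. if i \<in> setR D e0 \<union> setT3 D e0
    then 1 / 2 * x $ head_of D i / s $ head_of D i else 0)"

text \<open>
  If the partition is unchanged, the blocks of \<open>R\<close> and \<open>T\<^sub>3\<close> of the dual solution stay on the boundary and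
  complementarity makes \<open>x\<close> a multiple of \<open>R s\<close> there, which is what \<open>G\<close> prescribes.
\<close>

lemma kkt_G_eqs:
  assumes kkt: "kkt D e x y s" and part: "opt_partition D e = opt_partition D e0"
    and pos: "\<And>i. i \<in> setR D e0 \<union> setT3 D e0 \<Longrightarrow> 0 < s $ head_of D i"
  shows "G_eqs D e0 e y s (- x) (multiplier x s)"
proof -
  have opt: "x \<in> primal_opt D e" "(y, s) \<in> dual_opt D e"
    using kkt by (simp_all add: kkt_iff_optimal)
  have eq: "setB D e = setB D e0" "setN D e = setN D e0" "setR D e = setR D e0"
    "setT1 D e = setT1 D e0" "setT2 D e = setT2 D e0" "setT3 D e = setT3 D e0"
    using part by (simp_all add: opt_partition_def)
  have zero: "part D i s = 0" if "i \<notin> setR D e0 \<union> setN D e0 \<union> setT3 D e0" for i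
  proof -
    have "i \<in> setB D e \<or> i \<in> setT1 D e \<or> i \<in> setT2 D e"
      using that partition_cover[of e0] unfolding eq by blast
    then show ?thesis
      using setB_complementary[OF _ opt(2)] opt by (auto simp: setT1_def setT2_def)
  qed
  have N: "part D i (- x) = 0" if "i \<in> setN D e0" for i
    using setN_complementary[OF _ opt(1), of i] that unfolding eq by (simp add: part_eq_0_iff)
  have bd: "in_bd0 D i s" if i: "i \<in> setR D e0 \<union> setT3 D e0" for i
  proof -
    have "i \<notin> setN D e"
      using setR_setT_not_interior[of i e] i unfolding eq[symmetric] by (auto simp: setT3_def)
    then have "\<not> in_int D i s"
      using opt(2) by (auto simp: setN_def)
    moreover have "part D i s \<noteq> 0"
      using pos[OF i] by (metis head less_irrefl part_eq_0_iff)
    ultimately show ?thesis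
      using cone_cases[OF kkt_block(2)[OF kkt]] by blast
  qed
  have "block_inner D i s (reflect D s) = 0" if "i \<in> setR D e0 \<union> setT3 D e0" for i
    using in_bd0_square[OF bd[OF that]] by (simp add: block_inner_reflect_self)
  moreover have "(- x) $ j + 2 * (multiplier x s $ i * reflect D s $ j) = 0"
    if i: "i \<in> setR D e0 \<union> setT3 D e0" and j: "block_of D j = i" for i j
  proof -
    have "s $ head_of D i * x $ j = x $ head_of D i * reflect D s $ j"
      using complementary_cone(1)[OF kkt_block[OF kkt], of i] j by (simp add: block_parallel_def)
    then show ?thesis
      using i pos[OF i] by (simp add: multiplier_def field_simps)
  qed
  moreover have "matA D *v (- x) = - rhs D"
    using kkt by (simp add: kkt_def primal_feasible_def linear_neg[OF matrix_vector_mul_linear])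
  moreover have "transpose (matA D) *v y + s = cost_at D e"
    using kkt by (simp add: kkt_def dual_feasible_def)
  moreover have "multiplier x s $ i = 0" if "i \<notin> setR D e0 \<union> setT3 D e0" for i
    using that by (simp add: multiplier_def)
  ultimately show ?thesis
    unfolding G_eqs_def using zero N by blast
qed

lemma complementary_branch_of_kkt:
  assumes kkt: "kkt D e (- u e) y s" and part: "opt_partition D e = opt_partition D e0"
    and v: "v e = multiplier (- u e) s"
  shows "complementary_branch e"
proof -
  have opt: "- u e \<in> primal_opt D e" "(y, s) \<in> dual_opt D e"
    using kkt by (simp_all add: kkt_iff_optimal)
  have eq: "setT1 D e0 = setT1 D e" "setT2 D e0 = setT2 D e" "setT3 D e0 = setT3 D e"
    using part by (simp_all add: opt_partition_def)
  have zero: "part D i (u e) = 0" if "i \<in> setT1 D e \<union> setT3 D e" for i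
  proof -
    have "part D i (- u e) = 0"
      using that opt by (auto simp: setT1_def setT3_def)
    then show ?thesis
      by (simp add: part_eq_0_iff)
  qed
  have bd: "(u e $ head_of D i)\<^sup>2 - (tail_norm D i (u e))\<^sup>2 = 0" if "i \<in> setT2 D e" for i
  proof -
    have "\<not> in_int D i (- u e)"
      using setR_setT_not_interior[of i e] that opt by (auto simp: setT2_def setB_def)
    then have "- u e $ head_of D i = tail_norm D i (- u e)"
      using kkt_block(1)[OF kkt, of i] by (simp add: in_cone_iff)
    moreover have "tail_norm D i (- u e) = tail_norm D i (u e)"
      using tail_norm_scale[of D i "-1" "u e"] by simp
    ultimately show ?thesis
      by (metis cancel_comm_monoid_add_class.diff_cancel power2_minus)
  qed
  have "v e $ i = 0" if "i \<in> setT3 D e" for i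
    using zero[of i] that unfolding v by (simp add: multiplier_def part_eq_0_iff)
  then show ?thesis
    unfolding complementary_branch_def eq using zero bd by auto
qed

text \<open>
  Optimal solutions near \<open>e0\<close> are zeros of \<open>G\<close> close to the starting point; by local uniqueness of zeros they
  are the branch itself, whose blocks therefore inherit their position from the partition.
\<close>

lemma partition_const_imp_complementary_branch:
  assumes const: "\<forall>\<^sub>F e in nhds e0. opt_partition D e = opt_partition D e0"
  shows "\<forall>\<^sub>F e in nhds e0. complementary_branch e"
proof -
  obtain d where "d > 0" and inj: "\<And>z' v' dw dz du dv. dist (z', v') (ss, vs) < d \<Longrightarrow>
      G_jacobian_kernel D e0 z' v' dw dz du dv \<Longrightarrow> (dw, dz, du, dv) = 0"
    using G_jacobian_kernel_persists[of D e0 ss vs, OF G_jacobian_injective]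
    unfolding eventually_nhds_metric by fastforce
  \<comment> \<open>Both zeros are required within distance \<open>d\<close>, so that their midpoint, where the Jacobian is
    evaluated, is within distance \<open>d\<close> as well.\<close>
  define P where "P x y s \<longleftrightarrow> (\<forall>i\<in>setR D e0 \<union> setT3 D e0. 0 < s $ head_of D i) \<and>
    dist (s, multiplier x s) (ss, vs) < d" for x s :: "real ^ 'n" and y :: "real ^ 'm"
  have "\<forall>\<^sub>F (x, y, s) in nhds (xs, ys, ss). P x y s"
  proof -
    let ?F = "nhds (xs, ys, ss)"
    have lim: "(fst \<longlongrightarrow> xs) ?F" "((\<lambda>q. snd (snd q)) \<longlongrightarrow> ss) ?F"
      using tendsto_fst[OF filterlim_ident[of ?F]] tendsto_snd[OF tendsto_snd[OF filterlim_ident[of ?F]]]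
      by simp_all
    have pos: "0 < ss $ head_of D i" if "i \<in> setR D e0 \<union> setT3 D e0" for i
      using dual_nondegenerate_boundary[OF ss dual_nd that] by (rule in_bd0_head_pos)
    have "((\<lambda>q. multiplier (fst q) (snd (snd q)) $ i) \<longlongrightarrow> vs $ i) ?F" for i
    proof (cases "i \<in> setR D e0 \<union> setT3 D e0")
      case True
      have "((\<lambda>q. 1 / 2 * fst q $ head_of D i / snd (snd q) $ head_of D i)
          \<longlongrightarrow> 1 / 2 * xs $ head_of D i / ss $ head_of D i) ?F"
        using pos[OF True] by (intro tendsto_intros lim) auto
      then show ?thesis
        using True by (simp add: multiplier_def vs_def)
    qed (simp add: multiplier_def vs_def)
    then have "((\<lambda>q. multiplier (fst q) (snd (snd q))) \<longlongrightarrow> vs) ?F"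
      by (rule vec_tendstoI)
    then have "((\<lambda>q. (snd (snd q), multiplier (fst q) (snd (snd q)))) \<longlongrightarrow> (ss, vs)) ?F"
      by (intro tendsto_Pair lim)
    then have "\<forall>\<^sub>F q in ?F. dist (snd (snd q), multiplier (fst q) (snd (snd q))) (ss, vs) < d"
      using \<open>d > 0\<close> by (rule tendstoD)
    moreover have "\<forall>\<^sub>F q in ?F. \<forall>i\<in>setR D e0 \<union> setT3 D e0. 0 < snd (snd q) $ head_of D i"
      by (rule eventually_ball_finite) (auto intro!: order_tendstoD(1)[OF tendsto_vec_nth[OF lim(2)]] pos)
    ultimately show ?thesis
      by eventually_elim (auto simp: P_def)
  qed
  then have "\<forall>\<^sub>F e in nhds e0. \<exists>x y s. kkt D e x y s \<and> P x y s"
    using kkt_unique by (intro kkt_stability[OF e0]) auto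
  moreover have "\<forall>\<^sub>F e in nhds e0. dist (z e, v e) (ss, vs) < d"
    using tendsto_Pair[OF branch_tendsto(2,4)] \<open>d > 0\<close> by (rule tendstoD)
  ultimately show ?thesis
    using branch_G_eqs const
  proof eventually_elim
    case (elim e)
    then obtain x y s where kkt: "kkt D e x y s" and P: "P x y s"
      by blast
    have G: "G_eqs D e0 e y s (- x) (multiplier x s)"
      using P by (intro kkt_G_eqs kkt elim) (auto simp: P_def)
    have "(1/2) *\<^sub>R (z e, v e) + (1/2) *\<^sub>R (s, multiplier x s) \<in> ball (ss, vs) d"
      using elim(2) P by (intro convexD[OF convex_ball]) (auto simp: P_def dist_commute)
    then have "dist ((1/2) *\<^sub>R (z e + s), (1/2) *\<^sub>R (v e + multiplier x s)) (ss, vs) < d"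
      by (simp add: dist_commute scaleR_add_right)
    from inj[OF this G_eqs_diff[OF elim(3) G]] have "u e = - x" "v e = multiplier x s"
      by (simp_all only: zero_prod_def prod.inject right_minus_eq)
    then show ?case
      using kkt elim(4) by (intro complementary_branch_of_kkt[of e y s]) auto
  qed
qed

text \<open>
  The negative of \<open>u\<close> together with \<open>w\<close> and \<open>z\<close> is feasible and complementary, hence optimal: interior blocks stay
  interior by continuity, and the other blocks are kept on the boundary or at the origin by \<open>G = 0\<close> and the
  assumption.  It is the only optimal solution because the kernels stay trivial, so the partition is
  determined by the blocks, whose position is the same as at \<open>e0\<close>.
\<close>

lemma complementary_branch_imp_partition_const:
  assumes compl: "\<forall>\<^sub>F e in nhds e0. complementary_branch e"
  shows "\<forall>\<^sub>F e in nhds e0. opt_partition D e = opt_partition D e0"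
proof -
  have lim_x: "((\<lambda>e. - u e) \<longlongrightarrow> xs) (nhds e0)"
    using tendsto_minus[OF branch_tendsto(3)] by simp
  have pos: "\<forall>\<^sub>F e in nhds e0. in_bd0 D i a \<longrightarrow> 0 < f e $ head_of D i"
    if "(f \<longlongrightarrow> a) (nhds e0)" for f a i
    using order_tendstoD(1)[OF tendsto_vec_nth[OF that]] in_bd0_head_pos[of i a]
    by (cases "in_bd0 D i a") simp_all
  have "\<forall>\<^sub>F e in nhds e0. \<forall>i. in_int D i xs \<longrightarrow> in_int D i (- u e)"
    by (intro eventually_all_finite) (auto intro: eventually_in_int[OF lim_x])
  moreover have "\<forall>\<^sub>F e in nhds e0. \<forall>i. in_int D i ss \<longrightarrow> in_int D i (z e)"
    by (intro eventually_all_finite) (auto intro: eventually_in_int[OF branch_tendsto(2)])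
  moreover have "\<forall>\<^sub>F e in nhds e0. \<forall>i. in_bd0 D i xs \<longrightarrow> 0 < (- u e) $ head_of D i"
    by (intro eventually_all_finite pos lim_x)
  moreover have "\<forall>\<^sub>F e in nhds e0. \<forall>i. in_bd0 D i ss \<longrightarrow> 0 < z e $ head_of D i"
    by (intro eventually_all_finite pos branch_tendsto)
  moreover have "\<forall>\<^sub>F e in nhds e0. \<forall>dy ds. primal_kernel D e0 (- u e) dy ds \<longrightarrow> dy = 0 \<and> ds = 0"
    using lim_x primal_kernel_persists[OF primal_nondegenerate_kernel[OF xs primal_nd]]
    by (rule eventually_compose_filterlim[rotated])
  moreover have "\<forall>\<^sub>F e in nhds e0. \<forall>dx. dual_kernel D e0 (z e) dx \<longrightarrow> dx = 0"
    using branch_tendsto(2) dual_kernel_persists[OF dual_nondegenerate_kernel[OF xs ss dual_nd]]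
    by (rule eventually_compose_filterlim[rotated])
  ultimately show ?thesis
    using branch_G_eqs compl
  proof eventually_elim
    case (elim e)
    define x where "x = - u e"
    have u_eq: "u e = - x"
      by (simp add: x_def)
    note int_x = elim(1)[folded x_def, rule_format] and int_s = elim(2)[rule_format]
      and pos_x = elim(3)[folded x_def, rule_format] and pos_s = elim(4)[rule_format]
      and primal_inj = elim(5)[folded x_def] and dual_inj = elim(6) and G = elim(7)
      and compl = elim(8)
    have z0: "part D i (z e) = 0" if "i \<notin> setR D e0 \<union> setN D e0 \<union> setT3 D e0" for i
      using G that by (simp add: G_eqs_def)
    have N0: "part D i x = 0" if "i \<in> setN D e0" for i
      using G that by (auto simp: G_eqs_def part_eq_0_iff x_def)
    have xz: "x $ j = 2 * (v e $ i * reflect D (z e) $ j)"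
      if "i \<in> setR D e0 \<union> setT3 D e0" "block_of D j = i" for i j
    proof -
      have "u e $ j + 2 * (v e $ i * reflect D (z e) $ j) = 0"
        using G that unfolding G_eqs_def by blast
      then show ?thesis
        by (simp add: x_def)
    qed
    have zz: "block_inner D i (z e) (reflect D (z e)) = 0" if "i \<in> setR D e0 \<union> setT3 D e0" for i
      using G that unfolding G_eqs_def by blast
    have bd_z: "in_bd0 D i (z e)" if i: "i \<in> setR D e0 \<union> setT3 D e0" for i
    proof (rule in_bd0I)
      show "0 < z e $ head_of D i"
        using i partition_start(3,6)[of i] by (intro pos_s) auto
      show "(z e $ head_of D i)\<^sup>2 = (tail_norm D i (z e))\<^sup>2"
        using zz[OF i] by (simp add: block_inner_reflect_self)
    qed
    have bd_x: "in_bd0 D i x" if i: "i \<in> setR D e0 \<union> setT2 D e0" for i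
    proof (rule in_bd0I)
      show "0 < x $ head_of D i"
        using i partition_start(3,5)[of i] by (intro pos_x) auto
      show "(x $ head_of D i)\<^sup>2 = (tail_norm D i x)\<^sup>2"
      proof (cases "i \<in> setR D e0")
        case True
        have "block_inner D i x (reflect D x)
            = (\<Sum>j | block_of D j = i. (2 * v e $ i)\<^sup>2 * (z e $ j * reflect D (z e) $ j))"
          unfolding block_inner_def
        proof (rule sum.cong)
          fix j assume "j \<in> {j. block_of D j = i}"
          then have "x $ j = 2 * (v e $ i * reflect D (z e) $ j)"
            using xz True by blast
          then show "x $ j * reflect D x $ j = (2 * v e $ i)\<^sup>2 * (z e $ j * reflect D (z e) $ j)"
            by (simp add: reflect_def power2_eq_square)
        qed simp
        also have "\<dots> = (2 * v e $ i)\<^sup>2 * block_inner D i (z e) (reflect D (z e))"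
          by (simp add: block_inner_def sum_distrib_left)
        finally show ?thesis
          using zz[of i] True by (simp add: block_inner_reflect_self)
      next
        case False
        have "tail_norm D i x = tail_norm D i (u e)"
          using tail_norm_scale[of D i "-1" "u e"] by (simp add: x_def)
        then show ?thesis
          using compl i False by (simp add: complementary_branch_def x_def)
      qed
    qed
    have T13: "part D i x = 0" if i: "i \<in> setT1 D e0 \<union> setT3 D e0" for i
    proof (cases "i \<in> setT1 D e0")
      case True
      then show ?thesis
        using compl by (simp add: complementary_branch_def x_def part_eq_0_iff)
    next
      case False
      then show ?thesis
        using i compl xz[of i] by (auto simp: complementary_branch_def part_eq_0_iff)
    qed
    have status: "(in_int D i x \<longleftrightarrow> in_int D i xs) \<and> (in_bd0 D i x \<longleftrightarrow> in_bd0 D i xs) \<and>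
      (in_int D i (z e) \<longleftrightarrow> in_int D i ss) \<and> (in_bd0 D i (z e) \<longleftrightarrow> in_bd0 D i ss) \<and>
      in_cone D i x \<and> in_cone D i (z e) \<and> block_inner D i x (z e) = 0" for i
    proof -
      have zero: "\<not> in_int D i a" "\<not> in_bd0 D i a" "in_cone D i a" if "part D i a = 0" for a
      proof -
        have head0: "a $ head_of D i = 0" and "tail_norm D i a = tail_norm D i 0"
          using that by (auto simp: part_eq_0_iff intro!: tail_norm_cong)
        then show "in_cone D i a"
          using prod_cone_0 by (simp add: in_cone_def prod_cone_def)
        show "\<not> in_int D i a" "\<not> in_bd0 D i a"
          using in_int_head_pos[of i a] in_bd0_head_pos[of i a] head0 by auto
      qed
      have bd: "\<not> in_int D i a" "in_cone D i a" if "in_bd0 D i a" for a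
        using that by (auto simp: in_int_def in_bd0_def in_cone_def)
      have int: "\<not> in_bd0 D i a" "in_cone D i a" if "in_int D i a" for a
        using that by (auto simp: in_int_def in_bd0_def in_cone_def)
      have orth: "block_inner D i x (z e) = 0" if "part D i x = 0 \<or> part D i (z e) = 0"
        using that by (metis block_inner_commute block_inner_zero)
      consider "i \<in> setB D e0" | "i \<in> setN D e0" | "i \<in> setR D e0" | "i \<in> setT1 D e0"
        | "i \<in> setT2 D e0" | "i \<in> setT3 D e0"
        using partition_cover[of e0] by blast
      then show ?thesis
      proof cases
        case 1
        then have "part D i (z e) = 0" "part D i ss = 0" "in_int D i xs"
          using z0[of i] partition_disjoint[OF kkt_start, of i] setB_complementary[OF 1 ss]
            partition_start(1)[of i] by blast+
        then show ?thesis
          using zero[of "z e"] zero[of ss] int[of x] int[of xs] int_x[of i] orth by blast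
      next
        case 2
        then have "part D i x = 0" "part D i xs = 0" "in_int D i ss"
          using N0[OF 2] setN_complementary[OF 2 xs] partition_start(2)[of i] by blast+
        then show ?thesis
          using zero[of x] zero[of xs] int[of "z e"] int[of ss] int_s[of i] orth by blast
      next
        case 3
        then have "in_bd0 D i x" "in_bd0 D i (z e)" "in_bd0 D i xs" "in_bd0 D i ss"
          using bd_x[of i] bd_z[of i] partition_start(3)[of i] by blast+
        moreover have "block_inner D i x (z e) = 2 * v e $ i * block_inner D i (z e) (reflect D (z e))"
          unfolding block_inner_def sum_distrib_left using xz[of i] 3 by (intro sum.cong) auto
        ultimately show ?thesis
          using bd[of x] bd[of xs] bd[of "z e"] bd[of ss] zz[of i] 3 by simp
      next
        case 4
        then have "part D i x = 0" "part D i xs = 0" "part D i (z e) = 0" "part D i ss = 0"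
          using T13[of i] z0[of i] partition_disjoint[OF kkt_start, of i] partition_start(4)[of i]
          by blast+
        then show ?thesis
          using zero[of x] zero[of xs] zero[of "z e"] zero[of ss] orth by blast
      next
        case 5
        then have "in_bd0 D i x" "in_bd0 D i xs" "part D i (z e) = 0" "part D i ss = 0"
          using bd_x[of i] z0[of i] partition_disjoint[OF kkt_start, of i] partition_start(5)[of i]
          by blast+
        then show ?thesis
          using bd[of x] bd[of xs] zero[of "z e"] zero[of ss] orth by blast
      next
        case 6
        then have "part D i x = 0" "part D i xs = 0" "in_bd0 D i (z e)" "in_bd0 D i ss"
          using T13[of i] bd_z[of i] partition_start(6)[of i] by blast+
        then show ?thesis
          using zero[of x] zero[of xs] bd[of "z e"] bd[of ss] orth by blast
      qed
    qed
    have kkt: "kkt D e x (w e) (z e)"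
    proof -
      have "x \<bullet> z e = 0"
        unfolding inner_eq_sum_block_inner[of x "z e" D] using status by simp
      moreover have "matA D *v x = rhs D"
        using G by (simp add: G_eqs_def u_eq linear_neg[OF matrix_vector_mul_linear])
      moreover have "transpose (matA D) *v w e + z e = cost_at D e"
        using G by (simp add: G_eqs_def)
      ultimately show ?thesis
        using status by (simp add: kkt_def primal_feasible_def dual_feasible_def prod_cone_def)
    qed
    have unique: "x' = x \<and> y' = w e \<and> s' = z e" if kkt': "kkt D e x' y' s'" for x' y' s'
    proof -
      have "setN D e0 \<subseteq> setN D e" "setB D e0 \<subseteq> setB D e"
        using kkt int_x int_s partition_start(1,2)
        by (auto simp: kkt_iff_optimal setN_def setB_def)
      then have "x' - x = 0" "y' - w e = 0 \<and> s' - z e = 0"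
        using dual_inj kkt_diff_dual_kernel[OF kkt kkt'] primal_inj kkt_diff_primal_kernel[OF kkt kkt']
        by blast+
      then show ?thesis
        by simp
    qed
    have opt: "x \<in> primal_opt D e" "(w e, z e) \<in> dual_opt D e"
      using kkt by (simp_all add: kkt_iff_optimal)
    have "x' = x" if "x' \<in> primal_opt D e" for x'
      using unique[of x' "w e" "z e"] that opt by (simp add: kkt_iff_optimal)
    then have 1: "primal_opt D e = {x}"
      using opt by blast
    have "q = (w e, z e)" if "q \<in> dual_opt D e" for q
      using unique[of x "fst q" "snd q"] that opt by (simp add: kkt_iff_optimal prod_eq_iff)
    then have 2: "dual_opt D e = {(w e, z e)}"
      using opt by blast
    show ?case
      using status by (intro opt_partition_cong[OF 1 2 optimal_unique]) blast+
  qed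
qed

end

section \<open>Nonlinearity intervals\<close>

lemma rays_const_subset: "rays_const D S \<Longrightarrow> T \<subseteq> S \<Longrightarrow> rays_const D T"
  unfolding rays_const_def by blast

text \<open>
  An open interval around \<open>e0\<close> on which the partition is constant cannot have constant rays, since \<open>{e0}\<close> is
  a maximal set with that property.  The union of all such intervals around \<open>e0\<close> is the maximal one.
\<close>

lemma nonlinearity_interval_iff_partition_locally_const:
  assumes e0: "e0 \<in> interior (dom_val D)" and inv: "invariancy_set D {e0}"
  shows "(\<exists>S. nonlinearity_interval D S \<and> e0 \<in> S)
    \<longleftrightarrow> (\<forall>\<^sub>F e in nhds e0. opt_partition D e = opt_partition D e0)"
proof
  assume "\<exists>S. nonlinearity_interval D S \<and> e0 \<in> S"
  then obtain S where "open S" "e0 \<in> S" and const: "partition_const D S"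
    by (auto simp: nonlinearity_interval_def nonlinear_on_def)
  then have "\<forall>\<^sub>F e in nhds e0. e \<in> S"
    by (intro eventually_nhds_in_open)
  then show "\<forall>\<^sub>F e in nhds e0. opt_partition D e = opt_partition D e0"
  proof eventually_elim
    case (elim e)
    with const \<open>e0 \<in> S\<close> show ?case
      unfolding partition_const_def by blast
  qed
next
  assume ev: "\<forall>\<^sub>F e in nhds e0. opt_partition D e = opt_partition D e0"
  have "\<forall>\<^sub>F e in nhds e0. e \<in> interior (dom_val D)"
    using e0 by (intro eventually_nhds_in_open) auto
  with ev have "\<forall>\<^sub>F e in nhds e0. opt_partition D e = opt_partition D e0 \<and> e \<in> interior (dom_val D)"
    by (rule eventually_conj)
  then obtain d where "d > 0" and d: "\<And>e. dist e e0 < d \<Longrightarrow>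
      opt_partition D e = opt_partition D e0 \<and> e \<in> interior (dom_val D)"
    unfolding eventually_nhds_metric by blast
  let ?I = "ball e0 d"
  have const: "partition_const D ?I" and dom: "?I \<subseteq> interior (dom_val D)"
    using d by (auto simp: partition_const_def dist_commute)
  have "e0 + d / 2 \<in> ?I" "e0 \<in> ?I" "e0 + d / 2 \<noteq> e0"
    using \<open>d > 0\<close> by (auto simp: dist_real_def)
  then have nontrivial: "\<nexists>t. ?I \<subseteq> {t}"
    by blast
  have "\<not> rays_const D ?I"
  proof
    assume "rays_const D ?I"
    then have "?I = {e0}"
      using inv const dom \<open>e0 \<in> ?I\<close> unfolding invariancy_set_def by blast
    with nontrivial show False
      by blast
  qed
  then have I: "nonlinear_on D ?I"
    using const dom nontrivial by (auto simp: nonlinear_on_def is_interval_ball_real)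
  define U where "U = \<Union>{S. nonlinear_on D S \<and> e0 \<in> S}"
  have "?I \<subseteq> U"
    using I \<open>e0 \<in> ?I\<close> by (auto simp: U_def)
  have "nonlinear_on D U"
    unfolding nonlinear_on_def
  proof (intro conjI)
    show "open U"
      by (auto simp: U_def nonlinear_on_def)
    show "is_interval U"
      unfolding is_interval_connected_1 U_def
      by (rule connected_Union) (auto simp: nonlinear_on_def is_interval_connected_1)
    show "\<nexists>t. U \<subseteq> {t}"
      using nontrivial \<open>?I \<subseteq> U\<close> by blast
    show "U \<subseteq> interior (dom_val D)"
      by (auto simp: U_def nonlinear_on_def)
    have "opt_partition D e = opt_partition D e0" if "e \<in> U" for e
      using that unfolding U_def nonlinear_on_def partition_const_def by blast
    then show "partition_const D U"
      by (simp add: partition_const_def)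
    show "\<not> rays_const D U"
      using \<open>\<not> rays_const D ?I\<close> rays_const_subset[OF _ \<open>?I \<subseteq> U\<close>] by blast
  qed
  moreover have "S' = U" if "U \<subseteq> S'" "nonlinear_on D S'" for S'
  proof
    have "e0 \<in> S'"
      using that(1) \<open>?I \<subseteq> U\<close> \<open>e0 \<in> ?I\<close> by blast
    with that(2) show "S' \<subseteq> U"
      by (auto simp: U_def)
  qed (rule that(1))
  ultimately have "nonlinearity_interval D U"
    unfolding nonlinearity_interval_def by blast
  moreover have "e0 \<in> U"
    using \<open>?I \<subseteq> U\<close> \<open>e0 \<in> ?I\<close> by blast
  ultimately show "\<exists>S. nonlinearity_interval D S \<and> e0 \<in> S"
    by blast
qed

section \<open>The derivative criterion\<close>

context zero_branch
begin

lemma branch_expansion: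
  assumes "bounded_linear L"
  shows "\<exists>F. (\<lambda>h. L (w (e0 + h), z (e0 + h), u (e0 + h), v (e0 + h)) :: real) has_fps_expansion F"
  using chi by (intro real_analytic_on_coordinate_expansion[of _ "{e0 - r<..<e0 + r}", OF _ _ assms])
    (auto simp: is_chi_def)

text \<open>
  The functions in question are analytic and vanish at \<open>e0\<close>, so their derivatives vanish there if and only
  if they are zero near \<open>e0\<close>.
\<close>

lemma derivatives_zero_iff_complementary_branch:
  "(\<forall>k\<ge>1.
      (\<forall>i \<in> setT1 D e0. \<forall>j. block_of D j = i \<longrightarrow> (deriv ^^ k) (\<lambda>e. u e $ j) e0 = 0) \<and>
      (\<forall>i \<in> setT2 D e0.
        (deriv ^^ k) (\<lambda>e. (u e $ head_of D i)\<^sup>2 - (tail_norm D i (u e))\<^sup>2) e0 = 0) \<and>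
      (\<forall>i \<in> setT3 D e0. (deriv ^^ k) (\<lambda>e. v e $ i) e0 = 0))
    \<longleftrightarrow> (\<forall>\<^sub>F e in nhds e0. complementary_branch e)"
proof -
  have "bounded_linear (\<lambda>X :: (real ^ 'm) \<times> (real ^ 'n) \<times> (real ^ 'n) \<times> (real ^ 'p). fst (snd (snd X)) $ j)"
    for j
    by (intro bounded_linear_compose[OF bounded_linear_vec_nth]
        bounded_linear_compose[OF bounded_linear_fst]
        bounded_linear_compose[OF bounded_linear_snd] bounded_linear_snd)
  from branch_expansion[OF this]
  have "\<forall>j. \<exists>F. (\<lambda>h. u (e0 + h) $ j) has_fps_expansion F"
    by simp
  then obtain Fu where Fu: "\<And>j. (\<lambda>h. u (e0 + h) $ j) has_fps_expansion Fu j"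
    by metis
  have "bounded_linear (\<lambda>X :: (real ^ 'm) \<times> (real ^ 'n) \<times> (real ^ 'n) \<times> (real ^ 'p). snd (snd (snd X)) $ i)"
    for i
    by (intro bounded_linear_compose[OF bounded_linear_vec_nth]
        bounded_linear_compose[OF bounded_linear_snd] bounded_linear_snd)
  from branch_expansion[OF this]
  have "\<forall>i. \<exists>F. (\<lambda>h. v (e0 + h) $ i) has_fps_expansion F"
    by simp
  then obtain Fv where Fv: "\<And>i. (\<lambda>h. v (e0 + h) $ i) has_fps_expansion Fv i"
    by metis
  have Fq: "(\<lambda>h. (u (e0 + h) $ head_of D i)\<^sup>2 - (tail_norm D i (u (e0 + h)))\<^sup>2) has_fps_expansion
      (Fu (head_of D i) * Fu (head_of D i) - (\<Sum>j\<in>tail D i. Fu j * Fu j))" for i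
    unfolding tail_norm_square unfolding power2_eq_square by (intro fps_expansion_intros Fu)
  have T1: "(\<forall>k\<ge>1. (deriv ^^ k) (\<lambda>e. u e $ j) e0 = 0) \<longleftrightarrow> (\<forall>\<^sub>F e in nhds e0. u e $ j = 0)"
    if "block_of D j \<in> setT1 D e0" for j
  proof -
    have "u e0 $ j = 0"
      using partition_start(4)[of "block_of D j"] that by (simp add: branch_start part_eq_0_iff)
    then show ?thesis
      using higher_derivs_zero_iff_locally_constant[OF Fu, of j] by simp
  qed
  have T2: "(\<forall>k\<ge>1. (deriv ^^ k) (\<lambda>e. (u e $ head_of D i)\<^sup>2 - (tail_norm D i (u e))\<^sup>2) e0 = 0)
      \<longleftrightarrow> (\<forall>\<^sub>F e in nhds e0. (u e $ head_of D i)\<^sup>2 - (tail_norm D i (u e))\<^sup>2 = 0)"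
    if "i \<in> setT2 D e0" for i
  proof -
    have "in_bd0 D i xs"
      using partition_start(5)[of i] that by blast
    moreover have "tail_norm D i (- xs) = tail_norm D i xs"
      using tail_norm_scale[of D i "-1" xs] by simp
    ultimately have "(u e0 $ head_of D i)\<^sup>2 - (tail_norm D i (u e0))\<^sup>2 = 0"
      by (simp add: branch_start in_bd0_square)
    then show ?thesis
      using higher_derivs_zero_iff_locally_constant[OF Fq, of i] by simp
  qed
  have T3: "(\<forall>k\<ge>1. (deriv ^^ k) (\<lambda>e. v e $ i) e0 = 0) \<longleftrightarrow> (\<forall>\<^sub>F e in nhds e0. v e $ i = 0)"
    if "i \<in> setT3 D e0" for i
  proof -
    have "v e0 $ i = 0"
      using partition_start(6)[of i] that by (simp add: branch_start vs_def part_eq_0_iff)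
    then show ?thesis
      using higher_derivs_zero_iff_locally_constant[OF Fv, of i] by simp
  qed
  have branch: "(\<forall>\<^sub>F e in nhds e0. complementary_branch e) \<longleftrightarrow>
      (\<forall>j\<in>{j. block_of D j \<in> setT1 D e0}. \<forall>\<^sub>F e in nhds e0. u e $ j = 0) \<and>
      (\<forall>i\<in>setT2 D e0. \<forall>\<^sub>F e in nhds e0. (u e $ head_of D i)\<^sup>2 - (tail_norm D i (u e))\<^sup>2 = 0) \<and>
      (\<forall>i\<in>setT3 D e0. \<forall>\<^sub>F e in nhds e0. v e $ i = 0)"
  proof -
    have "complementary_branch e \<longleftrightarrow>
        (\<forall>j\<in>{j. block_of D j \<in> setT1 D e0}. u e $ j = 0) \<and>
        (\<forall>i\<in>setT2 D e0. (u e $ head_of D i)\<^sup>2 - (tail_norm D i (u e))\<^sup>2 = 0) \<and>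
        (\<forall>i\<in>setT3 D e0. v e $ i = 0)" for e
      unfolding complementary_branch_def part_eq_0_iff by blast
    then show ?thesis
      by (simp only: eventually_conj_iff eventually_ball_finite_distrib[OF finite])
  qed
  have swap: "(\<forall>k\<ge>1. (\<forall>i\<in>S1. \<forall>j. block_of D j = i \<longrightarrow> P1 k j) \<and> (\<forall>i\<in>S2. P2 k i) \<and> (\<forall>i\<in>S3. P3 k i))
      \<longleftrightarrow> (\<forall>j\<in>{j. block_of D j \<in> S1}. \<forall>k\<ge>1. P1 k j) \<and> (\<forall>i\<in>S2. \<forall>k\<ge>1. P2 k i) \<and>
        (\<forall>i\<in>S3. \<forall>k\<ge>1. P3 k i)"
    for S1 S2 S3 :: "'p set" and P1 :: "nat \<Rightarrow> 'n \<Rightarrow> bool" and P2 P3 :: "nat \<Rightarrow> 'p \<Rightarrow> bool"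
    by blast
  show ?thesis
    unfolding branch swap
    by (intro arg_cong2[where f = "(\<and>)"] ball_cong refl T1 T2 T3) simp_all
qed

end

theorem theorem4:
  fixes D :: "('m::finite, 'n::finite, 'p::finite) socp"
    and e0 r :: real
    and w :: "real \<Rightarrow> real ^ 'm"
    and z u :: "real \<Rightarrow> real ^ 'n"
    and v :: "real \<Rightarrow> real ^ 'p"
  assumes "parametric_socp D"
    and "e0 \<in> interior (dom_val D)"
    and "invariancy_set D {e0}"
    and "nondegenerate_at D e0"
    and "is_chi D e0 r (\<lambda>e. (w e, z e, u e, v e))"
  shows "(\<exists>S. nonlinearity_interval D S \<and> e0 \<in> S) \<longleftrightarrow>
    (\<forall>k \<ge> 1.
      (\<forall>i \<in> setT1 D e0. \<forall>j. block_of D j = i \<longrightarrow> (deriv ^^ k) (\<lambda>e. u e $ j) e0 = 0) \<and>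
      (\<forall>i \<in> setT2 D e0.
        (deriv ^^ k) (\<lambda>e. (u e $ head_of D i)\<^sup>2 - (tail_norm D i (u e))\<^sup>2) e0 = 0) \<and>
      (\<forall>i \<in> setT3 D e0. (deriv ^^ k) (\<lambda>e. v e $ i) e0 = 0))"
proof -
  obtain xs ys ss where "max_compl D e0 xs ys ss"
    and nd: "primal_nondegenerate D e0 xs" "dual_nondegenerate D e0 ss"
    using assms(4) unfolding nondegenerate_at_def by blast
  then have "xs \<in> primal_opt D e0" "(ys, ss) \<in> dual_opt D e0"
    using rel_interior_subset unfolding max_compl_def by blast+
  then interpret zero_branch D e0 xs ys ss r w z u v
    using assms nd by unfold_locales
  show ?thesis
    unfolding nonlinearity_interval_iff_partition_locally_const[OF assms(2,3)]
      derivatives_zero_iff_complementary_branch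
    using partition_const_imp_complementary_branch complementary_branch_imp_partition_const by blast
qed

end
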